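(* Let $Q$ be a smooth manifold and let $\mathcal{D}\subset TQ$ be a non-integrable distribution of constant rank. Let $\mathcal{D}^{(2)}\subset T\mathcal{D}$ be the submanifold of velocities of admissible curves in $\mathcal{D}$, with inclusion $i_{\mathcal{D}^{(2)}}:\mathcal{D}^{(2)}\hookrightarrow T\mathcal{D}$, and let $\mathcal{L}:\mathcal{D}^{(2)}\to\mathbb{R}$ be a $C^\infty$ function. Let $\omega_{T\mathcal{D}}$ be the canonical symplectic 2-form on $T^{*}T\mathcal{D}$. Then $$\Sigma_{\mathcal{L}}=\{\mu\in T^{*}T\mathcal{D}\mid i_{\mathcal{D}^{(2)}}^{*}\mu=d\mathcal{L}\}\subset T^{*}T\mathcal{D}$$ is a Lagrangian submanifold of $(T^{*}T\mathcal{D},\omega_{T\mathcal{D}})$.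
   Context: $\mathcal{D}$ is regarded as a manifold, the total space of the vector bundle $\tau_{\mathcal{D}}:\mathcal{D}\to Q$; $T\mathcal{D}$ is its tangent bundle and $T^{*}T\mathcal{D}$ is the cotangent bundle of the manifold $T\mathcal{D}$. A curve $\gamma:I\subset\mathbb{R}\to\mathcal{D}$ is admissible if, with $\sigma=\tau_{\mathcal{D}}\circ\gamma$, one has $\gamma(t)=\frac{d\sigma}{dt}(t)$ for all $t$. Define $$\mathcal{D}^{(2)}=\{v\in T\mathcal{D}\mid v=\dot\gamma(0)\text{ for some admissible curve }\gamma:I\to\mathcal{D}\}.$$ If $(q^i)$ are local coordinates on $Q$ and $\{e_A=\rho_A^i(q)\frac{\partial}{\partial q^i}\}$ is a local basis of sections of $\mathcal{D}$, there are induced coordinates $(q^i,y^A)$ on $\mathcal{D}$ (an element $e\in\mathcal{D}_q$ is written $e=y^Ae_A(q)$) and $(q^i,y^A,\dot q^i,\dot y^A)$ on $T\mathcal{D}$; $\mathcal{D}^{(2)}$ is locally the submanifold $\dot q^i=\rho_A^i(q)y^A$, with coordinates $(q^i,y^A,\dot y^A)$. The condition $i_{\mathcal{D}^{(2)}}^{*}\mu=d\mathcal{L}$ on a covector $\mu\in T^{*}_vT\mathcal{D}$ means: $v\in\mathcal{D}^{(2)}$ and $\langle\mu,w\rangle=\langle d\mathcal{L}(v),w\rangle$ for all $w\in T_v\mathcal{D}^{(2)}\subset T_vT\mathcal{D}$. A submanifold $N$ of a symplectic manifold $(P,\omega)$, with inclusion $i_N$, is Lagrangian if $i_N^{*}\omega=0$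 and $\dim N=\frac12\dim P$. For a manifold $M$ the canonical symplectic form on $T^{*}M$ is $\omega_M=-d\theta_M$, where $\theta_M$ is the Liouville 1-form. *)

theory Defs
  imports "HOL-Analysis.Analysis"
begin

section \<open>Smooth maps between open subsets of Euclidean spaces\<close>

text \<open>
  Used for open \<open>S\<close> only.  Since the domain is finite-dimensional, requiring all directional
  derivatives \<open>x \<mapsto> Df(x) v\<close> to be \<open>C\<^sup>k\<close> is the same as requiring this of \<open>Df\<close>.
\<close>

primrec Ck_on :: "nat \<Rightarrow> 'a::euclidean_space set \<Rightarrow> ('a \<Rightarrow> 'b::real_normed_vector) \<Rightarrow> bool" where
  "Ck_on 0 S f \<longleftrightarrow> continuous_on S f"
| "Ck_on (Suc k) S f \<longleftrightarrow>
     (\<forall>x\<in>S. f differentiable (at x)) \<and> (\<forall>v. Ck_on k S (\<lambda>x. frechet_derivative f (at x) v))"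

definition smooth_on :: "'a::euclidean_space set \<Rightarrow> ('a \<Rightarrow> 'b::real_normed_vector) \<Rightarrow> bool" where
  "smooth_on S f \<longleftrightarrow> (\<forall>k. Ck_on k S f)"


section \<open>Smooth manifolds\<close>

text \<open>
  Manifolds have an explicit carrier and an atlas of charts with values in a Euclidean space
  \<open>'e\<close>; the dimension is \<open>DIM('e)\<close>.  The values of \<open>cmap c\<close> outside \<open>cdom c\<close> are irrelevant.
\<close>

datatype ('m, 'e) chart = Chart (cdom: "'m set") (cmap: "'m \<Rightarrow> 'e")

datatype ('m, 'e) mfd = Mfd (points: "'m set") (atlas: "('m, 'e) chart set")

definition chart_inv :: "('m, 'e) chart \<Rightarrow> 'e \<Rightarrow> 'm" where
  "chart_inv c = inv_into (cdom c) (cmap c)"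

definition chart_on :: "'m set \<Rightarrow> ('m, 'e::euclidean_space) chart \<Rightarrow> bool" where
  "chart_on X c \<longleftrightarrow> cdom c \<subseteq> X \<and> inj_on (cmap c) (cdom c) \<and> open (cmap c ` cdom c)"

definition compatible :: "('m, 'e::euclidean_space) chart \<Rightarrow> ('m, 'e) chart \<Rightarrow> bool" where
  "compatible c d \<longleftrightarrow>
     open (cmap c ` (cdom c \<inter> cdom d)) \<and> open (cmap d ` (cdom c \<inter> cdom d)) \<and>
     smooth_on (cmap c ` (cdom c \<inter> cdom d)) (cmap d \<circ> chart_inv c) \<and>
     smooth_on (cmap d ` (cdom c \<inter> cdom d)) (cmap c \<circ> chart_inv d)"

definition mfd_topology :: "('m, 'e::euclidean_space) mfd \<Rightarrow> 'm topology" where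
  "mfd_topology M =
     topology_generated_by {{p \<in> cdom c. cmap c p \<in> V} | c V. c \<in> atlas M \<and> open V}"

definition second_countable_space :: "'m topology \<Rightarrow> bool" where
  "second_countable_space X \<longleftrightarrow>
     (\<exists>\<B>. countable \<B> \<and> (\<forall>B\<in>\<B>. openin X B) \<and>
       (\<forall>U p. openin X U \<and> p \<in> U \<longrightarrow> (\<exists>B\<in>\<B>. p \<in> B \<and> B \<subseteq> U)))"

definition smooth_manifold :: "('m, 'e::euclidean_space) mfd \<Rightarrow> bool" where
  "smooth_manifold M \<longleftrightarrow>
     (\<forall>c\<in>atlas M. chart_on (points M) c) \<and>
     (\<Union>c\<in>atlas M. cdom c) = points M \<and>
     (\<forall>c\<in>atlas M. \<forall>d\<in>atlas M. compatible c d) \<and>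
     Hausdorff_space (mfd_topology M) \<and> second_countable_space (mfd_topology M)"

text \<open>The maximal atlas: all charts of the smooth structure given by \<open>atlas M\<close>.\<close>

definition max_atlas :: "('m, 'e::euclidean_space) mfd \<Rightarrow> ('m, 'e) chart set" where
  "max_atlas M = {c. chart_on (points M) c \<and> (\<forall>d\<in>atlas M. compatible c d)}"

definition chart_at :: "('m, 'e) mfd \<Rightarrow> 'm \<Rightarrow> ('m, 'e) chart" where
  "chart_at M p = (SOME c. c \<in> atlas M \<and> p \<in> cdom c)"

definition smooth_fun :: "('m, 'e::euclidean_space) mfd \<Rightarrow> ('m \<Rightarrow> real) \<Rightarrow> bool" where
  "smooth_fun M f \<longleftrightarrow> (\<forall>c\<in>atlas M. smooth_on (cmap c ` cdom c) (f \<circ> chart_inv c))"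

definition smooth_curve :: "('m, 'e::euclidean_space) mfd \<Rightarrow> real set \<Rightarrow> (real \<Rightarrow> 'm) \<Rightarrow> bool" where
  "smooth_curve M I \<gamma> \<longleftrightarrow> \<gamma> ` I \<subseteq> points M \<and>
     (\<forall>c\<in>atlas M. open {t\<in>I. \<gamma> t \<in> cdom c} \<and> smooth_on {t\<in>I. \<gamma> t \<in> cdom c} (cmap c \<circ> \<gamma>))"


section \<open>Tangent and cotangent bundles\<close>

text \<open>
  A tangent vector at \<open>p\<close> is a pair \<open>(p, \<xi>)\<close> where \<open>\<xi> c\<close> is its vector of components in the
  chart \<open>c\<close>, and these components transform with the derivatives of the coordinate changes.
  Outside the charts of the atlas around \<open>p\<close>, \<open>\<xi>\<close> is set to \<open>0\<close>, so that a tangent vector is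
  determined by its components in one chart.
\<close>

type_synonym ('m, 'e) tvec = "'m \<times> (('m, 'e) chart \<Rightarrow> 'e)"

definition tangent_space :: "('m, 'e::euclidean_space) mfd \<Rightarrow> 'm \<Rightarrow> ('m, 'e) tvec set" where
  "tangent_space M p = {(p, \<xi>) | \<xi>.
     (\<forall>c\<in>atlas M. \<forall>d\<in>atlas M. p \<in> cdom c \<longrightarrow> p \<in> cdom d \<longrightarrow>
        \<xi> d = frechet_derivative (cmap d \<circ> chart_inv c) (at (cmap c p)) (\<xi> c)) \<and>
     (\<forall>c. \<not> (c \<in> atlas M \<and> p \<in> cdom c) \<longrightarrow> \<xi> c = 0)}"

text \<open>
  The tangent vector at \<open>p\<close> with components \<open>u\<close> in the chart \<open>c\<close>, i.e. \<open>u\<^sup>i \<partial>/\<partial>x\<^sup>i\<close>; here \<open>c\<close>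
  may be any chart of the maximal atlas.
\<close>

definition tvec_of ::
    "('m, 'e::euclidean_space) mfd \<Rightarrow> ('m, 'e) chart \<Rightarrow> 'm \<Rightarrow> 'e \<Rightarrow> ('m, 'e) tvec" where
  "tvec_of M c p u = (p, \<lambda>d. if d \<in> atlas M \<and> p \<in> cdom d
     then frechet_derivative (cmap d \<circ> chart_inv c) (at (cmap c p)) u else 0)"

definition tangent_bundle ::
    "('m, 'e::euclidean_space) mfd \<Rightarrow> (('m, 'e) tvec, 'e \<times> 'e) mfd" where
  "tangent_bundle M = Mfd (\<Union>p\<in>points M. tangent_space M p)
     {Chart {v \<in> (\<Union>p\<in>points M. tangent_space M p). fst v \<in> cdom c}
            (\<lambda>v. (cmap c (fst v), snd v c)) | c. c \<in> atlas M}"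

definition velocity ::
    "('m, 'e::euclidean_space) mfd \<Rightarrow> (real \<Rightarrow> 'm) \<Rightarrow> real \<Rightarrow> ('m, 'e) tvec" where
  "velocity M \<gamma> t = (\<gamma> t, \<lambda>c. if c \<in> atlas M \<and> \<gamma> t \<in> cdom c
     then vector_derivative (cmap c \<circ> \<gamma>) (at t) else 0)"

text \<open>
  The tangent map \<open>Tf : TM \<rightarrow> TN\<close> of a smooth map and the differential \<open>df\<close> of a smooth real
  function.  By the chain rule neither depends on the chart selected by \<open>chart_at\<close>.
\<close>

definition tangent_map :: "('m, 'e::euclidean_space) mfd \<Rightarrow> ('n, 'f::euclidean_space) mfd \<Rightarrow>
    ('m \<Rightarrow> 'n) \<Rightarrow> ('m, 'e) tvec \<Rightarrow> ('n, 'f) tvec" where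
  "tangent_map M N f v = (let p = fst v; c = chart_at M p in
     (f p, \<lambda>d. if d \<in> atlas N \<and> f p \<in> cdom d
       then frechet_derivative (cmap d \<circ> f \<circ> chart_inv c) (at (cmap c p)) (snd v c) else 0))"

definition differential ::
    "('m, 'e::euclidean_space) mfd \<Rightarrow> ('m \<Rightarrow> real) \<Rightarrow> ('m, 'e) tvec \<Rightarrow> real" where
  "differential M f v = (let p = fst v; c = chart_at M p in
     frechet_derivative (f \<circ> chart_inv c) (at (cmap c p)) (snd v c))"

text \<open>
  A covector at \<open>p\<close> is a pair \<open>(p, \<alpha>)\<close> with \<open>\<alpha>\<close> a linear functional on the tangent space at
  \<open>p\<close> (whose vector space operations are those of the components), set to \<open>0\<close> elsewhere.
\<close>

type_synonym ('m, 'e) covec = "'m \<times> (('m, 'e) tvec \<Rightarrow> real)"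

definition cotangent_space :: "('m, 'e::euclidean_space) mfd \<Rightarrow> 'm \<Rightarrow> ('m, 'e) covec set" where
  "cotangent_space M p = {(p, \<alpha>) | \<alpha>.
     (\<forall>\<xi> \<eta>. (p, \<xi>) \<in> tangent_space M p \<longrightarrow> (p, \<eta>) \<in> tangent_space M p \<longrightarrow>
        \<alpha> (p, \<lambda>c. \<xi> c + \<eta> c) = \<alpha> (p, \<xi>) + \<alpha> (p, \<eta>)) \<and>
     (\<forall>a \<xi>. (p, \<xi>) \<in> tangent_space M p \<longrightarrow> \<alpha> (p, \<lambda>c. a *\<^sub>R \<xi> c) = a * \<alpha> (p, \<xi>)) \<and>
     (\<forall>v. v \<notin> tangent_space M p \<longrightarrow> \<alpha> v = 0)}"

text \<open>
  The chart of the cotangent bundle induced by \<open>c\<close> is \<open>(x\<^sup>i, p\<^sub>i)\<close> with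
  \<open>p\<^sub>i = \<langle>\<mu>, \<partial>/\<partial>x\<^sup>i\<rangle>\<close>.
\<close>

definition cotangent_bundle ::
    "('m, 'e::euclidean_space) mfd \<Rightarrow> (('m, 'e) covec, 'e \<times> 'e) mfd" where
  "cotangent_bundle M = Mfd (\<Union>p\<in>points M. cotangent_space M p)
     {Chart {\<mu> \<in> (\<Union>p\<in>points M. cotangent_space M p). fst \<mu> \<in> cdom c}
            (\<lambda>\<mu>. (cmap c (fst \<mu>), \<Sum>b\<in>Basis. snd \<mu> (tvec_of M c (fst \<mu>) b) *\<^sub>R b))
      | c. c \<in> atlas M}"


section \<open>Differential forms and the canonical symplectic form\<close>

text \<open>
  A 1-form is a function of a tangent vector, a 2-form a function of two tangent vectors with
  the same base point.  In the exterior derivative, \<open>a u\<close> is the function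
  \<open>x \<mapsto> \<langle>\<alpha>, u\<^sup>i \<partial>/\<partial>x\<^sup>i\<rangle>\<close> in coordinates, so that the formula is
  \<open>d\<alpha>(v,w) = (\<partial>\<^sub>i \<alpha>\<^sub>j - \<partial>\<^sub>j \<alpha>\<^sub>i) v\<^sup>i w\<^sup>j\<close>; for smooth \<open>\<alpha>\<close> it does not depend on the chart.
\<close>

definition ext_deriv :: "('m, 'e::euclidean_space) mfd \<Rightarrow> (('m, 'e) tvec \<Rightarrow> real) \<Rightarrow>
    ('m, 'e) tvec \<Rightarrow> ('m, 'e) tvec \<Rightarrow> real" where
  "ext_deriv M \<alpha> v w = (let p = fst v; c = chart_at M p;
       a = (\<lambda>u x. \<alpha> (tvec_of M c (chart_inv c x) u)) in
     frechet_derivative (a (snd w c)) (at (cmap c p)) (snd v c)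
     - frechet_derivative (a (snd v c)) (at (cmap c p)) (snd w c))"

text \<open>\<open>\<theta>\<^sub>\<mu>(X) = \<langle>\<mu>, T\<pi>(X)\<rangle>\<close> with \<open>\<pi> = fst\<close> the projection of the cotangent bundle.\<close>

definition liouville_form ::
    "('m, 'e::euclidean_space) mfd \<Rightarrow> (('m, 'e) covec, 'e \<times> 'e) tvec \<Rightarrow> real" where
  "liouville_form M X = snd (fst X) (tangent_map (cotangent_bundle M) M fst X)"

definition canonical_symplectic :: "('m, 'e::euclidean_space) mfd \<Rightarrow>
    (('m, 'e) covec, 'e \<times> 'e) tvec \<Rightarrow> (('m, 'e) covec, 'e \<times> 'e) tvec \<Rightarrow> real" where
  "canonical_symplectic M X Y = - ext_deriv (cotangent_bundle M) (liouville_form M) X Y"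


section \<open>Submanifolds\<close>

text \<open>
  The induced manifold structure on a subset \<open>N\<close>, modelled on \<open>'f\<close>: its charts come from the
  slice charts \<open>c\<close> of the ambient manifold, in which \<open>N\<close> is the intersection of the image of
  \<open>c\<close> with a linear subspace; the subspace is given as the range of a linear injection
  \<open>J : 'f \<rightarrow> 'e\<close>, by which it is identified with \<open>'f\<close>.  The subset is an (embedded) submanifold
  of dimension \<open>DIM('f)\<close> if these charts cover it.
\<close>

definition induced_mfd ::
    "('m, 'e::euclidean_space) mfd \<Rightarrow> 'm set \<Rightarrow> ('m, 'f::euclidean_space) mfd" where
  "induced_mfd M N = Mfd N
     {Chart (N \<inter> cdom c) (\<lambda>p. inv J (cmap c p)) | c J.
        c \<in> max_atlas M \<and> linear J \<and> inj J \<and>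
        cmap c ` (N \<inter> cdom c) = cmap c ` cdom c \<inter> range J}"

definition submanifold ::
    "'f::euclidean_space itself \<Rightarrow> ('m, 'e::euclidean_space) mfd \<Rightarrow> 'm set \<Rightarrow> bool" where
  "submanifold F M N \<longleftrightarrow> N \<subseteq> points M \<and>
     (\<forall>p\<in>N. \<exists>c\<in>atlas (induced_mfd M N :: ('m, 'f) mfd). p \<in> cdom c)"

text \<open>The tangent map of the inclusion \<open>N \<hookrightarrow> M\<close>.\<close>

definition incl_tangent :: "('m, 'e::euclidean_space) mfd \<Rightarrow> 'm set \<Rightarrow>
    ('m, 'f::euclidean_space) tvec \<Rightarrow> ('m, 'e) tvec" where
  "incl_tangent M N = tangent_map (induced_mfd M N) M (\<lambda>p. p)"

definition lagrangian_submanifold ::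
    "'f::euclidean_space itself \<Rightarrow> ('m, 'e::euclidean_space) mfd \<Rightarrow>
     (('m, 'e) tvec \<Rightarrow> ('m, 'e) tvec \<Rightarrow> real) \<Rightarrow> 'm set \<Rightarrow> bool" where
  "lagrangian_submanifold F P \<omega> N \<longleftrightarrow>
     submanifold F P N \<and>
     (\<forall>p\<in>N. \<forall>X\<in>tangent_space (induced_mfd P N :: ('m, 'f) mfd) p.
             \<forall>Y\<in>tangent_space (induced_mfd P N :: ('m, 'f) mfd) p.
        \<omega> (incl_tangent P N X) (incl_tangent P N Y) = 0) \<and>
     2 * DIM('f) = DIM('e)"


section \<open>Distributions\<close>

text \<open>
  A local frame: in the coordinates \<open>q\<^sup>i\<close> of \<open>c\<close>, the sections are
  \<open>e\<^sub>A = \<rho>\<^sup>i\<^sub>A(q) \<partial>/\<partial>q\<^sup>i\<close>, and \<open>\<rho> x y\<close> is the vector \<open>y\<^sup>A \<rho>\<^sup>i\<^sub>A(x)\<close>; the rank is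
  \<open>DIM('k)\<close>.  As \<open>c\<close> ranges over the maximal atlas, frames over arbitrarily small open sets are
  included.
\<close>

definition local_frame :: "('q, 'e::euclidean_space) mfd \<Rightarrow> ('q, 'e) tvec set \<Rightarrow>
    ('q, 'e) chart \<Rightarrow> ('e \<Rightarrow> 'k::euclidean_space \<Rightarrow> 'e) \<Rightarrow> bool" where
  "local_frame Q D c \<rho> \<longleftrightarrow> c \<in> max_atlas Q \<and>
     (\<forall>x\<in>cmap c ` cdom c. linear (\<rho> x) \<and> inj (\<rho> x)) \<and>
     (\<forall>y. smooth_on (cmap c ` cdom c) (\<lambda>x. \<rho> x y)) \<and>
     (\<forall>q\<in>cdom c. {v\<in>D. fst v = q} = range (\<lambda>y. tvec_of Q c q (\<rho> (cmap c q) y)))"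

definition distribution :: "'k::euclidean_space itself \<Rightarrow> ('q, 'e::euclidean_space) mfd \<Rightarrow>
    ('q, 'e) tvec set \<Rightarrow> bool" where
  "distribution K Q D \<longleftrightarrow> D \<subseteq> points (tangent_bundle Q) \<and>
     (\<forall>q\<in>points Q. \<exists>c (\<rho> :: 'e \<Rightarrow> 'k \<Rightarrow> 'e). local_frame Q D c \<rho> \<and> q \<in> cdom c)"

text \<open>Integrable: there is an integral manifold through every point.\<close>

definition integrable_distribution :: "'k::euclidean_space itself \<Rightarrow>
    ('q, 'e::euclidean_space) mfd \<Rightarrow> ('q, 'e) tvec set \<Rightarrow> bool" where
  "integrable_distribution K Q D \<longleftrightarrow>
     (\<forall>q\<in>points Q. \<exists>N. q \<in> N \<and> submanifold K Q N \<and>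
        (\<forall>p\<in>N. incl_tangent Q N ` tangent_space (induced_mfd Q N :: ('q, 'k) mfd) p
                = {v\<in>D. fst v = p}))"

text \<open>
  The total space of \<open>D\<close>, with the charts \<open>(q\<^sup>i, y\<^sup>A)\<close> induced by all local frames.
\<close>

definition total_space :: "('q, 'e::euclidean_space) mfd \<Rightarrow> ('q, 'e) tvec set \<Rightarrow>
    (('q, 'e) tvec, 'e \<times> 'k::euclidean_space) mfd" where
  "total_space Q D = Mfd D
     {Chart {v\<in>D. fst v \<in> cdom c}
        (\<lambda>v. (cmap c (fst v), inv (\<lambda>y. tvec_of Q c (fst v) (\<rho> (cmap c (fst v)) y)) v))
      | c (\<rho> :: 'e \<Rightarrow> 'k \<Rightarrow> 'e). local_frame Q D c \<rho>}"


section \<open>Admissible curves and the submanifold generated by a Lagrangian function\<close>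

text \<open>
  \<open>fst\<close> is the bundle projection of \<open>D\<close>.  The total space is passed as the parameter \<open>E\<close>
  because its type fixes the rank of the distribution.
\<close>

definition admissible_curve :: "('q, 'e::euclidean_space) mfd \<Rightarrow>
    (('q, 'e) tvec, 'e \<times> 'k::euclidean_space) mfd \<Rightarrow> real set \<Rightarrow> (real \<Rightarrow> ('q, 'e) tvec) \<Rightarrow> bool"
  where
  "admissible_curve Q E I \<gamma> \<longleftrightarrow>
     smooth_curve E I \<gamma> \<and> (\<forall>t\<in>I. \<gamma> t = velocity Q (\<lambda>s. fst (\<gamma> s)) t)"

definition D2 :: "('q, 'e::euclidean_space) mfd \<Rightarrow> ('q, 'e) tvec set \<Rightarrow>
    (('q, 'e) tvec, 'e \<times> 'k::euclidean_space) tvec set" where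
  "D2 Q D = {velocity (total_space Q D) \<gamma> 0 | \<gamma>.
     \<exists>I. open I \<and> is_interval I \<and> 0 \<in> I \<and> admissible_curve Q (total_space Q D :: (_, 'e \<times> 'k) mfd) I \<gamma>}"

text \<open>\<open>D2\<close> as a submanifold of \<open>TD\<close>, with model space that of the coordinates \<open>(q, y, y')\<close>.\<close>

definition D2_mfd :: "('q, 'e::euclidean_space) mfd \<Rightarrow> ('q, 'e) tvec set \<Rightarrow>
    ((('q, 'e) tvec, 'e \<times> 'k::euclidean_space) tvec, 'e \<times> 'k \<times> 'k) mfd" where
  "D2_mfd Q D = induced_mfd (tangent_bundle (total_space Q D)) (D2 Q D)"

definition Sigma_L :: "('q, 'e::euclidean_space) mfd \<Rightarrow> ('q, 'e) tvec set \<Rightarrow>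
    ((('q, 'e) tvec, 'e \<times> 'k::euclidean_space) tvec \<Rightarrow> real) \<Rightarrow>
    ((('q, 'e) tvec, 'e \<times> 'k) tvec, ('e \<times> 'k) \<times> ('e \<times> 'k)) covec set" where
  "Sigma_L Q D L = {\<mu> \<in> points (cotangent_bundle (tangent_bundle (total_space Q D))).
     fst \<mu> \<in> D2 Q D \<and>
     (\<forall>w\<in>tangent_space (D2_mfd Q D) (fst \<mu>).
        snd \<mu> (incl_tangent (tangent_bundle (total_space Q D)) (D2 Q D) w)
          = differential (D2_mfd Q D) L w)}"

end

theory Submission
  imports Defs
begin

text \<open>
  The statement is an instance of a general fact: for any submanifold \<open>N\<close> of a manifold \<open>M\<close>
  and any smooth \<open>L : N \<rightarrow> \<real>\<close>, the covectors over \<open>N\<close> whose restriction to \<open>TN\<close> is \<open>dL\<close>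
  form a Lagrangian submanifold of \<open>T\<^sup>*M\<close>. In a slice chart the fibre translation by the
  differential of an extension of \<open>L\<close> straightens this set to \<open>N\<close> times the annihilator of \<open>TN\<close>,
  of dimension \<open>dim M\<close>; and the Liouville form pulls back to \<open>dL\<close>, which is closed.

  It is applied to \<open>D2 \<subset> TD\<close>. That this set is given by \<open>q' = \<rho>(q) y\<close> in the coordinates of a
  frame requires an admissible curve through every such vector; one is obtained by prescribing
  \<open>y'\<close> to be constant and solving a differential equation.
  Replacing \<open>q'\<close> by \<open>q' - \<rho>(q) y\<close> gives a slice chart.
\<close>

section \<open>Calculus of smooth maps\<close>

text \<open>\<open>tangent_map\<close> and \<open>differential\<close> are computed in the chart
  that \<open>chart_at\<close> happens to select, while slice charts and local frames live in the
  maximal atlas. Each object is therefore given a formula in an arbitrary chart of the maximal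
  atlas, with \<open>tvec_of\<close> supplying the components there, because a tangent vector stores
  components for atlas charts only. They meet in the identity \<open>p . dx = dh\<close> along one
  parametrisation, and closedness of \<open>dh\<close> becomes symmetry of second derivatives.
  Compatibility of the charts of the distribution is the other obstacle. A frame is an injective, in
  general not invertible, linear map into the tangent space, so a change of frame is determined only
  implicitly; its smoothness is extracted from the linear system that it solves.

  The IDEA block above contains a malformed symbol and is void. The complete reply follows.\<close>

abbreviation der :: "('a::euclidean_space \<Rightarrow> 'b::real_normed_vector) \<Rightarrow> 'a \<Rightarrow> 'a \<Rightarrow> 'b" where
  "der f x \<equiv> frechet_derivative f (at x)"

lemma has_derivative_der:
  "f differentiable (at x) \<Longrightarrow> (f has_derivative der f x) (at x)"
  by (rule frechet_derivative_works[THEN iffD1])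

lemma der_eqI: "(f has_derivative f') (at x) \<Longrightarrow> der f x = f'"
  by (rule frechet_derivative_at[symmetric])

lemma linear_der: "f differentiable (at x) \<Longrightarrow> linear (der f x)"
  by (rule linear_frechet_derivative)

text \<open>\<open>frechet_derivative\<close> chooses an element of the set of derivatives.
  Functions that agree near \<open>x\<close> have the same set, hence the same choice, even where
  that set is empty.\<close>

lemma der_cong:
  assumes "open S" "x \<in> S" "\<And>y. y \<in> S \<Longrightarrow> f y = g y"
  shows "der f x = der g x"
proof -
  have "(f has_derivative f') (at x) \<longleftrightarrow> (g has_derivative f') (at x)" for f'
    using assms by (metis has_derivative_transform_within_open)
  then show ?thesis
    by (simp add: frechet_derivative_def)
qed

lemma differentiable_cong_open:
  assumes "open S" "x \<in> S" "\<And>y. y \<in> S \<Longrightarrow> f y = g y" "f differentiable (at x)"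
  shows "g differentiable (at x)"
  using assms by (metis differentiable_def has_derivative_transform_within_open)

lemma der_compose:
  assumes "f differentiable (at x)" "g differentiable (at (f x))"
  shows "der (\<lambda>y. g (f y)) x = (\<lambda>v. der g (f x) (der f x v))"
proof (rule der_eqI)
  show "((\<lambda>y. g (f y)) has_derivative (\<lambda>v. der g (f x) (der f x v))) (at x)"
    using diff_chain_at[OF assms[THEN has_derivative_der]] by (simp add: o_def)
qed

section \<open>Closure properties of C^k and smooth maps\<close>

lemma Ck_on_cong:
  assumes "open S" "\<And>x. x \<in> S \<Longrightarrow> f x = g x" "Ck_on k S f"
  shows "Ck_on k S g"
  using assms(2,3)
proof (induction k arbitrary: f g)
  case 0
  then show ?case by (simp cong: continuous_on_cong)
next
  case (Suc k)
  have "Ck_on k S (\<lambda>x. der g x v)" for v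
  proof (rule Suc.IH[of "\<lambda>x. der f x v"])
    show "der f x v = der g x v" if "x \<in> S" for x
      using der_cong[OF assms(1) that Suc.prems(1)] by simp
    show "Ck_on k S (\<lambda>x. der f x v)" using Suc.prems by simp
  qed
  moreover have "\<forall>x\<in>S. g differentiable (at x)"
    using Suc.prems differentiable_cong_open[OF assms(1), of _ f g] by auto
  ultimately show ?case by simp
qed

lemma Ck_on_Suc_imp: "Ck_on (Suc k) S f \<Longrightarrow> Ck_on k S f"
proof (induction k arbitrary: f)
  case 0
  then show ?case
    by (auto intro!: continuous_at_imp_continuous_on differentiable_imp_continuous_within)
next
  case (Suc k)
  then show ?case by auto
qed

lemma Ck_on_subset: "Ck_on k S f \<Longrightarrow> T \<subseteq> S \<Longrightarrow> Ck_on k T f"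
  by (induction k arbitrary: f) (auto intro: continuous_on_subset)

lemma Ck_on_local:
  assumes "\<And>x. x \<in> S \<Longrightarrow> \<exists>T. open T \<and> x \<in> T \<and> Ck_on k T f"
  shows "Ck_on k S f"
  using assms
proof (induction k arbitrary: f)
  case 0
  show ?case unfolding Ck_on.simps
  proof (rule continuous_at_imp_continuous_on, rule ballI)
    show "isCont f x" if "x \<in> S" for x
      using 0[OF that] continuous_on_eq_continuous_at by fastforce
  qed
next
  case (Suc k)
  show ?case unfolding Ck_on.simps
  proof (intro conjI allI)
    show "\<forall>x\<in>S. f differentiable (at x)" using Suc.prems by fastforce
    show "Ck_on k S (\<lambda>x. der f x v)" for v
      by (rule Suc.IH) (use Suc.prems in fastforce)
  qed
qed

lemma Ck_on_const: "Ck_on k S (\<lambda>x. c)"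
  by (induction k arbitrary: c) (auto simp: frechet_derivative_const)

lemma Ck_on_linear:
  assumes "linear f" shows "Ck_on k S f"
proof (cases k)
  case 0
  then show ?thesis using assms
    by (simp add: linear_continuous_on linear_conv_bounded_linear)
next
  case (Suc j)
  have "(f has_derivative f) (at x)" for x
    by (rule linear_imp_has_derivative[OF assms])
  then have "\<forall>x. f differentiable (at x)" "\<forall>x. der f x = f"
    by (auto simp: differentiable_def intro: der_eqI)
  then show ?thesis by (simp add: Suc Ck_on_const)
qed

lemma Ck_on_add:
  assumes "Ck_on k S f" "Ck_on k S g" "open S"
  shows "Ck_on k S (\<lambda>x. f x + g x)"
  using assms(1,2)
proof (induction k arbitrary: f g)
  case 0
  then show ?case by (auto intro: continuous_on_add)
next
  case (Suc k)
  have "Ck_on k S (\<lambda>x. der (\<lambda>x. f x + g x) x v)" for v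
  proof (rule Ck_on_cong[OF assms(3)])
    show "Ck_on k S (\<lambda>x. der f x v + der g x v)"
      using Suc by simp
    show "der f x v + der g x v = der (\<lambda>x. f x + g x) x v" if "x \<in> S" for x
      using Suc.prems that der_eqI[OF has_derivative_add[OF has_derivative_der has_derivative_der], of f x g]
      by simp
  qed
  then show ?case using Suc.prems by auto
qed

lemma Ck_on_bilinear:
  assumes "bounded_bilinear B" "Ck_on k S f" "Ck_on k S g" "open S"
  shows "Ck_on k S (\<lambda>x. B (f x) (g x))"
  using assms(2,3)
proof (induction k arbitrary: f g)
  case 0
  then show ?case by (auto intro: bounded_bilinear.continuous_on[OF assms(1)])
next
  case (Suc k)
  have fg: "((\<lambda>x. B (f x) (g x)) has_derivative (\<lambda>v. B (f x) (der g x v) + B (der f x v) (g x))) (at x)"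
    if "x \<in> S" for x
    using Suc.prems that by (intro bounded_bilinear.FDERIV[OF assms(1)] has_derivative_der) auto
  have "Ck_on k S (\<lambda>x. der (\<lambda>x. B (f x) (g x)) x v)" for v
  proof (rule Ck_on_cong[OF assms(4)])
    show "Ck_on k S (\<lambda>x. B (f x) (der g x v) + B (der f x v) (g x))"
      using Suc.prems by (intro Ck_on_add Suc.IH assms(4) Ck_on_Suc_imp[of k S f] Ck_on_Suc_imp[of k S g]) auto
    show "B (f x) (der g x v) + B (der f x v) (g x) = der (\<lambda>x. B (f x) (g x)) x v" if "x \<in> S" for x
      using der_eqI[OF fg[OF that]] by simp
  qed
  moreover have "\<forall>x\<in>S. (\<lambda>x. B (f x) (g x)) differentiable (at x)"
    using fg differentiable_def by blast
  ultimately show ?case by simp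
qed

lemma Ck_on_bounded_linear:
  assumes "bounded_linear h" "Ck_on k S f" "open S"
  shows "Ck_on k S (\<lambda>x. h (f x))"
  using assms(2)
proof (induction k arbitrary: f)
  case 0
  then show ?case by (auto intro: bounded_linear.continuous_on[OF assms(1)])
next
  case (Suc k)
  have hf: "((\<lambda>x. h (f x)) has_derivative (\<lambda>v. h (der f x v))) (at x)" if "x \<in> S" for x
    using Suc.prems that by (intro bounded_linear.has_derivative[OF assms(1)] has_derivative_der) auto
  have "Ck_on k S (\<lambda>x. der (\<lambda>x. h (f x)) x v)" for v
  proof (rule Ck_on_cong[OF assms(3)])
    show "Ck_on k S (\<lambda>x. h (der f x v))"
      using Suc.prems by (intro Suc.IH) auto
    show "h (der f x v) = der (\<lambda>x. h (f x)) x v" if "x \<in> S" for x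
      using der_eqI[OF hf[OF that]] by simp
  qed
  moreover have "\<forall>x\<in>S. (\<lambda>x. h (f x)) differentiable (at x)"
    using hf differentiable_def by blast
  ultimately show ?case by simp
qed

lemma Ck_on_sum:
  assumes "\<And>i. i \<in> I \<Longrightarrow> Ck_on k S (f i)" "open S"
  shows "Ck_on k S (\<lambda>x. \<Sum>i\<in>I. f i x)"
  using assms(1)
  by (induction I rule: infinite_finite_induct) (auto intro: Ck_on_const Ck_on_add assms(2))

lemma linear_sum_Basis:
  fixes f :: "'a::euclidean_space \<Rightarrow> 'b::real_normed_vector"
  assumes "linear f" shows "f v = (\<Sum>b\<in>Basis. (v \<bullet> b) *\<^sub>R f b)"
proof -
  have "f v = f (\<Sum>b\<in>Basis. (v \<bullet> b) *\<^sub>R b)" by (simp add: euclidean_representation)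
  also have "\<dots> = (\<Sum>b\<in>Basis. (v \<bullet> b) *\<^sub>R f b)" by (simp add: linear_sum[OF assms] linear_cmul[OF assms])
  finally show ?thesis .
qed

text \<open>\<open>Ck_on\<close> controls \<open>der g\<close> only in fixed directions, whereas the
  chain rule applies \<open>der g (f x)\<close> to a vector that moves with \<open>x\<close>.
  Expanding this vector in \<open>Basis\<close> leaves products of scalar functions with derivatives
  in fixed directions.\<close>

lemma Ck_on_compose:
  fixes f :: "'a::euclidean_space \<Rightarrow> 'b::euclidean_space" and g :: "'b \<Rightarrow> 'c::real_normed_vector"
  assumes "open S" "f ` S \<subseteq> T" "Ck_on k S f" "Ck_on k T g"
  shows "Ck_on k S (\<lambda>x. g (f x))"
  using assms(3,4)
proof (induction k arbitrary: g)
  case 0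
  then show ?case using assms(2) by (auto intro: continuous_on_compose2)
next
  case (Suc k)
  have d: "f differentiable (at x)" "g differentiable (at (f x))" if "x \<in> S" for x
    using Suc.prems assms(2) that by auto
  have "Ck_on k S (\<lambda>x. der (\<lambda>x. g (f x)) x v)" for v
  proof (rule Ck_on_cong[OF assms(1)])
    show "Ck_on k S (\<lambda>x. \<Sum>b\<in>Basis. (der f x v \<bullet> b) *\<^sub>R der g (f x) b)"
    proof (intro Ck_on_sum Ck_on_bilinear[OF bounded_bilinear_scaleR] assms(1))
      show "Ck_on k S (\<lambda>x. der f x v \<bullet> b)" for b
        using Suc.prems assms(1) by (intro Ck_on_bounded_linear[OF bounded_linear_inner_left]) auto
      show "Ck_on k S (\<lambda>x. der g (f x) b)" for b
        using Suc.prems by (intro Suc.IH Ck_on_Suc_imp[of k S f]) auto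
    qed
    show "(\<Sum>b\<in>Basis. (der f x v \<bullet> b) *\<^sub>R der g (f x) b) = der (\<lambda>x. g (f x)) x v" if "x \<in> S" for x
      using linear_sum_Basis[OF linear_der[OF d(2)[OF that]], of "der f x v"] der_compose[OF d[OF that]]
      by simp
  qed
  moreover have "\<forall>x\<in>S. (\<lambda>x. g (f x)) differentiable (at x)"
    using d differentiable_chain_at by (fastforce simp: o_def)
  ultimately show ?case by simp
qed

lemma smooth_on_cong:
  "open S \<Longrightarrow> (\<And>x. x \<in> S \<Longrightarrow> f x = g x) \<Longrightarrow> smooth_on S f \<Longrightarrow> smooth_on S g"
  unfolding smooth_on_def by (intro allI Ck_on_cong[of S f g]) auto

lemma smooth_on_subset: "smooth_on S f \<Longrightarrow> T \<subseteq> S \<Longrightarrow> smooth_on T f"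
  unfolding smooth_on_def by (intro allI Ck_on_subset[of _ S f T]) auto

lemma smooth_on_local:
  "(\<And>x. x \<in> S \<Longrightarrow> \<exists>T. open T \<and> x \<in> T \<and> smooth_on T f) \<Longrightarrow> smooth_on S f"
  unfolding smooth_on_def by (intro allI Ck_on_local) blast

lemma smooth_on_const: "smooth_on S (\<lambda>x. c)"
  by (simp add: smooth_on_def Ck_on_const)

lemma smooth_on_linear: "linear f \<Longrightarrow> smooth_on S f"
  by (simp add: smooth_on_def Ck_on_linear)

lemma smooth_on_add: "smooth_on S f \<Longrightarrow> smooth_on S g \<Longrightarrow> open S \<Longrightarrow> smooth_on S (\<lambda>x. f x + g x)"
  unfolding smooth_on_def by (rule allI, rule Ck_on_add) auto

lemma smooth_on_sum:
  "(\<And>i. i \<in> I \<Longrightarrow> smooth_on S (f i)) \<Longrightarrow> open S \<Longrightarrow> smooth_on S (\<lambda>x. \<Sum>i\<in>I. f i x)"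
  unfolding smooth_on_def by (rule allI, rule Ck_on_sum) auto

lemma smooth_on_bilinear:
  "bounded_bilinear B \<Longrightarrow> smooth_on S f \<Longrightarrow> smooth_on S g \<Longrightarrow> open S \<Longrightarrow>
    smooth_on S (\<lambda>x. B (f x) (g x))"
  unfolding smooth_on_def by (rule allI, rule Ck_on_bilinear) auto

lemmas smooth_on_scaleR = smooth_on_bilinear[OF bounded_bilinear_scaleR]
lemmas smooth_on_inner = smooth_on_bilinear[OF bounded_bilinear_inner]

lemma smooth_on_bounded_linear:
  "bounded_linear h \<Longrightarrow> smooth_on S f \<Longrightarrow> open S \<Longrightarrow> smooth_on S (\<lambda>x. h (f x))"
  unfolding smooth_on_def by (rule allI, rule Ck_on_bounded_linear) auto

lemma smooth_on_minus: "smooth_on S f \<Longrightarrow> open S \<Longrightarrow> smooth_on S (\<lambda>x. - f x)"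
  by (rule smooth_on_bounded_linear[OF bounded_linear_minus[OF bounded_linear_ident]])

lemma smooth_on_diff: "smooth_on S f \<Longrightarrow> smooth_on S g \<Longrightarrow> open S \<Longrightarrow> smooth_on S (\<lambda>x. f x - g x)"
  using smooth_on_add[of S f "\<lambda>x. - g x"] smooth_on_minus[of S g] by simp

lemma smooth_on_Pair:
  assumes "smooth_on S f" "smooth_on S g" "open S"
  shows "smooth_on S (\<lambda>x. (f x, g x))"
proof -
  have "smooth_on S (\<lambda>x. (f x, 0) + (0, g x))"
    using assms
    by (intro smooth_on_add smooth_on_bounded_linear[of "\<lambda>a. (a, 0)"] smooth_on_bounded_linear[of "\<lambda>a. (0, a)"])
       (auto intro: bounded_linear_Pair bounded_linear_ident bounded_linear_zero)
  then show ?thesis by simp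
qed

lemma smooth_on_fst: "smooth_on S f \<Longrightarrow> open S \<Longrightarrow> smooth_on S (\<lambda>x. fst (f x))"
  by (rule smooth_on_bounded_linear[OF bounded_linear_fst])

lemma smooth_on_snd: "smooth_on S f \<Longrightarrow> open S \<Longrightarrow> smooth_on S (\<lambda>x. snd (f x))"
  by (rule smooth_on_bounded_linear[OF bounded_linear_snd])

lemma smooth_on_compose:
  fixes f :: "'a::euclidean_space \<Rightarrow> 'b::euclidean_space" and g :: "'b \<Rightarrow> 'c::real_normed_vector"
  assumes "smooth_on T g" "smooth_on S f" "open S" "f ` S \<subseteq> T"
  shows "smooth_on S (\<lambda>x. g (f x))"
  using assms Ck_on_compose[OF assms(3,4)] unfolding smooth_on_def by blast

lemma smooth_on_der: "smooth_on S f \<Longrightarrow> smooth_on S (\<lambda>x. der f x v)"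
  unfolding smooth_on_def by (metis Ck_on.simps(2))

lemma smooth_on_differentiable: "smooth_on S f \<Longrightarrow> x \<in> S \<Longrightarrow> f differentiable (at x)"
  unfolding smooth_on_def by (drule spec[of _ "Suc 0"]) simp

lemma smooth_on_continuous: "smooth_on S f \<Longrightarrow> continuous_on S f"
  unfolding smooth_on_def using Ck_on.simps(1) by blast

text \<open>By linearity \<open>f (g x) (h x)\<close> is a combination of the
  \<open>f (g x) b\<close> for basis vectors \<open>b\<close>. This turns smoothness for each fixed
  vector into joint smoothness, as required for Jacobians acting on fibres and for frames.\<close>

lemma smooth_on_linear_family:
  fixes f :: "'a::euclidean_space \<Rightarrow> 'b::euclidean_space \<Rightarrow> 'c::real_normed_vector"
  assumes "open S" "\<And>u. smooth_on T (\<lambda>x. f x u)" "smooth_on S h"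
    "smooth_on S g" "g ` S \<subseteq> T" "\<And>x. x \<in> T \<Longrightarrow> linear (f x)"
  shows "smooth_on S (\<lambda>x. f (g x) (h x))"
proof (rule smooth_on_cong[OF assms(1)])
  show "smooth_on S (\<lambda>x. \<Sum>b\<in>Basis. (h x \<bullet> b) *\<^sub>R f (g x) b)"
    using assms
    by (intro smooth_on_sum smooth_on_scaleR smooth_on_inner smooth_on_const smooth_on_compose[OF assms(2)]) auto
  show "(\<Sum>b\<in>Basis. (h x \<bullet> b) *\<^sub>R f (g x) b) = f (g x) (h x)" if "x \<in> S" for x
    using assms(5,6) that linear_sum_Basis[of "f (g x)" "h x"] by (simp add: image_subset_iff)
qed

section \<open>Symmetry of second derivatives\<close>

lemma DERIV_along_line:
  fixes f :: "'a::euclidean_space \<Rightarrow> real"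
  assumes "f differentiable (at (p + s *\<^sub>R u))"
  shows "((\<lambda>s. f (p + s *\<^sub>R u)) has_field_derivative der f (p + s *\<^sub>R u) u) (at s)"
proof -
  have "((\<lambda>s. p + s *\<^sub>R u) has_derivative (\<lambda>h. h *\<^sub>R u)) (at s)"
    by (auto intro!: derivative_eq_intros)
  then have "((\<lambda>s. f (p + s *\<^sub>R u)) has_derivative (\<lambda>h. der f (p + s *\<^sub>R u) (h *\<^sub>R u))) (at s)"
    by (rule has_derivative_compose) (rule has_derivative_der[OF assms])
  moreover have "(\<lambda>h. der f (p + s *\<^sub>R u) (h *\<^sub>R u)) = (*) (der f (p + s *\<^sub>R u) u)"
    by (simp add: fun_eq_iff linear_cmul[OF linear_der[OF assms]])
  ultimately show ?thesis by (simp add: has_field_derivative_def)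
qed

text \<open>The mean value theorem is applied twice: in direction \<open>u\<close> to the difference
  of \<open>f\<close> on two parallel segments, then in direction \<open>w\<close> to the derivative
  so obtained. The bound on \<open>t\<close> keeps the whole parallelogram in the ball.\<close>

lemma double_difference_eq:
  fixes f :: "'a::euclidean_space \<Rightarrow> real"
  assumes "smooth_on (ball z \<delta>) f" "t > 0" "t * (norm u + norm w) < \<delta>"
  shows "\<exists>y\<in>ball z \<delta>. f (z + t *\<^sub>R u + t *\<^sub>R w) - f (z + t *\<^sub>R u) - f (z + t *\<^sub>R w) + f z
    = t * (t * der (\<lambda>x. der f x u) y w)"
proof -
  have in_ball: "z + s *\<^sub>R u + r *\<^sub>R w \<in> ball z \<delta>" if "0 \<le> s" "s \<le> t" "0 \<le> r" "r \<le> t" for s r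
  proof -
    have "norm (s *\<^sub>R u + r *\<^sub>R w) \<le> s * norm u + r * norm w"
      using norm_triangle_ineq[of "s *\<^sub>R u" "r *\<^sub>R w"] that by simp
    also have "\<dots> \<le> t * norm u + t * norm w"
      using that by (intro add_mono mult_right_mono) auto
    finally show ?thesis
      using assms(3) by (simp add: dist_norm algebra_simps norm_minus_commute)
  qed
  note d1 = smooth_on_differentiable[OF assms(1)]
  note d2 = smooth_on_differentiable[OF smooth_on_der[OF assms(1), of u]]
  have "\<exists>s>0. s < t \<and> (f ((z + t *\<^sub>R w) + t *\<^sub>R u) - f (z + t *\<^sub>R u)) - (f ((z + t *\<^sub>R w) + 0 *\<^sub>R u) - f (z + 0 *\<^sub>R u))
      = (t - 0) * (der f ((z + t *\<^sub>R w) + s *\<^sub>R u) u - der f (z + s *\<^sub>R u) u)"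
  proof (rule MVT2[OF assms(2)])
    fix s assume s: "0 \<le> s" "s \<le> t"
    have "z + t *\<^sub>R w + s *\<^sub>R u \<in> ball z \<delta>" "z + s *\<^sub>R u \<in> ball z \<delta>"
      using in_ball[OF s, of t] in_ball[OF s, of 0] assms(2) by (simp_all add: algebra_simps)
    then show "((\<lambda>s. f ((z + t *\<^sub>R w) + s *\<^sub>R u) - f (z + s *\<^sub>R u)) has_real_derivative
        der f ((z + t *\<^sub>R w) + s *\<^sub>R u) u - der f (z + s *\<^sub>R u) u) (at s)"
      by (intro DERIV_diff DERIV_along_line d1)
  qed
  then obtain s where s: "0 < s" "s < t"
    "(f ((z + t *\<^sub>R w) + t *\<^sub>R u) - f (z + t *\<^sub>R u)) - (f (z + t *\<^sub>R w) - f z)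
      = t * (der f ((z + t *\<^sub>R w) + s *\<^sub>R u) u - der f (z + s *\<^sub>R u) u)"
    by auto
  have "\<exists>r>0. r < t \<and> der f ((z + s *\<^sub>R u) + t *\<^sub>R w) u - der f ((z + s *\<^sub>R u) + 0 *\<^sub>R w) u
      = (t - 0) * der (\<lambda>x. der f x u) ((z + s *\<^sub>R u) + r *\<^sub>R w) w"
    by (rule MVT2[OF assms(2)], rule DERIV_along_line, rule d2) (use in_ball s in auto)
  then obtain r where r: "0 < r" "r < t" "der f ((z + s *\<^sub>R u) + t *\<^sub>R w) u - der f (z + s *\<^sub>R u) u
      = t * der (\<lambda>x. der f x u) ((z + s *\<^sub>R u) + r *\<^sub>R w) w"
    by auto
  have e: "z + t *\<^sub>R w + c *\<^sub>R u = z + c *\<^sub>R u + t *\<^sub>R w" for c by (simp add: algebra_simps)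
  show ?thesis
    using s(3) r(3) in_ball[of s r] s(1,2) r(1,2) unfolding e
    by (intro bexI[of _ "z + s *\<^sub>R u + r *\<^sub>R w"]) auto
qed

text \<open>The double difference is symmetric in \<open>u\<close> and \<open>w\<close>, so the two
  mixed derivatives take a common value at two points arbitrarily close to \<open>z\<close>.
  Continuity carries the equality to \<open>z\<close>.\<close>

lemma der_der_commute_real:
  fixes f :: "'a::euclidean_space \<Rightarrow> real"
  assumes "open S" "z \<in> S" "smooth_on S f"
  shows "der (\<lambda>x. der f x u) z w = der (\<lambda>x. der f x w) z u"
proof (rule ccontr)
  let ?g = "\<lambda>x. der (\<lambda>x. der f x u) x w" and ?h = "\<lambda>x. der (\<lambda>x. der f x w) x u"
  assume ne: "?g z \<noteq> ?h z"
  \<comment> \<open>Half the supposed gap: two numbers within \<open>e\<close> of one common value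
    differ by less than the gap.\<close>
  define e where "e = \<bar>?g z - ?h z\<bar> / 2"
  have e: "e > 0" using ne by (simp add: e_def)
  have "isCont ?g z" "isCont ?h z"
    using smooth_on_continuous[OF smooth_on_der[OF smooth_on_der[OF assms(3)]]] assms(1,2)
    by (auto simp: continuous_on_eq_continuous_at)
  then have "\<exists>d>0. \<forall>y. dist y z < d \<longrightarrow> dist (?g y) (?g z) < e"
      "\<exists>d>0. \<forall>y. dist y z < d \<longrightarrow> dist (?h y) (?h z) < e"
    using e by (simp_all add: continuous_at_eps_delta)
  then obtain d1 d2 where d: "d1 > 0" "\<And>y. dist y z < d1 \<Longrightarrow> dist (?g y) (?g z) < e"
      "d2 > 0" "\<And>y. dist y z < d2 \<Longrightarrow> dist (?h y) (?h z) < e"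
    by blast
  obtain d3 where d3: "d3 > 0" "ball z d3 \<subseteq> S"
    using assms(1,2) openE by blast
  define \<delta> where "\<delta> = min d1 (min d2 d3)"
  have \<delta>: "\<delta> > 0" using d d3 by (simp add: \<delta>_def)
  have sm: "smooth_on (ball z \<delta>) f"
    by (rule smooth_on_subset[OF assms(3)]) (use d3 in \<open>auto simp: \<delta>_def\<close>)
  \<comment> \<open>The summand 1 keeps the denominator positive when \<open>u\<close> and
    \<open>w\<close> both vanish.\<close>
  define t where "t = \<delta> / (2 * (norm u + norm w + 1))"
  have t: "t > 0" using \<delta> by (auto simp: t_def intro!: divide_pos_pos add_nonneg_pos)
  define c where "c = norm u + norm w"
  have c: "c \<ge> 0" by (simp add: c_def)
  then have "t * c < t * (2 * (c + 1))"
    using t by (intro mult_strict_left_mono) auto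
  also have "\<dots> = \<delta>" using c by (simp add: t_def c_def[symmetric] add.assoc[symmetric])
  finally have "t * c < \<delta>" .
  then have tl: "t * (norm u + norm w) < \<delta>" "t * (norm w + norm u) < \<delta>" by (simp_all add: c_def add.commute)
  obtain y1 where y1: "y1 \<in> ball z \<delta>" "f (z + t *\<^sub>R u + t *\<^sub>R w) - f (z + t *\<^sub>R u) - f (z + t *\<^sub>R w) + f z
    = t * (t * ?g y1)"
    using double_difference_eq[OF sm t tl(1)] by blast
  obtain y2 where y2: "y2 \<in> ball z \<delta>" "f (z + t *\<^sub>R w + t *\<^sub>R u) - f (z + t *\<^sub>R w) - f (z + t *\<^sub>R u) + f z
    = t * (t * ?h y2)"
    using double_difference_eq[OF sm t tl(2)] by blast
  have swap: "z + t *\<^sub>R w + t *\<^sub>R u = z + t *\<^sub>R u + t *\<^sub>R w" by (simp add: algebra_simps)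
  have "t * (t * ?g y1) = t * (t * ?h y2)"
    using y1(2) y2(2) unfolding swap by linarith
  then have "?g y1 = ?h y2" using t by simp
  moreover have "dist (?g y1) (?g z) < e" "dist (?h y2) (?h z) < e"
    using y1(1) y2(1) by (auto intro!: d simp: \<delta>_def dist_commute)
  ultimately show False
    unfolding e_def dist_real_def by (smt (verit) field_sum_of_halves)
qed

lemma der_bounded_linear:
  assumes "bounded_linear h" "f differentiable (at x)"
  shows "der (\<lambda>x. h (f x)) x = (\<lambda>v. h (der f x v))"
  by (rule der_eqI) (rule bounded_linear.has_derivative[OF assms(1) has_derivative_der[OF assms(2)]])

lemma der_der_commute:
  fixes f :: "'a::euclidean_space \<Rightarrow> 'b::euclidean_space"
  assumes "open S" "z \<in> S" "smooth_on S f"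
  shows "der (\<lambda>x. der f x u) z w = der (\<lambda>x. der f x w) z u"
proof (rule euclidean_eqI)
  fix b :: 'b assume "b \<in> Basis"
  have sm: "smooth_on S (\<lambda>x. f x \<bullet> b)"
    by (rule smooth_on_bounded_linear[OF bounded_linear_inner_left assms(3,1)])
  have "der (\<lambda>x. der f x u) z w \<bullet> b = der (\<lambda>x. der (\<lambda>x. f x \<bullet> b) x u) z w" for u w
  proof -
    have "der (\<lambda>x. der f x u) z w \<bullet> b = der (\<lambda>x. der f x u \<bullet> b) z w"
      using der_bounded_linear[OF bounded_linear_inner_left
          smooth_on_differentiable[OF smooth_on_der[OF assms(3)] assms(2)]] by metis
    also have "(\<lambda>x. der f x u \<bullet> b) y = (\<lambda>x. der (\<lambda>x. f x \<bullet> b) x u) y" if "y \<in> S" for y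
      using der_bounded_linear[OF bounded_linear_inner_left
          smooth_on_differentiable[OF assms(3) that]] by metis
    then have "der (\<lambda>x. der f x u \<bullet> b) z = der (\<lambda>x. der (\<lambda>x. f x \<bullet> b) x u) z"
      by (rule der_cong[OF assms(1,2)])
    finally show ?thesis by simp
  qed
  then show "der (\<lambda>x. der f x u) z w \<bullet> b = der (\<lambda>x. der f x w) z u \<bullet> b"
    using der_der_commute_real[OF assms(1,2) sm] by simp
qed

section \<open>Injective linear systems with smooth coefficients\<close>

lemma linear_solve_estimate:
  fixes R :: "'a::euclidean_space \<Rightarrow> 'b::euclidean_space \<Rightarrow> 'c::euclidean_space"
  assumes "open S" "z \<in> S" "\<And>x. x \<in> S \<Longrightarrow> linear (R x)" "inj (R z)"
    and cont: "\<And>u. isCont (\<lambda>x. R x u) z"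
    and eq: "\<And>x. x \<in> S \<Longrightarrow> R x (y x) = w x"
  obtains \<Lambda> e g where "bounded_linear \<Lambda>" "(e \<longlongrightarrow> 0) (at z)"
    "g = (\<lambda>x. \<Lambda> (w x - w z - (R x (y z) - R z (y z))))"
    "\<forall>\<^sub>F x in at z. 0 \<le> e x \<and> norm (y x - y z) \<le> 2 * norm (g x) \<and>
      norm (y x - y z - g x) \<le> e x * (2 * norm (g x))"
proof -
  obtain \<Lambda> where \<Lambda>: "linear \<Lambda>" "\<Lambda> \<circ> R z = id"
    using linear_injective_left_inverse assms(2-4) by blast
  have bl: "bounded_linear \<Lambda>" using \<Lambda>(1) by (simp add: linear_conv_bounded_linear)
  define d where "d x = y x - y z" for x
  define E where "E x u = \<Lambda> (R x u - R z u)" for x u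
  define g where "g = (\<lambda>x. \<Lambda> (w x - w z - (R x (y z) - R z (y z))))"
  define e where "e x = (\<Sum>b\<in>Basis. norm (E x b))" for x
  have linE: "linear (E x)" if "x \<in> S" for x
    unfolding E_def using linear_compose[OF linear_compose_sub \<Lambda>(1), of "R x" "R z"] assms(2,3) that
    by (simp add: o_def)
  \<comment> \<open>Applying the left inverse \<open>\<Lambda>\<close> of \<open>R z\<close> to the
    difference of the equations at \<open>x\<close> and \<open>z\<close> gives a fixed point
    equation for the increment \<open>d\<close>. Here \<open>g\<close> contains only the data and
    the fixed vector \<open>y z\<close>, and the operator \<open>E x\<close> tends to 0 as
    \<open>x\<close> tends to \<open>z\<close>; nothing is presupposed about the regularity of
    \<open>y\<close>.\<close>
  have dg: "d x = g x - E x (d x)" if x: "x \<in> S" for x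
  proof -
    have "d x = \<Lambda> (R z (d x))" using \<Lambda>(2) by (simp add: o_def fun_eq_iff)
    also have "R z (d x) = (w x - w z - (R x (y z) - R z (y z))) - (R x (d x) - R z (d x))"
      using eq[OF x] eq[OF assms(2)] linear_diff[OF assms(3)[OF x]] linear_diff[OF assms(3)[OF assms(2)]]
      by (simp add: d_def)
    finally show ?thesis unfolding g_def E_def by (simp add: linear_diff[OF \<Lambda>(1)])
  qed
  have normE: "norm (E x u) \<le> e x * norm u" if "x \<in> S" for x u
  proof -
    have "norm (E x u) \<le> (\<Sum>b\<in>Basis. norm ((u \<bullet> b) *\<^sub>R E x b))"
      unfolding linear_sum_Basis[OF linE[OF that], of u] by (rule norm_sum)
    also have "\<dots> \<le> (\<Sum>b\<in>Basis. norm u * norm (E x b))"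
      by (intro sum_mono) (auto intro!: mult_right_mono simp: Basis_le_norm)
    finally show ?thesis by (simp add: e_def sum_distrib_left mult.commute)
  qed
  have "isCont e z" unfolding e_def E_def
    by (intro continuous_intros bounded_linear.continuous[OF bl] cont)
  then have e0: "(e \<longlongrightarrow> 0) (at z)"
    by (simp add: isCont_def e_def E_def linear_0[OF \<Lambda>(1)])
  \<comment> \<open>Below 1/2 the term \<open>E x (d x)\<close> can be absorbed into
    \<open>d x\<close>, which produces the factor 2 in the estimate.\<close>
  have "\<forall>\<^sub>F x in at z. e x < 1/2" using order_tendstoD(2)[OF e0, of "1/2"] by simp
  moreover have "\<forall>\<^sub>F x in at z. x \<in> S" using eventually_at_in_open'[OF assms(1,2)] .
  ultimately have "\<forall>\<^sub>F x in at z. 0 \<le> e x \<and> norm (d x) \<le> 2 * norm (g x) \<and>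
      norm (d x - g x) \<le> e x * (2 * norm (g x))"
  proof eventually_elim
    case (elim x)
    have e_ge: "0 \<le> e x" unfolding e_def by (simp add: sum_nonneg)
    have "norm (d x) \<le> norm (g x) + norm (E x (d x))"
      using dg[OF elim(2)] norm_triangle_ineq4[of "g x" "E x (d x)"] by simp
    also have "norm (E x (d x)) \<le> 1/2 * norm (d x)"
      using normE[OF elim(2), of "d x"] mult_right_mono[OF less_imp_le[OF elim(1)] norm_ge_zero, of "d x"]
      by linarith
    finally have d2: "norm (d x) \<le> 2 * norm (g x)" by simp
    have "d x - g x = - E x (d x)" using dg[OF elim(2)] by (simp add: algebra_simps)
    then have "norm (d x - g x) \<le> e x * norm (d x)" using normE[OF elim(2), of "d x"] by simp
    also have "\<dots> \<le> e x * (2 * norm (g x))" by (rule mult_left_mono[OF d2 e_ge])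
    finally show ?case using d2 e_ge by simp
  qed
  then show thesis using that[OF bl e0 g_def] by (simp add: d_def)
qed

lemma continuous_linear_solve:
  fixes R :: "'a::euclidean_space \<Rightarrow> 'b::euclidean_space \<Rightarrow> 'c::euclidean_space"
  assumes "open S" "z \<in> S" "\<And>x. x \<in> S \<Longrightarrow> linear (R x)" "inj (R z)"
    and "\<And>u. isCont (\<lambda>x. R x u) z" "isCont w z"
    and "\<And>x. x \<in> S \<Longrightarrow> R x (y x) = w x"
  shows "isCont y z"
proof -
  obtain \<Lambda> e g where *: "bounded_linear \<Lambda>"
    "g = (\<lambda>x. \<Lambda> (w x - w z - (R x (y z) - R z (y z))))"
    "\<forall>\<^sub>F x in at z. 0 \<le> e x \<and> norm (y x - y z) \<le> 2 * norm (g x) \<and>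
      norm (y x - y z - g x) \<le> e x * (2 * norm (g x))"
    using linear_solve_estimate[where R = R and y = y and w = w, OF assms(1-5,7)] by blast
  have "isCont g z" unfolding *(2)
    by (intro continuous_intros bounded_linear.continuous[OF *(1)] assms)
  then have "((\<lambda>x. 2 * norm (g x)) \<longlongrightarrow> 2 * norm (g z)) (at z)"
    unfolding isCont_def by (intro tendsto_intros)
  then have "((\<lambda>x. 2 * norm (g x)) \<longlongrightarrow> 0) (at z)"
    by (simp add: *(2) linear_simps[OF *(1)])
  then have "((\<lambda>x. y x - y z) \<longlongrightarrow> 0) (at z)"
    by (rule Lim_null_comparison[rotated]) (use *(3) in \<open>auto elim: eventually_mono\<close>)
  then show ?thesis
    using LIM_zero_iff isCont_def by blast
qed

text \<open>The derivative of \<open>y\<close> is the derivative \<open>G\<close> of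
  \<open>g\<close>: the increment of \<open>y\<close> differs from \<open>g x\<close> by at most
  \<open>e x * (2 * norm (g x))\<close>, where \<open>e\<close> tends to 0 and \<open>g\<close> is
  of first order in \<open>x - z\<close>.\<close>

lemma differentiable_linear_solve:
  fixes R :: "'a::euclidean_space \<Rightarrow> 'b::euclidean_space \<Rightarrow> 'c::euclidean_space"
  assumes "open S" "z \<in> S" "\<And>x. x \<in> S \<Longrightarrow> linear (R x)" "inj (R z)"
    and diff: "\<And>u. (\<lambda>x. R x u) differentiable (at z)" "w differentiable (at z)"
    and eq: "\<And>x. x \<in> S \<Longrightarrow> R x (y x) = w x"
  shows "y differentiable (at z)"
proof -
  have "isCont (\<lambda>x. R x u) z" for u
    using diff(1) differentiable_imp_continuous_within by blast
  then obtain \<Lambda> e g where bl: "bounded_linear \<Lambda>" and e0: "(e \<longlongrightarrow> 0) (at z)"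
    and g_def: "g = (\<lambda>x. \<Lambda> (w x - w z - (R x (y z) - R z (y z))))"
    and est: "\<forall>\<^sub>F x in at z. 0 \<le> e x \<and> norm (y x - y z) \<le> 2 * norm (g x) \<and>
      norm (y x - y z - g x) \<le> e x * (2 * norm (g x))"
    using linear_solve_estimate[where R = R and y = y and w = w, OF assms(1-4) _ eq] by blast
  have "(\<lambda>x. w x - w z - (R x (y z) - R z (y z))) differentiable (at z)"
    by (intro differentiable_diff diff differentiable_const)
  then obtain G where G: "(g has_derivative G) (at z)"
    unfolding g_def using bounded_linear.has_derivative[OF bl] unfolding differentiable_def by blast
  have g0: "g z = 0" by (simp add: g_def linear_simps[OF bl])
  have blG: "bounded_linear G" using G by (rule has_derivative_bounded_linear)
  obtain K where K: "\<And>x. norm (G x) \<le> norm x * K"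
    using bounded_linear.pos_bounded[OF blG] by blast
  define q where "q x = norm (g x - G (x - z)) / norm (x - z)" for x
  have q0: "(q \<longlongrightarrow> 0) (at z)"
    using G unfolding has_derivative_iff_norm q_def by (simp add: g0)
  have "\<forall>\<^sub>F x in at z. x \<noteq> z" by (simp add: eventually_at_filter)
  with est have bound: "\<forall>\<^sub>F x in at z. norm (norm (y x - y z - G (x - z)) / norm (x - z))
      \<le> q x + 2 * e x * (q x + K)"
  proof eventually_elim
    case (elim x)
    then have pos: "norm (x - z) > 0" by simp
    have gq: "norm (g x) \<le> (q x + K) * norm (x - z)"
    proof -
      have "norm (g x) \<le> norm (g x - G (x - z)) + norm (G (x - z))"
        using norm_triangle_ineq[of "g x - G (x - z)" "G (x - z)"] by simp
      also have "norm (g x - G (x - z)) = q x * norm (x - z)" using pos by (simp add: q_def)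
      finally show ?thesis using K[of "x - z"] by (simp add: algebra_simps)
    qed
    have "norm (y x - y z - G (x - z)) \<le> norm (g x - G (x - z)) + norm (y x - y z - g x)"
      using norm_triangle_ineq[of "g x - G (x - z)" "y x - y z - g x"] by (simp add: algebra_simps)
    also have "norm (y x - y z - g x) \<le> e x * (2 * norm (g x))" using elim by simp
    also have "\<dots> \<le> e x * (2 * ((q x + K) * norm (x - z)))"
      using gq elim by (intro mult_left_mono) auto
    also have "norm (g x - G (x - z)) = q x * norm (x - z)" using pos by (simp add: q_def)
    finally have "norm (y x - y z - G (x - z)) \<le> (q x + 2 * e x * (q x + K)) * norm (x - z)"
      by (simp add: algebra_simps)
    then show ?case using pos by (simp add: divide_le_eq)
  qed
  have "((\<lambda>x. q x + 2 * e x * (q x + K)) \<longlongrightarrow> 0 + 2 * 0 * (0 + K)) (at z)"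
    by (intro tendsto_intros q0 e0)
  then have "((\<lambda>x. norm (y x - y z - G (x - z)) / norm (x - z)) \<longlongrightarrow> 0) (at z)"
    using Lim_null_comparison[OF bound] by simp
  with blG have "(y has_derivative G) (at z)" unfolding has_derivative_iff_norm by blast
  then show ?thesis by (auto simp: differentiable_def)
qed

text \<open>
  Differentiating \<open>R y = w\<close> yields a system of the same kind for the derivatives of \<open>y\<close>, so that
  no formula for the inverse is needed.
\<close>

lemma smooth_on_linear_solve:
  fixes R :: "'a::euclidean_space \<Rightarrow> 'b::euclidean_space \<Rightarrow> 'c::euclidean_space"
  assumes S: "open S" and lin: "\<And>x. x \<in> S \<Longrightarrow> linear (R x)" and inj: "\<And>x. x \<in> S \<Longrightarrow> inj (R x)"
    and sm: "\<And>u. smooth_on S (\<lambda>x. R x u)" and w: "smooth_on S w"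
    and eq: "\<And>x. x \<in> S \<Longrightarrow> R x (y x) = w x"
  shows "smooth_on S y"
proof -
  have R_diff: "(\<lambda>x. R x u) differentiable (at x)" if "x \<in> S" for x u
    using smooth_on_differentiable[OF sm that] .
  have R_Ck: "Ck_on k S (\<lambda>x. R x u)" for k u
    using sm by (simp add: smooth_on_def)
  have "Ck_on k S y" if "Ck_on k S w" "\<And>x. x \<in> S \<Longrightarrow> R x (y x) = w x" for k y w
    using that
  proof (induction k arbitrary: y w)
    case 0
    have "isCont y x" if x: "x \<in> S" for x
    proof (rule continuous_linear_solve[where R = R and w = w, OF S x lin inj[OF x]])
      show "isCont (\<lambda>x. R x u) x" for u
        using R_diff[OF x] by (rule differentiable_imp_continuous_within)
      show "isCont w x" using 0(1) x S by (simp add: continuous_on_eq_continuous_at)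
    qed (use 0 in auto)
    then show ?case by (simp add: continuous_at_imp_continuous_on)
  next
    case (Suc k)
    have y_diff: "y differentiable (at x)" if x: "x \<in> S" for x
      using Suc.prems x by (intro differentiable_linear_solve[where R = R and w = w, OF S x lin inj[OF x] R_diff[OF x]]) auto
    have y_Ck: "Ck_on k S y"
      by (rule Suc.IH[OF Ck_on_Suc_imp[OF Suc.prems(1)] Suc.prems(2)])
    have "Ck_on k S (\<lambda>x. der y x v)" for v
    proof (rule Suc.IH)
      \<comment> \<open>Leibniz rule for \<open>R x (y x) = w x\<close>, with the terms that
        differentiate \<open>R\<close> moved to the right. They contain \<open>y\<close>
        undifferentiated, which the induction hypothesis has just shown to be C^k.\<close>
      let ?r = "\<lambda>x. der w x v + - (\<Sum>b\<in>Basis. (y x \<bullet> b) *\<^sub>R der (\<lambda>x. R x b) x v)"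
      show "Ck_on k S ?r"
      proof (intro Ck_on_add S Ck_on_bounded_linear[OF bounded_linear_minus[OF bounded_linear_ident]]
          Ck_on_sum Ck_on_bilinear[OF bounded_bilinear_scaleR])
        show "Ck_on k S (\<lambda>x. der w x v)" using Suc.prems by simp
        show "Ck_on k S (\<lambda>x. y x \<bullet> b)" for b
          by (rule Ck_on_bounded_linear[OF bounded_linear_inner_left y_Ck S])
        show "Ck_on k S (\<lambda>x. der (\<lambda>x. R x b) x v)" for b
          using R_Ck[of "Suc k" b] by simp
      qed
      show "R x (der y x v) = ?r x" if x: "x \<in> S" for x
      proof -
        have "((\<lambda>x. \<Sum>b\<in>Basis. (y x \<bullet> b) *\<^sub>R R x b) has_derivative
            (\<lambda>v. \<Sum>b\<in>Basis. (y x \<bullet> b) *\<^sub>R der (\<lambda>x. R x b) x v + (der y x v \<bullet> b) *\<^sub>R R x b)) (at x)"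
          by (intro has_derivative_sum has_derivative_scaleR has_derivative_inner_left
              has_derivative_der y_diff R_diff x)
        moreover have "(\<Sum>b\<in>Basis. (y x' \<bullet> b) *\<^sub>R R x' b) = w x'" if "x' \<in> S" for x'
          using Suc.prems(2)[OF that] linear_sum_Basis[OF lin[OF that], of "y x'"] by simp
        ultimately have "(w has_derivative
            (\<lambda>v. \<Sum>b\<in>Basis. (y x \<bullet> b) *\<^sub>R der (\<lambda>x. R x b) x v + (der y x v \<bullet> b) *\<^sub>R R x b)) (at x)"
          by (rule has_derivative_transform_within_open[OF _ S x])
        then have "der w x v = (\<Sum>b\<in>Basis. (y x \<bullet> b) *\<^sub>R der (\<lambda>x. R x b) x v + (der y x v \<bullet> b) *\<^sub>R R x b)"
          by (simp add: der_eqI)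
        then show ?thesis
          using linear_sum_Basis[OF lin[OF x], of "der y x v"] by (simp add: sum.distrib)
      qed
    qed
    then show ?case using y_diff by simp
  qed
  then show ?thesis using w eq unfolding smooth_on_def by blast
qed

section \<open>Local existence and smoothness for ordinary differential equations\<close>

lemma smooth_on_imp_lipschitz:
  fixes F :: "'a::euclidean_space \<Rightarrow> 'b::euclidean_space"
  assumes "open W" "smooth_on W F" "compact C" "convex C" "C \<subseteq> W"
  obtains K where "K > 0" "\<And>x y. x \<in> C \<Longrightarrow> y \<in> C \<Longrightarrow> norm (F x - F y) \<le> K * norm (x - y)"
proof -
  \<comment> \<open>This sum dominates the operator norm of \<open>der F x\<close>; its continuity
    bounds that norm on the compact set, and convexity then admits the mean value
    inequality.\<close>
  have cont: "continuous_on C (\<lambda>x. \<Sum>b\<in>Basis. norm (der F x b))"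
    by (intro continuous_intros continuous_on_subset[OF smooth_on_continuous[OF smooth_on_der[OF assms(2)]] assms(5)])
  have "bounded ((\<lambda>x. \<Sum>b\<in>Basis. norm (der F x b)) ` C)"
    by (intro compact_imp_bounded compact_continuous_image cont assms)
  then obtain K where K: "K > 0" "\<And>x. x \<in> C \<Longrightarrow> (\<Sum>b\<in>Basis. norm (der F x b)) \<le> K"
    unfolding bounded_pos by fastforce
  have "norm (F x - F y) \<le> K * norm (x - y)" if "x \<in> C" "y \<in> C" for x y
  proof (rule differentiable_bound[OF assms(4) _ _ that])
    fix x assume x: "x \<in> C"
    then have d: "F differentiable (at x)"
      using smooth_on_differentiable[OF assms(2)] assms(5) by blast
    then show "(F has_derivative der F x) (at x within C)"
      by (rule has_derivative_at_withinI[OF has_derivative_der])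
    have "norm (der F x v) \<le> K * norm v" for v
    proof -
      have "norm (der F x v) \<le> (\<Sum>b\<in>Basis. norm ((v \<bullet> b) *\<^sub>R der F x b))"
        unfolding linear_sum_Basis[OF linear_der[OF d], of v] by (rule norm_sum)
      also have "\<dots> \<le> (\<Sum>b\<in>Basis. norm v * norm (der F x b))"
        by (intro sum_mono) (auto intro!: mult_right_mono simp: Basis_le_norm)
      also have "\<dots> = norm v * (\<Sum>b\<in>Basis. norm (der F x b))" by (simp add: sum_distrib_left)
      also have "\<dots> \<le> norm v * K" by (intro mult_left_mono K x) auto
      finally show ?thesis by (simp add: mult.commute)
    qed
    then show "onorm (der F x) \<le> K" by (rule onorm_le)
  qed
  with K(1) that show thesis by blast
qed

text \<open>
  Precomposing \<open>F\<close> with the metric projection onto a closed ball makes it globally Lipschitz and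
  bounded, so that Banach's theorem applies to the Picard operator on all bounded continuous
  functions.
\<close>

lemma ode_solution_exists:
  fixes F :: "'a::euclidean_space \<Rightarrow> 'a"
  assumes "open W" "z0 \<in> W" "smooth_on W F"
  obtains a z where "a > 0" "z 0 = z0"
    "\<And>t. t \<in> {-a<..<a} \<Longrightarrow> z t \<in> W \<and> (z has_vector_derivative F (z t)) (at t)"
proof -
  obtain r where r: "r > 0" "cball z0 r \<subseteq> W" using open_contains_cball_eq[OF assms(1)] assms(2) by blast
  obtain K where K: "K > 0" "\<And>x y. x \<in> cball z0 r \<Longrightarrow> y \<in> cball z0 r \<Longrightarrow> norm (F x - F y) \<le> K * norm (x - y)"
    using smooth_on_imp_lipschitz[OF assms(1,3) compact_cball convex_cball r(2)] by metis
  define p where "p = closest_point (cball z0 r)"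
  have ne: "cball z0 r \<noteq> {}" using r(1) by simp
  have p_in: "p x \<in> cball z0 r" for x
    unfolding p_def by (rule closest_point_in_set[OF closed_cball ne])
  have p_lip: "norm (p x - p y) \<le> norm (x - y)" for x y
    using closest_point_lipschitz[OF convex_cball closed_cball ne, of x y] by (simp add: p_def dist_norm)
  have p_id: "p x = x" if "x \<in> cball z0 r" for x
    unfolding p_def using that by (rule closest_point_self)
  have G_lip: "norm (F (p x) - F (p y)) \<le> K * norm (x - y)" for x y
    using K(2)[OF p_in p_in, of x y] mult_left_mono[OF p_lip[of x y], of K] K(1) by linarith
  have contF: "continuous_on (cball z0 r) F"
    using smooth_on_continuous[OF assms(3)] r(2) by (rule continuous_on_subset)
  have "continuous_on UNIV p" unfolding p_def by (rule continuous_on_closest_point[OF convex_cball closed_cball ne])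
  then have contG: "continuous_on UNIV (\<lambda>x. F (p x))"
    using contF p_in by (auto intro: continuous_on_compose2)
  have "bounded (F ` cball z0 r)"
    by (intro compact_imp_bounded compact_continuous_image contF compact_cball)
  then obtain B where B: "B > 0" "\<And>x. norm (F (p x)) \<le> B"
    using p_in unfolding bounded_pos by blast
  \<comment> \<open>The Picard operator is a difference of integrals over intervals of length at
    most \<open>2 * a\<close> and \<open>a\<close>. So \<open>3 * a * K \<le> 1/2\<close> makes it a
    contraction and \<open>3 * a * B \<le> r\<close> keeps its values in the ball.\<close>
  define a where "a = min (1 / (6 * K)) (r / (3 * B))"
  have a: "a > 0" "3 * a * K \<le> 1/2" "3 * a * B \<le> r"
  proof -
    show "a > 0" using K(1) B(1) r(1) by (simp add: a_def)
    have "a \<le> 1 / (6 * K)" "a \<le> r / (3 * B)" by (simp_all add: a_def)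
    then show "3 * a * K \<le> 1/2" "3 * a * B \<le> r" using K(1) B(1) by (simp_all add: field_simps)
  qed
  \<comment> \<open>Clamping the time to \<open>[-a, a]\<close> makes the operator act on bounded
    continuous functions on the whole line.\<close>
  define c where "c t = max (-a) (min a t)" for t :: real
  have c: "-a \<le> c t" "c t \<le> a" for t using a(1) by (auto simp: c_def)
  have cont_c: "continuous_on UNIV c" unfolding c_def by (intro continuous_intros)
  \<comment> \<open>The integral from 0 to the clamped time, written with base point
    \<open>-a\<close> because the set \<open>{0..t}\<close> is empty for negative
    \<open>t\<close>.\<close>
  define P where "P \<phi> t = z0 + (integral {-a..c t} (\<lambda>s. F (p (apply_bcontfun \<phi> s)))
      - integral {-a..0} (\<lambda>s. F (p (apply_bcontfun \<phi> s))))" for \<phi> :: "real \<Rightarrow>\<^sub>C 'a" and t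
  have contH: "continuous_on S (\<lambda>s. F (p (apply_bcontfun \<phi> s)))" for \<phi> :: "real \<Rightarrow>\<^sub>C 'a" and S
    by (rule continuous_on_compose2[OF contG continuous_on_apply_bcontfun]) auto
  note intH = integrable_continuous_real[OF contH]
  have P_bound: "norm (P \<phi> t - z0) \<le> 3 * a * B" for \<phi> t
  proof -
    have "norm (integral {-a..u} (\<lambda>s. F (p (apply_bcontfun \<phi> s)))) \<le> B * (u - (-a))" if "-a \<le> u" for u
      by (rule integral_bound[OF that contH]) (rule B(2))
    from this[OF c(1)[of t]] this[of 0]
    have "norm (integral {-a..c t} (\<lambda>s. F (p (apply_bcontfun \<phi> s)))) \<le> B * (c t + a)"
      "norm (integral {-a..0} (\<lambda>s. F (p (apply_bcontfun \<phi> s)))) \<le> B * a"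
      using a(1) by simp_all
    moreover have "B * (c t + a) \<le> B * (2 * a)" using c(2)[of t] B(1) by (intro mult_left_mono) auto
    ultimately show ?thesis
      unfolding P_def using norm_triangle_ineq4[of "integral {-a..c t} (\<lambda>s. F (p (apply_bcontfun \<phi> s)))"
          "integral {-a..0} (\<lambda>s. F (p (apply_bcontfun \<phi> s)))"] by (simp add: mult.commute)
  qed
  have P_cont: "continuous_on UNIV (P \<phi>)" for \<phi>
  proof -
    have "continuous_on {-a..a} (\<lambda>u. integral {-a..u} (\<lambda>s. F (p (apply_bcontfun \<phi> s))))"
      by (rule indefinite_integral_continuous_1[OF intH])
    then have "continuous_on UNIV (\<lambda>t. integral {-a..c t} (\<lambda>s. F (p (apply_bcontfun \<phi> s))))"
      using c by (intro continuous_on_compose2[OF _ cont_c]) auto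
    then show ?thesis unfolding P_def by (intro continuous_intros)
  qed
  have P_bc: "P \<phi> \<in> bcontfun" for \<phi>
  proof (rule bcontfun_normI[OF P_cont])
    show "norm (P \<phi> t) \<le> norm z0 + 3 * a * B" for t
      using P_bound[of \<phi> t] norm_triangle_ineq[of z0 "P \<phi> t - z0"] by simp
  qed
  have P_lip: "dist (P \<phi> t) (P \<psi> t) \<le> 1/2 * dist \<phi> \<psi>" for \<phi> \<psi> t
  proof -
    let ?h = "\<lambda>s. F (p (apply_bcontfun \<phi> s)) - F (p (apply_bcontfun \<psi> s))"
    have h: "norm (?h s) \<le> K * dist \<phi> \<psi>" for s
      using G_lip[of "apply_bcontfun \<phi> s" "apply_bcontfun \<psi> s"] dist_bounded[of \<phi> s \<psi>] K(1)
      by (smt (verit) dist_norm mult_left_mono)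
    have "norm (integral {-a..u} ?h) \<le> K * dist \<phi> \<psi> * (u - (-a))" if "-a \<le> u" for u
      by (rule integral_bound[OF that]) (auto intro: continuous_on_diff contH h)
    from this[OF c(1)[of t]] this[of 0]
    have *: "norm (integral {-a..c t} ?h) \<le> K * dist \<phi> \<psi> * (c t + a)"
      "norm (integral {-a..0} ?h) \<le> K * dist \<phi> \<psi> * a"
      using a(1) by simp_all
    have "K * dist \<phi> \<psi> * (c t + a) \<le> K * dist \<phi> \<psi> * (2 * a)"
      using c(2)[of t] K(1) by (intro mult_left_mono) auto
    moreover have P_diff: "P \<phi> t - P \<psi> t = integral {-a..c t} ?h - integral {-a..0} ?h"
      unfolding P_def by (simp add: integral_diff[OF intH intH])
    ultimately have "norm (P \<phi> t - P \<psi> t) \<le> K * dist \<phi> \<psi> * (2 * a) + K * dist \<phi> \<psi> * a"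
      unfolding P_diff using * norm_triangle_ineq4[of "integral {-a..c t} ?h" "integral {-a..0} ?h"] by linarith
    also have "\<dots> = (3 * a * K) * dist \<phi> \<psi>" by (simp add: algebra_simps)
    also have "\<dots> \<le> 1/2 * dist \<phi> \<psi>" using a(2) by (intro mult_right_mono) auto
    finally show ?thesis by (simp add: dist_norm)
  qed
  have "\<exists>!\<phi>. Bcontfun (P \<phi>) = \<phi>"
  proof (rule banach_fix_type)
    show "\<forall>\<phi> \<psi>. dist (Bcontfun (P \<phi>)) (Bcontfun (P \<psi>)) \<le> 1/2 * dist \<phi> \<psi>"
      by (intro allI dist_bound) (use P_lip in \<open>simp add: Bcontfun_inverse[OF P_bc]\<close>)
  qed auto
  then obtain \<phi> where \<phi>: "apply_bcontfun \<phi> = P \<phi>" by (metis Bcontfun_inverse[OF P_bc])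
  define z where "z = apply_bcontfun \<phi>"
  have zP: "z t = P \<phi> t" for t by (simp only: z_def \<phi>)
  have z_in: "z t \<in> cball z0 r" for t
    using P_bound[of \<phi> t] a(3) by (simp add: zP dist_norm norm_minus_commute)
  show thesis
  proof (rule that[OF a(1)])
    show "z 0 = z0" using a(1) by (simp add: zP P_def c_def)
    fix t assume t: "t \<in> {-a<..<a}"
    have "((\<lambda>u. integral {-a..u} (\<lambda>s. F (p (apply_bcontfun \<phi> s)))) has_vector_derivative
        F (p (apply_bcontfun \<phi> t))) (at t within {-a..a})"
      using t by (intro integral_has_vector_derivative contH) auto
    then have "((\<lambda>u. integral {-a..u} (\<lambda>s. F (p (apply_bcontfun \<phi> s)))) has_vector_derivative
        F (p (apply_bcontfun \<phi> t))) (at t)"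
      using t at_within_interior[of t "{-a..a}"] by simp
    then have "((\<lambda>u. z0 + (integral {-a..u} (\<lambda>s. F (p (apply_bcontfun \<phi> s)))
        - integral {-a..0} (\<lambda>s. F (p (apply_bcontfun \<phi> s))))) has_vector_derivative
        F (p (apply_bcontfun \<phi> t))) (at t)"
      by (auto intro!: derivative_eq_intros)
    moreover have "z u = z0 + (integral {-a..u} (\<lambda>s. F (p (apply_bcontfun \<phi> s)))
        - integral {-a..0} (\<lambda>s. F (p (apply_bcontfun \<phi> s))))" if "u \<in> {-a<..<a}" for u
      using that by (simp add: zP P_def c_def min_def max_def)
    ultimately have "(z has_vector_derivative F (p (apply_bcontfun \<phi> t))) (at t)"
      using has_vector_derivative_transform_within_open[OF _ open_greaterThanLessThan t] by fastforce
    \<comment> \<open>The fixed point never leaves the ball, where the projection \<open>p\<close>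
      is the identity, so the modified equation is the original one.\<close>
    then show "z t \<in> W \<and> (z has_vector_derivative F (z t)) (at t)"
      using z_in[of t] r(2) p_id[OF z_in] by (auto simp: z_def)
  qed
qed

text \<open>Bootstrapping: if \<open>z\<close> is C^k, so is \<open>F (z t)\<close>, which is the
  derivative of \<open>z\<close>; hence \<open>z\<close> is of class C^(k+1).\<close>

lemma smooth_on_ode_solution:
  fixes F :: "'a::euclidean_space \<Rightarrow> 'a"
  assumes "open I" "smooth_on W F"
    and sol: "\<And>t. t \<in> I \<Longrightarrow> z t \<in> W \<and> (z has_vector_derivative F (z t)) (at t)"
  shows "smooth_on I z"
proof -
  have dz: "(z has_derivative (\<lambda>h. h *\<^sub>R F (z t))) (at t)" if "t \<in> I" for t
    using sol[OF that] by (simp add: has_vector_derivative_def)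
  have "Ck_on k I z" for k
  proof (induction k)
    case 0
    have "isCont z t" if "t \<in> I" for t
      using dz[OF that] by (rule has_derivative_continuous)
    then show ?case by (simp add: continuous_at_imp_continuous_on)
  next
    case (Suc k)
    have "Ck_on k I (\<lambda>t. der z t v)" for v
    proof (rule Ck_on_cong[OF assms(1)])
      have "Ck_on k I (\<lambda>t. F (z t))"
        using assms(2) sol by (intro Ck_on_compose[OF assms(1) _ Suc.IH, of W]) (auto simp: smooth_on_def)
      then show "Ck_on k I (\<lambda>t. v *\<^sub>R F (z t))"
        by (rule Ck_on_bounded_linear[OF bounded_linear_scaleR_right _ assms(1)])
      show "v *\<^sub>R F (z t) = der z t v" if "t \<in> I" for t
        using der_eqI[OF dz[OF that]] by simp
    qed
    moreover have "\<forall>t\<in>I. z differentiable (at t)" using dz by (auto simp: differentiable_def)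
    ultimately show ?case by simp
  qed
  then show ?thesis by (simp add: smooth_on_def)
qed

section \<open>Manifolds\<close>

lemma chart_inv_cmap: "chart_on X c \<Longrightarrow> p \<in> cdom c \<Longrightarrow> chart_inv c (cmap c p) = p"
  unfolding chart_on_def chart_inv_def by (simp add: inv_into_f_f)

lemma compatible_sym: "compatible c d \<longleftrightarrow> compatible d c"
  unfolding compatible_def by (auto simp: Int_commute)

text \<open>The change from \<open>c\<close> to \<open>e\<close> factors through \<open>d\<close>
  only where the three domains meet, so the conclusion is local around \<open>p\<close>.
  \<open>T\<close> consists of the coordinates whose image in \<open>d\<close> lies in the domain of
  \<open>e\<close>.\<close>

lemma compatible_via:
  assumes "chart_on X c" "chart_on X d" "chart_on X e" "compatible c d" "compatible d e"
    and p: "p \<in> cdom c" "p \<in> cdom d" "p \<in> cdom e"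
  obtains T where "open T" "cmap c p \<in> T" "T \<subseteq> cmap c ` (cdom c \<inter> cdom e)"
    "smooth_on T (cmap e \<circ> chart_inv c)"
proof -
  let ?cd = "cmap d \<circ> chart_inv c" and ?de = "cmap e \<circ> chart_inv d"
  define T where "T = {x \<in> cmap c ` (cdom c \<inter> cdom d). ?cd x \<in> cmap d ` (cdom d \<inter> cdom e)}"
  have cd: "open (cmap c ` (cdom c \<inter> cdom d))" "smooth_on (cmap c ` (cdom c \<inter> cdom d)) ?cd"
    and de: "open (cmap d ` (cdom d \<inter> cdom e))" "smooth_on (cmap d ` (cdom d \<inter> cdom e)) ?de"
    using assms(4,5) by (auto simp: compatible_def)
  have T: "open T"
    unfolding T_def using continuous_open_preimage[OF smooth_on_continuous[OF cd(2)] cd(1) de(1)]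
    by (simp add: vimage_def Int_def)
  have mem: "\<exists>q. q \<in> cdom c \<inter> cdom d \<inter> cdom e \<and> x = cmap c q" if xT: "x \<in> T" for x
  proof -
    obtain q where q: "q \<in> cdom c" "q \<in> cdom d" "x = cmap c q" using xT by (auto simp: T_def)
    have "cmap d q \<in> cmap d ` (cdom d \<inter> cdom e)"
      using xT q chart_inv_cmap[OF assms(1)] by (auto simp: T_def)
    then have "q \<in> cdom e" using q(2) assms(2) by (auto simp: chart_on_def inj_on_def)
    with q show ?thesis by blast
  qed
  have "smooth_on T (\<lambda>x. ?de (?cd x))"
    by (rule smooth_on_compose[OF de(2) smooth_on_subset[OF cd(2)] T]) (auto simp: T_def)
  then have "smooth_on T (cmap e \<circ> chart_inv c)"
  proof (rule smooth_on_cong[OF T, rotated])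
    fix x assume "x \<in> T"
    from mem[OF this] obtain q where "q \<in> cdom c \<inter> cdom d \<inter> cdom e" "x = cmap c q" by blast
    then show "?de (?cd x) = (cmap e \<circ> chart_inv c) x"
      using chart_inv_cmap[OF assms(1)] chart_inv_cmap[OF assms(2)] by simp
  qed
  moreover have "cmap c p \<in> T" using p chart_inv_cmap[OF assms(1)] by (auto simp: T_def)
  moreover have "T \<subseteq> cmap c ` (cdom c \<inter> cdom e)" using mem by blast
  ultimately show thesis using T that by blast
qed

text \<open>The setting for computations in charts. It is interpreted for the base manifold, the
  total space of the distribution, tangent and cotangent bundles, and the induced structures on
  submanifolds.\<close>

locale atlas_mfd =
  fixes M :: "('m, 'e::euclidean_space) mfd"
  assumes atlas_chart_on: "c \<in> atlas M \<Longrightarrow> chart_on (points M) c"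
    and atlas_cover: "(\<Union>c\<in>atlas M. cdom c) = points M"
    and atlas_compatible: "c \<in> atlas M \<Longrightarrow> d \<in> atlas M \<Longrightarrow> compatible c d"
begin

lemma atlas_max: "c \<in> atlas M \<Longrightarrow> c \<in> max_atlas M"
  by (simp add: max_atlas_def atlas_chart_on atlas_compatible)

lemma max_chart_on: "c \<in> max_atlas M \<Longrightarrow> chart_on (points M) c"
  by (simp add: max_atlas_def)

lemma inv_cmap: "c \<in> max_atlas M \<Longrightarrow> p \<in> cdom c \<Longrightarrow> chart_inv c (cmap c p) = p"
  by (rule chart_inv_cmap[OF max_chart_on])

lemma open_image: "c \<in> max_atlas M \<Longrightarrow> open (cmap c ` cdom c)"
  using max_chart_on[of c] by (simp add: chart_on_def)

lemma dom_points: "c \<in> max_atlas M \<Longrightarrow> p \<in> cdom c \<Longrightarrow> p \<in> points M"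
  using max_chart_on[of c] by (auto simp: chart_on_def)

lemma cmap_eq_iff: "c \<in> max_atlas M \<Longrightarrow> p \<in> cdom c \<Longrightarrow> q \<in> cdom c \<Longrightarrow> cmap c p = cmap c q \<longleftrightarrow> p = q"
  by (rule inj_on_eq_iff[of "cmap c" "cdom c"]) (use max_chart_on[of c] in \<open>simp_all add: chart_on_def\<close>)

lemma ex_chart: "p \<in> points M \<Longrightarrow> \<exists>c\<in>atlas M. p \<in> cdom c"
  using atlas_cover by blast

lemma chart_at: "p \<in> points M \<Longrightarrow> chart_at M p \<in> atlas M" "p \<in> points M \<Longrightarrow> p \<in> cdom (chart_at M p)"
  using someI_ex[of "\<lambda>c. c \<in> atlas M \<and> p \<in> cdom c"] ex_chart unfolding chart_at_def by blast+

text \<open>Charts of the maximal atlas are compared by definition only with atlas charts. Near each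
  point of the overlap an atlas chart serves as intermediary, and both openness and smoothness are
  local.\<close>

lemma max_compatible:
  assumes "c \<in> max_atlas M" "d \<in> max_atlas M"
  shows "compatible c d"
proof -
  have *: "\<exists>T. open T \<and> x \<in> T \<and> T \<subseteq> cmap c ` (cdom c \<inter> cdom d) \<and> smooth_on T (cmap d \<circ> chart_inv c)"
    if cd: "c \<in> max_atlas M" "d \<in> max_atlas M" and x: "x \<in> cmap c ` (cdom c \<inter> cdom d)" for c d x
  proof -
    obtain p where p: "p \<in> cdom c" "p \<in> cdom d" "x = cmap c p" using x by blast
    obtain a where a: "a \<in> atlas M" "p \<in> cdom a" using ex_chart dom_points cd(1) p(1) by blast
    have "compatible c a" "compatible a d"
      using cd a compatible_sym by (auto simp: max_atlas_def)
    from compatible_via[OF max_chart_on[OF cd(1)] atlas_chart_on[OF a(1)] max_chart_on[OF cd(2)] this p(1) a(2) p(2)]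
    show ?thesis using p(3) by metis
  qed
  have **: "open (cmap c ` (cdom c \<inter> cdom d)) \<and> smooth_on (cmap c ` (cdom c \<inter> cdom d)) (cmap d \<circ> chart_inv c)"
    if cd: "c \<in> max_atlas M" "d \<in> max_atlas M" for c d
  proof
    show "open (cmap c ` (cdom c \<inter> cdom d))"
      using *[OF cd] by (subst open_subopen) blast
    show "smooth_on (cmap c ` (cdom c \<inter> cdom d)) (cmap d \<circ> chart_inv c)"
      using *[OF cd] by (intro smooth_on_local) blast
  qed
  show ?thesis
    using **[OF assms] **[OF assms(2,1)] by (simp add: compatible_def Int_commute)
qed

lemma open_overlap: "c \<in> max_atlas M \<Longrightarrow> d \<in> max_atlas M \<Longrightarrow> open (cmap c ` (cdom c \<inter> cdom d))"
  using max_compatible[of c d] by (simp add: compatible_def)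

lemma smooth_trans:
  "c \<in> max_atlas M \<Longrightarrow> d \<in> max_atlas M \<Longrightarrow> smooth_on (cmap c ` (cdom c \<inter> cdom d)) (cmap d \<circ> chart_inv c)"
  using max_compatible[of c d] by (simp add: compatible_def)

section \<open>Tangent vectors and derivatives in charts of the maximal atlas\<close>

abbreviation jac :: "('m, 'e) chart \<Rightarrow> ('m, 'e) chart \<Rightarrow> 'm \<Rightarrow> 'e \<Rightarrow> 'e" where
  "jac c d p \<equiv> der (cmap d \<circ> chart_inv c) (cmap c p)"

lemma trans_differentiable:
  assumes "c \<in> max_atlas M" "d \<in> max_atlas M" "p \<in> cdom c" "p \<in> cdom d"
  shows "(cmap d \<circ> chart_inv c) differentiable (at (cmap c p))"
  by (rule smooth_on_differentiable[OF smooth_trans[OF assms(1,2)]]) (use assms in blast)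

text \<open>The chain rule through the coordinate change. Used in both directions, it replaces the
  chart selected by \<open>chart_at\<close> with any chart of the maximal atlas.\<close>

lemma der_change_chart:
  fixes g :: "'m \<Rightarrow> 'z::real_normed_vector"
  assumes cd: "c \<in> max_atlas M" "d \<in> max_atlas M" and p: "p \<in> cdom c" "p \<in> cdom d"
    and g: "(g \<circ> chart_inv d) differentiable (at (cmap d p))"
  shows "(g \<circ> chart_inv c) differentiable (at (cmap c p))"
    and "der (g \<circ> chart_inv c) (cmap c p) u = der (g \<circ> chart_inv d) (cmap d p) (jac c d p u)"
proof -
  let ?t = "cmap d \<circ> chart_inv c"
  have t: "?t differentiable (at (cmap c p))" by (rule trans_differentiable[OF assms(1-4)])
  have tp: "?t (cmap c p) = cmap d p" by (simp add: inv_cmap[OF cd(1) p(1)])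
  have "((\<lambda>x. (g \<circ> chart_inv d) (?t x)) has_derivative
      (\<lambda>u. der (g \<circ> chart_inv d) (cmap d p) (jac c d p u))) (at (cmap c p))"
    by (rule has_derivative_compose[OF has_derivative_der[OF t]])
       (simp only: tp has_derivative_der[OF g])
  then have "((g \<circ> chart_inv c) has_derivative
      (\<lambda>u. der (g \<circ> chart_inv d) (cmap d p) (jac c d p u))) (at (cmap c p))"
  proof (rule has_derivative_transform_within_open[OF _ open_overlap[OF cd]])
    show "cmap c p \<in> cmap c ` (cdom c \<inter> cdom d)" using p by blast
    show "(g \<circ> chart_inv d) (?t x) = (g \<circ> chart_inv c) x" if "x \<in> cmap c ` (cdom c \<inter> cdom d)" for x
      using that by (auto simp: inv_cmap[OF cd(1)] inv_cmap[OF cd(2)])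
  qed
  then show "(g \<circ> chart_inv c) differentiable (at (cmap c p))"
    "der (g \<circ> chart_inv c) (cmap c p) u = der (g \<circ> chart_inv d) (cmap d p) (jac c d p u)"
    by (auto simp: differentiable_def der_eqI)
qed

lemma jac_trans:
  assumes "c \<in> max_atlas M" "d \<in> max_atlas M" "e \<in> max_atlas M" "p \<in> cdom c" "p \<in> cdom d" "p \<in> cdom e"
  shows "jac d e p (jac c d p u) = jac c e p u"
  by (rule der_change_chart(2)[symmetric, OF assms(1,2,4,5) trans_differentiable[OF assms(2,3,5,6)]])

lemma jac_self:
  assumes "c \<in> max_atlas M" "p \<in> cdom c"
  shows "jac c c p u = u"
proof -
  have "der (cmap c \<circ> chart_inv c) (cmap c p) = der (\<lambda>x. x) (cmap c p)"
    by (rule der_cong[OF open_image[OF assms(1)]]) (use assms in \<open>auto simp: inv_cmap\<close>)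
  then show ?thesis by (simp add: frechet_derivative_ident)
qed

lemma linear_jac:
  assumes "c \<in> max_atlas M" "d \<in> max_atlas M" "p \<in> cdom c" "p \<in> cdom d"
  shows "linear (jac c d p)"
  by (rule linear_der[OF trans_differentiable[OF assms]])

lemma fst_tvec_of [simp]: "fst (tvec_of M c p u) = p"
  by (simp add: tvec_of_def)

lemma snd_tvec_of: "d \<in> atlas M \<Longrightarrow> p \<in> cdom d \<Longrightarrow> snd (tvec_of M c p u) d = jac c d p u"
  by (simp add: tvec_of_def)

lemma snd_tvec_of_self: "c \<in> atlas M \<Longrightarrow> p \<in> cdom c \<Longrightarrow> snd (tvec_of M c p u) c = u"
  by (simp add: snd_tvec_of jac_self atlas_max)

lemma tvec_of_eqI:
  assumes "\<And>d. d \<in> atlas M \<Longrightarrow> p \<in> cdom d \<Longrightarrow> \<xi> d = jac c d p u"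
    and "\<And>d. \<not> (d \<in> atlas M \<and> p \<in> cdom d) \<Longrightarrow> \<xi> d = 0"
  shows "(p, \<xi>) = tvec_of M c p u"
proof -
  have "\<xi> = (\<lambda>d. if d \<in> atlas M \<and> p \<in> cdom d then jac c d p u else 0)"
    by (rule ext) (simp only: assms split: if_split, blast intro: assms)
  then show ?thesis by (simp only: tvec_of_def)
qed

lemma tvec_of_change:
  assumes "c \<in> max_atlas M" "d \<in> max_atlas M" "p \<in> cdom c" "p \<in> cdom d"
  shows "tvec_of M c p u = tvec_of M d p (jac c d p u)"
proof -
  have "jac d a p (jac c d p u) = jac c a p u" if "a \<in> atlas M" "p \<in> cdom a" for a
    by (rule jac_trans[OF assms(1,2) atlas_max[OF that(1)] assms(3,4) that(2)])
  then show ?thesis unfolding tvec_of_def by (simp add: fun_eq_iff)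
qed

lemma tvec_of_in_tangent:
  assumes "c \<in> max_atlas M" "p \<in> cdom c"
  shows "tvec_of M c p u \<in> tangent_space M p"
proof -
  have "jac a b p (jac c a p u) = jac c b p u"
    if "a \<in> atlas M" "p \<in> cdom a" "b \<in> atlas M" "p \<in> cdom b" for a b
    by (rule jac_trans[OF assms(1) atlas_max[OF that(1)] atlas_max[OF that(3)] assms(2) that(2,4)])
  then show ?thesis unfolding tvec_of_def tangent_space_def by simp
qed

lemma tangent_eq_tvec_of:
  assumes "w \<in> tangent_space M p" "c \<in> atlas M" "p \<in> cdom c"
  shows "w = tvec_of M c p (snd w c)"
proof -
  from assms(1)[unfolded tangent_space_def mem_Collect_eq] obtain \<xi> where w: "w = (p, \<xi>)"
    and \<xi>: "\<forall>c\<in>atlas M. \<forall>d\<in>atlas M. p \<in> cdom c \<longrightarrow> p \<in> cdom d \<longrightarrow> \<xi> d = jac c d p (\<xi> c)"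
      "\<forall>c. \<not> (c \<in> atlas M \<and> p \<in> cdom c) \<longrightarrow> \<xi> c = 0"
    by (elim exE conjE) (rule that)
  have "(p, \<xi>) = tvec_of M c p (\<xi> c)"
    by (rule tvec_of_eqI) (use \<xi> assms(2,3) in blast)+
  moreover have "snd w c = \<xi> c" by (simp only: w snd_conv)
  ultimately show ?thesis using w by (simp only:)
qed

text \<open>If \<open>c\<close> is not an atlas chart, the vector does not store its components in
  \<open>c\<close>. They are recovered from an atlas chart \<open>a\<close>, since
  \<open>jac a c p\<close> inverts \<open>jac c a p\<close>.\<close>

lemma tvec_of_inject:
  assumes "c \<in> max_atlas M" "p \<in> cdom c"
  shows "tvec_of M c p u = tvec_of M c p v \<longleftrightarrow> u = v"
proof
  assume eq: "tvec_of M c p u = tvec_of M c p v"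
  obtain a where a: "a \<in> atlas M" "p \<in> cdom a" using ex_chart[OF dom_points[OF assms]] by blast
  have "jac c a p u = jac c a p v" using arg_cong[OF eq, of "\<lambda>w. snd w a"] snd_tvec_of[OF a] by simp
  then have "jac a c p (jac c a p u) = jac a c p (jac c a p v)" by simp
  then show "u = v"
    by (simp only: jac_trans[OF assms(1) atlas_max[OF a(1)] assms(1,2) a(2) assms(2)] jac_self[OF assms])
qed simp

text \<open>The components cannot be read off as \<open>snd w c\<close>, which is 0 by convention
  when \<open>c\<close> is not in the atlas; they are transported from an atlas chart by the
  Jacobian.\<close>

lemma tangent_repr:
  assumes "w \<in> tangent_space M p" "c \<in> max_atlas M" "p \<in> cdom c"
  obtains u where "w = tvec_of M c p u"
proof -
  obtain a where a: "a \<in> atlas M" "p \<in> cdom a" using ex_chart[OF dom_points[OF assms(2,3)]] by blast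
  show thesis
    using that[of "jac a c p (snd w a)"] tangent_eq_tvec_of[OF assms(1) a]
      tvec_of_change[OF atlas_max[OF a(1)] assms(2) a(2) assms(3)] by metis
qed

lemma differential_tvec_of:
  assumes "c \<in> max_atlas M" "p \<in> cdom c" "(f \<circ> chart_inv c) differentiable (at (cmap c p))"
  shows "differential M f (tvec_of M c p u) = der (f \<circ> chart_inv c) (cmap c p) u"
proof -
  let ?a = "chart_at M p"
  have p: "p \<in> points M" using dom_points[OF assms(1,2)] .
  note a = atlas_max[OF chart_at(1)[OF p]] chart_at(2)[OF p]
  have "differential M f (tvec_of M c p u) = der (f \<circ> chart_inv ?a) (cmap ?a p) (jac c ?a p u)"
    by (simp add: differential_def Let_def snd_tvec_of[OF chart_at[OF p]])
  also have "\<dots> = der (f \<circ> chart_inv c) (cmap c p) u"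
    using der_change_chart(2)[OF assms(1) a(1) assms(2) a(2) der_change_chart(1)[OF a(1) assms(1) a(2) assms(2,3)]]
    by simp
  finally show ?thesis .
qed

text \<open>Both slice charts of this development arise in this way, from a bundle chart followed by
  a shear \<open>\<Phi>\<close>. Its inverse \<open>\<Psi>\<close> is given explicitly, so
  smoothness in both directions follows from composition.\<close>

lemma max_atlas_postcompose:
  fixes \<Phi> \<Psi> :: "'e \<Rightarrow> 'e"
  assumes c: "c \<in> max_atlas M" and W: "open W" "W \<subseteq> cmap c ` cdom c"
    and \<Phi>: "smooth_on W \<Phi>" and \<Psi>: "open (\<Phi> ` W)" "smooth_on (\<Phi> ` W) \<Psi>" "\<And>x. x \<in> W \<Longrightarrow> \<Psi> (\<Phi> x) = x"
  shows "Chart {p \<in> cdom c. cmap c p \<in> W} (\<lambda>p. \<Phi> (cmap c p)) \<in> max_atlas M" (is "?e \<in> _")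
proof -
  have img: "\<Phi> ` W = cmap ?e ` cdom ?e" using W(2) by auto
  have inj: "inj_on (cmap ?e) (cdom ?e)"
  proof (rule inj_onI)
    fix p q assume *: "p \<in> cdom ?e" "q \<in> cdom ?e" "cmap ?e p = cmap ?e q"
    then have "p \<in> cdom c" "q \<in> cdom c" and W': "cmap c p \<in> W" "cmap c q \<in> W"
      and eq: "\<Phi> (cmap c p) = \<Phi> (cmap c q)" by simp_all
    moreover have "cmap c p = cmap c q"
      using \<Psi>(3)[OF W'(1)] \<Psi>(3)[OF W'(2)] arg_cong[OF eq, of \<Psi>] by metis
    ultimately show "p = q" using cmap_eq_iff[OF c] by simp
  qed
  have e: "chart_on (points M) ?e"
    using img inj \<Psi>(1) dom_points[OF c] by (auto simp: chart_on_def)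
  have inv_e: "chart_inv ?e (\<Phi> (cmap c p)) = p" if "p \<in> cdom c" "cmap c p \<in> W" for p
    using chart_inv_cmap[OF e, of p] that by simp
  have "compatible ?e d" if "d \<in> atlas M" for d
  proof -
    have d: "d \<in> max_atlas M" using that by (rule atlas_max)
    let ?O = "cmap c ` (cdom c \<inter> cdom d)" and ?O' = "cmap d ` (cdom c \<inter> cdom d)"
    have O: "open ?O" "open ?O'" using open_overlap[OF c d] open_overlap[OF d c] by (simp_all add: Int_commute)
    have sm: "smooth_on ?O (cmap d \<circ> chart_inv c)" "smooth_on ?O' (cmap c \<circ> chart_inv d)"
      using smooth_trans[OF c d] smooth_trans[OF d c] by (simp_all add: Int_commute)
    have 1: "cmap ?e ` (cdom ?e \<inter> cdom d) = \<Phi> ` W \<inter> \<Psi> -` ?O"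
    proof (intro equalityI subsetI)
      show "y \<in> \<Phi> ` W \<inter> \<Psi> -` ?O" if "y \<in> cmap ?e ` (cdom ?e \<inter> cdom d)" for y
        using that \<Psi>(3) by auto
      show "y \<in> cmap ?e ` (cdom ?e \<inter> cdom d)" if "y \<in> \<Phi> ` W \<inter> \<Psi> -` ?O" for y
        using that \<Psi>(3) by auto
    qed
    have 2: "cmap d ` (cdom ?e \<inter> cdom d) = ?O' \<inter> (cmap c \<circ> chart_inv d) -` W"
    proof (intro equalityI subsetI)
      show "y \<in> ?O' \<inter> (cmap c \<circ> chart_inv d) -` W" if "y \<in> cmap d ` (cdom ?e \<inter> cdom d)" for y
        using that inv_cmap[OF d] by auto
      show "y \<in> cmap d ` (cdom ?e \<inter> cdom d)" if "y \<in> ?O' \<inter> (cmap c \<circ> chart_inv d) -` W" for y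
        using that inv_cmap[OF d] by auto
    qed
    have o1: "open (cmap ?e ` (cdom ?e \<inter> cdom d))" unfolding 1
      by (rule continuous_open_preimage[OF smooth_on_continuous[OF \<Psi>(2)] \<Psi>(1) O(1)])
    have o2: "open (cmap d ` (cdom ?e \<inter> cdom d))" unfolding 2
      by (rule continuous_open_preimage[OF smooth_on_continuous[OF sm(2)] O(2) W(1)])
    have "smooth_on (cmap ?e ` (cdom ?e \<inter> cdom d)) (\<lambda>y. (cmap d \<circ> chart_inv c) (\<Psi> y))"
      by (rule smooth_on_compose[OF sm(1) smooth_on_subset[OF \<Psi>(2)] o1]) (auto simp: 1 \<Psi>(3))
    then have s1: "smooth_on (cmap ?e ` (cdom ?e \<inter> cdom d)) (cmap d \<circ> chart_inv ?e)"
      by (rule smooth_on_cong[OF o1, rotated]) (auto simp: inv_e inv_cmap[OF c] \<Psi>(3))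
    have "smooth_on (cmap d ` (cdom ?e \<inter> cdom d)) (\<lambda>y. \<Phi> ((cmap c \<circ> chart_inv d) y))"
      by (rule smooth_on_compose[OF \<Phi> smooth_on_subset[OF sm(2)] o2]) (auto simp: inv_cmap[OF d])
    then have s2: "smooth_on (cmap d ` (cdom ?e \<inter> cdom d)) (cmap ?e \<circ> chart_inv d)"
      by (rule smooth_on_cong[OF o2, rotated]) auto
    show ?thesis unfolding compatible_def using o1 o2 s1 s2 by blast
  qed
  with e show ?thesis by (simp add: max_atlas_def)
qed

end

text \<open>The map into an atlas chart \<open>b\<close> of \<open>N\<close> factors through
  \<open>d\<close> on the neighbourhood \<open>T\<close>, so the chain rule applies on the target
  side, and \<open>der_change_chart\<close> removes the selected chart on the source side.\<close>

lemma tangent_map_tvec_of: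
  fixes M :: "('m, 'e::euclidean_space) mfd" and N :: "('n, 'f::euclidean_space) mfd"
  assumes "atlas_mfd M" "atlas_mfd N"
    and c: "c \<in> max_atlas M" "p \<in> cdom c" and d: "d \<in> max_atlas N" "f p \<in> cdom d"
    and T: "open T" "cmap c p \<in> T" "\<And>x. x \<in> T \<Longrightarrow> f (chart_inv c x) \<in> cdom d"
    and diff: "(cmap d \<circ> f \<circ> chart_inv c) differentiable (at (cmap c p))"
  shows "tangent_map M N f (tvec_of M c p u)
    = tvec_of N d (f p) (der (cmap d \<circ> f \<circ> chart_inv c) (cmap c p) u)"
proof -
  interpret M: atlas_mfd M by fact
  interpret N: atlas_mfd N by fact
  let ?a = "chart_at M p" and ?F = "cmap d \<circ> f \<circ> chart_inv c"
  have p: "p \<in> points M" using M.dom_points[OF c] .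
  note a = M.atlas_max[OF M.chart_at(1)[OF p]] M.chart_at(2)[OF p]
  have Fp: "?F (cmap c p) = cmap d (f p)" using M.inv_cmap[OF c] by simp
  have main: "der (cmap b \<circ> f \<circ> chart_inv ?a) (cmap ?a p) (M.jac c ?a p u)
      = N.jac d b (f p) (der ?F (cmap c p) u)" if b: "b \<in> atlas N" "f p \<in> cdom b" for b
  proof -
    note b' = N.atlas_max[OF b(1)] b(2)
    have "((\<lambda>x. (cmap b \<circ> chart_inv d) (?F x)) has_derivative
        (\<lambda>u. N.jac d b (f p) (der ?F (cmap c p) u))) (at (cmap c p))"
      by (rule has_derivative_compose[OF has_derivative_der[OF diff]])
         (simp only: Fp has_derivative_der[OF N.trans_differentiable[OF d(1) b'(1) d(2) b'(2)]])
    then have *: "((cmap b \<circ> f \<circ> chart_inv c) has_derivative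
        (\<lambda>u. N.jac d b (f p) (der ?F (cmap c p) u))) (at (cmap c p))"
      by (rule has_derivative_transform_within_open[OF _ T(1,2)]) (simp add: T(3) N.inv_cmap[OF d(1)])
    then have "((cmap b \<circ> f) \<circ> chart_inv c) differentiable (at (cmap c p))"
      by (auto simp: differentiable_def)
    note change = M.der_change_chart[OF a(1) c(1) a(2) c(2) this]
    have "der (cmap b \<circ> f \<circ> chart_inv ?a) (cmap ?a p) (M.jac c ?a p u)
        = der (cmap b \<circ> f \<circ> chart_inv c) (cmap c p) u"
      using M.der_change_chart(2)[OF c(1) a(1) c(2) a(2) change(1)] by simp
    also have "\<dots> = N.jac d b (f p) (der ?F (cmap c p) u)" using der_eqI[OF *] by simp
    finally show ?thesis .
  qed
  show ?thesis
    unfolding tangent_map_def Let_def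
    by (simp only: M.fst_tvec_of M.snd_tvec_of[OF M.chart_at[OF p]])
       (rule N.tvec_of_eqI, simp add: main, rule if_not_P)
qed

section \<open>Tangent and cotangent bundles\<close>

context atlas_mfd
begin

text \<open>A name for the chart of the tangent bundle over \<open>c\<close>. It is meaningful for
  atlas charts only, since its fibre part reads the stored component \<open>snd v c\<close>.\<close>

definition tchart :: "('m, 'e) chart \<Rightarrow> (('m, 'e) tvec, 'e \<times> 'e) chart" where
  "tchart c = Chart {v \<in> (\<Union>p\<in>points M. tangent_space M p). fst v \<in> cdom c}
     (\<lambda>v. (cmap c (fst v), snd v c))"

lemma points_tangent_bundle: "points (tangent_bundle M) = (\<Union>p\<in>points M. tangent_space M p)"
  by (simp add: tangent_bundle_def)

lemma atlas_tangent_bundle: "atlas (tangent_bundle M) = tchart ` atlas M"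
  by (auto simp: tangent_bundle_def tchart_def)

lemma fst_tangent_space: "v \<in> tangent_space M p \<Longrightarrow> fst v = p"
  by (auto simp: tangent_space_def)

lemma mem_tangent_bundle: "v \<in> points (tangent_bundle M) \<longleftrightarrow> fst v \<in> points M \<and> v \<in> tangent_space M (fst v)"
  unfolding points_tangent_bundle UN_iff by (metis fst_tangent_space)

lemma tvec_of_mem:
  "c \<in> max_atlas M \<Longrightarrow> p \<in> cdom c \<Longrightarrow> tvec_of M c p u \<in> points (tangent_bundle M)"
  using tvec_of_in_tangent[of c p u] dom_points[of c p] by (simp add: mem_tangent_bundle)

lemma cdom_tchart: "v \<in> cdom (tchart c) \<longleftrightarrow> v \<in> points (tangent_bundle M) \<and> fst v \<in> cdom c"
  by (simp add: tchart_def points_tangent_bundle)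

lemma cmap_tchart: "cmap (tchart c) v = (cmap c (fst v), snd v c)"
  by (simp add: tchart_def)

lemma tchart_eq:
  assumes "c \<in> atlas M" "v \<in> cdom (tchart c)"
  shows "v = tvec_of M c (fst v) (snd v c)"
  by (rule tangent_eq_tvec_of) (use assms in \<open>auto simp: cdom_tchart mem_tangent_bundle\<close>)

lemma image_tchart:
  assumes c: "c \<in> atlas M" and T: "T \<subseteq> cdom c"
  shows "cmap (tchart c) ` {v \<in> cdom (tchart c). fst v \<in> T} = cmap c ` T \<times> UNIV"
proof (intro equalityI subsetI)
  fix z :: "'e \<times> 'e" assume "z \<in> cmap c ` T \<times> UNIV"
  then obtain p u where p: "p \<in> T" and z: "z = (cmap c p, u)" by auto
  then have "tvec_of M c p u \<in> {v \<in> cdom (tchart c). fst v \<in> T}" "cmap (tchart c) (tvec_of M c p u) = z"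
    using T tvec_of_mem[OF atlas_max[OF c]] snd_tvec_of_self[OF c] by (auto simp: cdom_tchart cmap_tchart)
  then show "z \<in> cmap (tchart c) ` {v \<in> cdom (tchart c). fst v \<in> T}" by blast
qed (auto simp: cmap_tchart)

lemma chart_on_tchart:
  assumes c: "c \<in> atlas M"
  shows "chart_on (points (tangent_bundle M)) (tchart c)"
proof -
  have "inj_on (cmap (tchart c)) (cdom (tchart c))"
  proof (rule inj_onI)
    fix v w assume vw: "v \<in> cdom (tchart c)" "w \<in> cdom (tchart c)" "cmap (tchart c) v = cmap (tchart c) w"
    then have "fst v = fst w" "snd v c = snd w c"
      using cmap_eq_iff[OF atlas_max[OF c], of "fst v" "fst w"] by (auto simp: cmap_tchart cdom_tchart)
    then show "v = w" using tchart_eq[OF c vw(1)] tchart_eq[OF c vw(2)] by metis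
  qed
  moreover have "open (cmap (tchart c) ` cdom (tchart c))"
  proof -
    have "{v \<in> cdom (tchart c). fst v \<in> cdom c} = cdom (tchart c)" by (auto simp: cdom_tchart)
    then show ?thesis
      using image_tchart[OF c order_refl] open_image[OF atlas_max[OF c]] by (simp add: open_Times)
  qed
  ultimately show ?thesis by (auto simp: chart_on_def cdom_tchart)
qed

lemma chart_inv_tchart:
  assumes "c \<in> atlas M" "p \<in> cdom c"
  shows "chart_inv (tchart c) (cmap c p, u) = tvec_of M c p u"
proof -
  have "cmap (tchart c) (tvec_of M c p u) = (cmap c p, u)"
    using snd_tvec_of_self[OF assms] by (simp add: cmap_tchart)
  moreover have "tvec_of M c p u \<in> cdom (tchart c)"
    using tvec_of_mem[OF atlas_max] assms by (simp add: cdom_tchart)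
  ultimately show ?thesis using chart_inv_cmap[OF chart_on_tchart[OF assms(1)]] by metis
qed

lemma smooth_on_jac_family:
  assumes "c \<in> max_atlas M" "d \<in> max_atlas M"
  shows "smooth_on (cmap c ` (cdom c \<inter> cdom d) \<times> UNIV) (\<lambda>z. der (cmap d \<circ> chart_inv c) (fst z) (snd z))"
proof -
  have o: "open (cmap c ` (cdom c \<inter> cdom d) \<times> (UNIV :: 'e set))"
    using open_overlap[OF assms] by (simp add: open_Times)
  show ?thesis
  proof (rule smooth_on_linear_family[OF o smooth_on_der[OF smooth_trans[OF assms]]])
    show "linear (der (cmap d \<circ> chart_inv c) x)" if "x \<in> cmap c ` (cdom c \<inter> cdom d)" for x
      by (rule linear_der[OF smooth_on_differentiable[OF smooth_trans[OF assms] that]])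
  qed (auto intro!: smooth_on_linear linear_fst linear_snd)
qed

lemma atlas_mfd_tangent_bundle: "atlas_mfd (tangent_bundle M)"
proof
  show "chart_on (points (tangent_bundle M)) C" if "C \<in> atlas (tangent_bundle M)" for C
    using that chart_on_tchart by (auto simp: atlas_tangent_bundle)
  show "(\<Union>C\<in>atlas (tangent_bundle M). cdom C) = points (tangent_bundle M)"
    using ex_chart by (fastforce simp: atlas_tangent_bundle cdom_tchart mem_tangent_bundle)
  have half: "open (cmap (tchart c) ` (cdom (tchart c) \<inter> cdom (tchart d))) \<and>
      smooth_on (cmap (tchart c) ` (cdom (tchart c) \<inter> cdom (tchart d))) (cmap (tchart d) \<circ> chart_inv (tchart c))"
    if c: "c \<in> atlas M" and d: "d \<in> atlas M" for c d
  proof -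
    note cm = atlas_max[OF c] and dm = atlas_max[OF d]
    let ?O = "cmap c ` (cdom c \<inter> cdom d)"
    have dom: "cdom (tchart c) \<inter> cdom (tchart d) = {v \<in> cdom (tchart c). fst v \<in> cdom c \<inter> cdom d}"
      by (auto simp: cdom_tchart)
    have img: "cmap (tchart c) ` (cdom (tchart c) \<inter> cdom (tchart d)) = ?O \<times> UNIV"
      unfolding dom by (rule image_tchart[OF c Int_lower1])
    have O: "open (?O \<times> (UNIV :: 'e set))" using open_overlap[OF cm dm] by (simp add: open_Times)
    have "smooth_on (?O \<times> UNIV) (\<lambda>z. ((cmap d \<circ> chart_inv c) (fst z), der (cmap d \<circ> chart_inv c) (fst z) (snd z)))"
      by (rule smooth_on_Pair[OF smooth_on_compose[OF smooth_trans[OF cm dm] smooth_on_linear[OF linear_fst] O]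
          smooth_on_jac_family[OF cm dm] O]) auto
    then have "smooth_on (?O \<times> UNIV) (cmap (tchart d) \<circ> chart_inv (tchart c))"
    proof (rule smooth_on_cong[OF O, rotated])
      fix z :: "'e \<times> 'e" assume "z \<in> ?O \<times> UNIV"
      then obtain p u where p: "p \<in> cdom c" "p \<in> cdom d" and z: "z = (cmap c p, u)" by auto
      show "((cmap d \<circ> chart_inv c) (fst z), der (cmap d \<circ> chart_inv c) (fst z) (snd z))
          = (cmap (tchart d) \<circ> chart_inv (tchart c)) z"
        using p by (simp add: z chart_inv_tchart[OF c p(1)] cmap_tchart snd_tvec_of[OF d p(2)] inv_cmap[OF cm])
    qed
    then show ?thesis using O by (simp add: img)
  qed
  show "compatible C C'" if C: "C \<in> atlas (tangent_bundle M)" "C' \<in> atlas (tangent_bundle M)" for C C'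
  proof -
    obtain c d where c: "c \<in> atlas M" "C = tchart c" and d: "d \<in> atlas M" "C' = tchart d"
      using C by (auto simp: atlas_tangent_bundle)
    show ?thesis unfolding c(2) d(2) compatible_def
      using half[OF c(1) d(1)] half[OF d(1) c(1)] by (simp add: Int_commute)
  qed
qed

section \<open>Covectors in coordinates and the cotangent bundle\<close>

lemma tvec_of_plus:
  assumes "c \<in> max_atlas M" "p \<in> cdom c"
  shows "(p, \<lambda>d. snd (tvec_of M c p u) d + snd (tvec_of M c p v) d) = tvec_of M c p (u + v)"
  unfolding tvec_of_def using assms linear_add[OF linear_jac] atlas_max by (simp add: fun_eq_iff)

lemma tvec_of_scaleR:
  assumes "c \<in> max_atlas M" "p \<in> cdom c"
  shows "(p, \<lambda>d. a *\<^sub>R snd (tvec_of M c p u) d) = tvec_of M c p (a *\<^sub>R u)"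
  unfolding tvec_of_def using assms linear_cmul[OF linear_jac] atlas_max by (simp add: fun_eq_iff)

text \<open>\<open>tvec_of M c p\<close> is a linear bijection onto the tangent space, so additivity
  and homogeneity of \<open>\<alpha>\<close> can be tested on components in one chart.\<close>

lemma mem_cotangent_space:
  assumes c: "c \<in> max_atlas M" "p \<in> cdom c"
  shows "(p, \<alpha>) \<in> cotangent_space M p \<longleftrightarrow>
    linear (\<lambda>u. \<alpha> (tvec_of M c p u)) \<and> (\<forall>v. v \<notin> tangent_space M p \<longrightarrow> \<alpha> v = 0)"
proof -
  have repr: "(p, \<xi>) \<in> tangent_space M p \<longleftrightarrow> (\<exists>u. \<xi> = snd (tvec_of M c p u))" for \<xi>
  proof
    assume "(p, \<xi>) \<in> tangent_space M p"
    from tangent_repr[OF this c] show "\<exists>u. \<xi> = snd (tvec_of M c p u)" by (metis snd_conv)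
  next
    assume "\<exists>u. \<xi> = snd (tvec_of M c p u)"
    then obtain u where "\<xi> = snd (tvec_of M c p u)" by blast
    then have "(p, \<xi>) = tvec_of M c p u" by (simp add: prod_eq_iff)
    then show "(p, \<xi>) \<in> tangent_space M p" using tvec_of_in_tangent[OF c] by metis
  qed
  have pair: "(p, snd (tvec_of M c p u)) = tvec_of M c p u" for u by (simp add: prod_eq_iff)
  have "(p, \<alpha>) \<in> cotangent_space M p \<longleftrightarrow>
      (\<forall>u v. \<alpha> (tvec_of M c p (u + v)) = \<alpha> (tvec_of M c p u) + \<alpha> (tvec_of M c p v)) \<and>
      (\<forall>a u. \<alpha> (tvec_of M c p (a *\<^sub>R u)) = a * \<alpha> (tvec_of M c p u)) \<and>
      (\<forall>v. v \<notin> tangent_space M p \<longrightarrow> \<alpha> v = 0)"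
    unfolding cotangent_space_def mem_Collect_eq repr
    by (simp add: all_simps(6)[symmetric] imp_ex pair tvec_of_plus[OF c] tvec_of_scaleR[OF c] del: all_simps) blast
  then show ?thesis by (auto simp: linear_iff)
qed

text \<open>The fibre part goes through \<open>tvec_of\<close>, so it makes sense for every chart of
  the maximal atlas. Slice charts of a submanifold therefore lift directly to the cotangent
  bundle.\<close>

definition cchart :: "('m, 'e) chart \<Rightarrow> (('m, 'e) covec, 'e \<times> 'e) chart" where
  "cchart c = Chart {\<mu> \<in> (\<Union>p\<in>points M. cotangent_space M p). fst \<mu> \<in> cdom c}
     (\<lambda>\<mu>. (cmap c (fst \<mu>), \<Sum>b\<in>Basis. snd \<mu> (tvec_of M c (fst \<mu>) b) *\<^sub>R b))"

text \<open>The inverse of \<open>cchart\<close>: the covector with momentum \<open>P\<close>. The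
  value 0 off the tangent space is the convention of \<open>cotangent_space\<close>.\<close>

definition covec_of :: "('m, 'e) chart \<Rightarrow> 'm \<Rightarrow> 'e \<Rightarrow> ('m, 'e) covec" where
  "covec_of c p P = (p, \<lambda>v. if v \<in> tangent_space M p then P \<bullet> (THE u. v = tvec_of M c p u) else 0)"

lemma fst_cotangent_space: "\<mu> \<in> cotangent_space M p \<Longrightarrow> fst \<mu> = p"
  by (auto simp: cotangent_space_def)

lemma mem_cotangent_bundle:
  "\<mu> \<in> points (cotangent_bundle M) \<longleftrightarrow> fst \<mu> \<in> points M \<and> \<mu> \<in> cotangent_space M (fst \<mu>)"
  unfolding cotangent_bundle_def mfd.sel UN_iff by (metis fst_cotangent_space)

lemma atlas_cotangent_bundle: "atlas (cotangent_bundle M) = cchart ` atlas M"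
  by (auto simp: cotangent_bundle_def cchart_def)

lemma cdom_cchart: "\<mu> \<in> cdom (cchart c) \<longleftrightarrow> \<mu> \<in> points (cotangent_bundle M) \<and> fst \<mu> \<in> cdom c"
  by (simp add: cchart_def cotangent_bundle_def)

lemma cmap_cchart: "cmap (cchart c) \<mu> = (cmap c (fst \<mu>), \<Sum>b\<in>Basis. snd \<mu> (tvec_of M c (fst \<mu>) b) *\<^sub>R b)"
  by (simp add: cchart_def)

lemma covec_apply:
  assumes c: "c \<in> max_atlas M" and \<mu>: "\<mu> \<in> cdom (cchart c)"
  shows "snd \<mu> (tvec_of M c (fst \<mu>) u) = snd (cmap (cchart c) \<mu>) \<bullet> u"
proof -
  have "(fst \<mu>, snd \<mu>) \<in> cotangent_space M (fst \<mu>)" "fst \<mu> \<in> cdom c"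
    using \<mu> by (auto simp: cdom_cchart mem_cotangent_bundle)
  then have "linear (\<lambda>u. snd \<mu> (tvec_of M c (fst \<mu>) u))"
    using mem_cotangent_space[OF c] by blast
  from linear_sum_Basis[OF this, of u] show ?thesis
    by (simp add: cmap_cchart inner_sum_left inner_commute[of u] mult.commute)
qed

lemma cmap_cchart_eqI:
  assumes "\<And>u. snd \<mu> (tvec_of M c (fst \<mu>) u) = P \<bullet> u"
  shows "cmap (cchart c) \<mu> = (cmap c (fst \<mu>), P)"
  by (simp add: cmap_cchart assms euclidean_representation)

lemma covec_of_apply:
  assumes c: "c \<in> max_atlas M" "p \<in> cdom c"
  shows "snd (covec_of c p P) (tvec_of M c p u) = P \<bullet> u"
  using tvec_of_in_tangent[OF c] tvec_of_inject[OF c] by (simp add: covec_of_def)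

lemma covec_of_mem:
  assumes c: "c \<in> max_atlas M" "p \<in> cdom c"
  shows "covec_of c p P \<in> cdom (cchart c)" "cmap (cchart c) (covec_of c p P) = (cmap c p, P)"
proof -
  have fst: "fst (covec_of c p P) = p" by (simp add: covec_of_def)
  have "(p, snd (covec_of c p P)) \<in> cotangent_space M p"
    unfolding mem_cotangent_space[OF c] covec_of_apply[OF c]
    by (auto simp: covec_of_def intro!: linearI inner_add_right)
  moreover have "(p, snd (covec_of c p P)) = covec_of c p P" by (simp add: covec_of_def)
  ultimately show "covec_of c p P \<in> cdom (cchart c)"
    using dom_points[OF c] c(2) by (simp add: cdom_cchart mem_cotangent_bundle fst)
  show "cmap (cchart c) (covec_of c p P) = (cmap c p, P)"
    using cmap_cchart_eqI[of "covec_of c p P" c P] covec_of_apply[OF c] fst by simp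
qed

lemma image_cchart:
  assumes c: "c \<in> max_atlas M" and T: "T \<subseteq> cdom c"
  shows "cmap (cchart c) ` {\<mu> \<in> cdom (cchart c). fst \<mu> \<in> T} = cmap c ` T \<times> UNIV"
proof (intro equalityI subsetI)
  fix z :: "'e \<times> 'e" assume "z \<in> cmap c ` T \<times> UNIV"
  then obtain p P where p: "p \<in> T" and z: "z = (cmap c p, P)" by auto
  then have "covec_of c p P \<in> {\<mu> \<in> cdom (cchart c). fst \<mu> \<in> T}" "cmap (cchart c) (covec_of c p P) = z"
    using T covec_of_mem[OF c] by (auto simp: covec_of_def)
  then show "z \<in> cmap (cchart c) ` {\<mu> \<in> cdom (cchart c). fst \<mu> \<in> T}" by blast
qed (auto simp: cmap_cchart)

lemma chart_on_cchart:
  assumes c: "c \<in> max_atlas M"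
  shows "chart_on (points (cotangent_bundle M)) (cchart c)"
proof -
  have "inj_on (cmap (cchart c)) (cdom (cchart c))"
  proof (rule inj_onI)
    fix \<mu> \<nu> assume \<mu>\<nu>: "\<mu> \<in> cdom (cchart c)" "\<nu> \<in> cdom (cchart c)" "cmap (cchart c) \<mu> = cmap (cchart c) \<nu>"
    then have fst: "fst \<mu> = fst \<nu>"
      using cmap_eq_iff[OF c, of "fst \<mu>" "fst \<nu>"] by (auto simp: cmap_cchart cdom_cchart)
    define p where "p = fst \<nu>"
    have p: "p \<in> cdom c" using \<mu>\<nu>(2) by (simp add: p_def cdom_cchart)
    have zero: "snd \<mu> v = 0" "snd \<nu> v = 0" if "v \<notin> tangent_space M p" for v
      using \<mu>\<nu>(1,2) that mem_cotangent_space[OF c p] fst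
      by (metis cdom_cchart mem_cotangent_bundle p_def prod.collapse)+
    have "snd \<mu> v = snd \<nu> v" for v
    proof (cases "v \<in> tangent_space M p")
      case True
      then obtain u where v: "v = tvec_of M c p u" using tangent_repr[OF _ c p] by blast
      show ?thesis
        using covec_apply[OF c \<mu>\<nu>(1), of u] covec_apply[OF c \<mu>\<nu>(2), of u] \<mu>\<nu>(3) by (simp add: v fst p_def)
    qed (simp add: zero)
    then show "\<mu> = \<nu>" using fst by (simp add: prod_eq_iff fun_eq_iff)
  qed
  moreover have "open (cmap (cchart c) ` cdom (cchart c))"
  proof -
    have "{\<mu> \<in> cdom (cchart c). fst \<mu> \<in> cdom c} = cdom (cchart c)" by (auto simp: cdom_cchart)
    then show ?thesis
      using image_cchart[OF c order_refl] open_image[OF c] by (simp add: open_Times)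
  qed
  ultimately show ?thesis by (auto simp: chart_on_def cdom_cchart)
qed

lemma chart_inv_cchart:
  assumes "c \<in> max_atlas M" "p \<in> cdom c"
  shows "chart_inv (cchart c) (cmap c p, P) = covec_of c p P"
  using covec_of_mem[OF assms] chart_inv_cmap[OF chart_on_cchart[OF assms(1)]] by metis

text \<open>Momenta transform by the transposed Jacobian of the inverse coordinate change: the
  component along \<open>b\<close> in the new chart is the old momentum paired with
  \<open>der ?s\<close> applied to \<open>b\<close>, taken at the new base coordinates.\<close>

lemma compatible_cchart:
  assumes "c \<in> max_atlas M" "d \<in> max_atlas M"
  shows "compatible (cchart c) (cchart d)"
proof -
  have half: "open (cmap (cchart c) ` (cdom (cchart c) \<inter> cdom (cchart d))) \<and>
      smooth_on (cmap (cchart c) ` (cdom (cchart c) \<inter> cdom (cchart d))) (cmap (cchart d) \<circ> chart_inv (cchart c))"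
    if c: "c \<in> max_atlas M" and d: "d \<in> max_atlas M" for c d
  proof -
    let ?O = "cmap c ` (cdom c \<inter> cdom d)"
    let ?t = "cmap d \<circ> chart_inv c" and ?s = "cmap c \<circ> chart_inv d"
    let ?G = "\<lambda>z. (?t (fst z), \<Sum>b\<in>Basis. (snd z \<bullet> der ?s (?t (fst z)) b) *\<^sub>R b)"
    have dom: "cdom (cchart c) \<inter> cdom (cchart d) = {v \<in> cdom (cchart c). fst v \<in> cdom c \<inter> cdom d}"
      by (auto simp: cdom_cchart)
    have img: "cmap (cchart c) ` (cdom (cchart c) \<inter> cdom (cchart d)) = ?O \<times> UNIV"
      unfolding dom by (rule image_cchart[OF c Int_lower1])
    have O: "open (?O \<times> (UNIV :: 'e set))" using open_overlap[OF c d] by (simp add: open_Times)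
    have t: "smooth_on (?O \<times> (UNIV :: 'e set)) (\<lambda>z. ?t (fst z))"
      by (rule smooth_on_compose[OF smooth_trans[OF c d] smooth_on_linear[OF linear_fst] O]) auto
    have s: "smooth_on (?O \<times> (UNIV :: 'e set)) (\<lambda>z. der ?s (?t (fst z)) b)" for b
      by (rule smooth_on_compose[OF smooth_on_der[OF smooth_trans[OF d c]] t O])
         (auto simp: inv_cmap[OF c])
    have "smooth_on (?O \<times> UNIV) ?G"
      by (intro smooth_on_Pair O t smooth_on_sum smooth_on_scaleR smooth_on_inner s smooth_on_const
          smooth_on_linear[OF linear_snd])
    then have "smooth_on (?O \<times> UNIV) (cmap (cchart d) \<circ> chart_inv (cchart c))"
    proof (rule smooth_on_cong[OF O, rotated])
      fix z :: "'e \<times> 'e" assume "z \<in> ?O \<times> UNIV"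
      then obtain p P where p: "p \<in> cdom c" "p \<in> cdom d" and z: "z = (cmap c p, P)" by auto
      have [simp]: "fst (covec_of c p P) = p" by (simp add: covec_of_def)
      show "?G z = (cmap (cchart d) \<circ> chart_inv (cchart c)) z"
        using p by (simp add: z chart_inv_cchart[OF c p(1)] cmap_cchart inv_cmap[OF c] tvec_of_change[OF d c p(2,1)]
            covec_of_apply[OF c p(1)])
    qed
    then show ?thesis using O by (simp add: img)
  qed
  show ?thesis unfolding compatible_def
    using half[OF assms] half[OF assms(2,1)] by (simp add: Int_commute)
qed

lemma atlas_mfd_cotangent_bundle: "atlas_mfd (cotangent_bundle M)"
proof
  show "chart_on (points (cotangent_bundle M)) C" if "C \<in> atlas (cotangent_bundle M)" for C
    using that chart_on_cchart atlas_max by (auto simp: atlas_cotangent_bundle)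
  show "(\<Union>C\<in>atlas (cotangent_bundle M). cdom C) = points (cotangent_bundle M)"
    using ex_chart by (fastforce simp: atlas_cotangent_bundle cdom_cchart mem_cotangent_bundle)
  show "compatible C C'" if "C \<in> atlas (cotangent_bundle M)" "C' \<in> atlas (cotangent_bundle M)" for C C'
    using that compatible_cchart atlas_max by (auto simp: atlas_cotangent_bundle)
qed

lemma cchart_max: "c \<in> max_atlas M \<Longrightarrow> cchart c \<in> max_atlas (cotangent_bundle M)"
  using compatible_cchart atlas_max chart_on_cchart by (auto simp: max_atlas_def[of "cotangent_bundle M"] atlas_cotangent_bundle)

end

section \<open>Submanifolds\<close>

definition induced_chart :: "'m set \<Rightarrow> ('m, 'e) chart \<Rightarrow> ('f \<Rightarrow> 'e) \<Rightarrow> ('m, 'f) chart" where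
  "induced_chart N c J = Chart (N \<inter> cdom c) (\<lambda>p. inv J (cmap c p))"

lemma cdom_induced_chart: "cdom (induced_chart N c J) = N \<inter> cdom c"
  by (simp add: induced_chart_def)

context atlas_mfd
begin

definition slice_chart :: "'m set \<Rightarrow> ('m, 'e) chart \<Rightarrow> ('f::euclidean_space \<Rightarrow> 'e) \<Rightarrow> bool" where
  "slice_chart N c J \<longleftrightarrow> c \<in> max_atlas M \<and> linear J \<and> inj J \<and>
     cmap c ` (N \<inter> cdom c) = cmap c ` cdom c \<inter> range J"

lemma points_induced: "points (induced_mfd M N) = N"
  by (simp add: induced_mfd_def)

lemma atlas_induced: "atlas (induced_mfd M N) = {induced_chart N c J | c J. slice_chart N c J}"
  by (auto simp: induced_mfd_def induced_chart_def slice_chart_def)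

lemma submanifold_iff:
  "submanifold TYPE('f::euclidean_space) M N \<longleftrightarrow>
    N \<subseteq> points M \<and> (\<forall>p\<in>N. \<exists>c (J :: 'f \<Rightarrow> 'e). slice_chart N c J \<and> p \<in> cdom c)"
  unfolding submanifold_def atlas_induced by (fastforce simp: cdom_induced_chart)

lemma induced_cmap:
  assumes "slice_chart N c J" "p \<in> N" "p \<in> cdom c"
  shows "J (cmap (induced_chart N c J) p) = cmap c p"
proof -
  have "cmap c p \<in> range J" using assms by (auto simp: slice_chart_def)
  then show ?thesis by (simp add: induced_chart_def f_inv_into_f)
qed

lemma open_slice_preimage:
  fixes J :: "'f::euclidean_space \<Rightarrow> 'e"
  assumes "slice_chart N c J" "open V"
  shows "open (J -` V)"
proof -
  have "continuous_on UNIV J"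
    using assms(1) by (simp add: slice_chart_def linear_continuous_on linear_conv_bounded_linear)
  then show ?thesis using assms(2) by (simp add: open_vimage)
qed

text \<open>A point of the chart domain whose coordinates lie in \<open>range J\<close> belongs to
  \<open>N\<close>, by the slice condition and injectivity of the chart. Hence every
  \<open>z\<close> with \<open>J z\<close> in the chart image is attained on
  \<open>N\<close>.\<close>

lemma image_induced_chart:
  assumes s: "slice_chart N c J" and T: "T \<subseteq> cdom c"
  shows "cmap (induced_chart N c J) ` (N \<inter> T) = J -` (cmap c ` T)"
proof (intro equalityI subsetI)
  fix z assume "z \<in> cmap (induced_chart N c J) ` (N \<inter> T)"
  then show "z \<in> J -` (cmap c ` T)" using induced_cmap[OF s] T by auto
next
  fix z assume "z \<in> J -` (cmap c ` T)"
  then obtain q where q: "q \<in> T" "J z = cmap c q" by auto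
  then have "cmap c q \<in> cmap c ` (N \<inter> cdom c)"
    using s T by (simp add: slice_chart_def) (metis image_eqI rangeI subsetD)
  then obtain p where "p \<in> N" "p \<in> cdom c" "cmap c q = cmap c p" by auto
  then have "q \<in> N" using cmap_eq_iff[of c q p] s T q(1) by (auto simp: slice_chart_def)
  moreover have "cmap (induced_chart N c J) q = z"
    using s q(2) by (simp add: induced_chart_def slice_chart_def inv_f_f flip: q(2))
  ultimately show "z \<in> cmap (induced_chart N c J) ` (N \<inter> T)" using q(1) by blast
qed

lemma chart_on_induced:
  assumes s: "slice_chart N c J"
  shows "chart_on N (induced_chart N c J)"
proof -
  have c: "c \<in> max_atlas M" using s by (simp add: slice_chart_def)
  have "inj_on (cmap (induced_chart N c J)) (N \<inter> cdom c)"
    using induced_cmap[OF s] cmap_eq_iff[OF c] by (intro inj_onI) (metis IntE)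
  moreover have "open (cmap (induced_chart N c J) ` (N \<inter> cdom c))"
    unfolding image_induced_chart[OF s order_refl] by (rule open_slice_preimage[OF s open_image[OF c]])
  ultimately show ?thesis by (simp add: chart_on_def cdom_induced_chart)
qed

lemma induced_chart_inv:
  assumes s: "slice_chart N c J" and z: "z \<in> J -` (cmap c ` cdom c)"
  shows "chart_inv (induced_chart N c J) z = chart_inv c (J z)"
    and "chart_inv c (J z) \<in> N" "chart_inv c (J z) \<in> cdom c" "cmap c (chart_inv c (J z)) = J z"
proof -
  have c: "c \<in> max_atlas M" using s by (simp add: slice_chart_def)
  obtain p where p: "p \<in> N" "p \<in> cdom c" "z = cmap (induced_chart N c J) p"
    using z image_induced_chart[OF s order_refl] by blast
  then have Jz: "J z = cmap c p" using induced_cmap[OF s] by simp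
  have inv: "chart_inv c (J z) = p" using Jz inv_cmap[OF c p(2)] by simp
  have "chart_inv (induced_chart N c J) (cmap (induced_chart N c J) p) = p"
    by (rule chart_inv_cmap[OF chart_on_induced[OF s]]) (simp add: cdom_induced_chart p)
  then show "chart_inv (induced_chart N c J) z = chart_inv c (J z)" using inv p(3) by simp
  show "chart_inv c (J z) \<in> N" "chart_inv c (J z) \<in> cdom c" "cmap c (chart_inv c (J z)) = J z"
    using p inv Jz by simp_all
qed

text \<open>On \<open>range K\<close> the set-theoretic inverse of \<open>K\<close> agrees with a
  linear left inverse \<open>R\<close>. Changes of induced charts are thus the ambient changes
  between the linear maps \<open>J\<close> and \<open>R\<close>, hence smooth.\<close>

lemma atlas_mfd_induced:
  assumes "submanifold TYPE('f::euclidean_space) M N"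
  shows "atlas_mfd (induced_mfd M N :: ('m, 'f) mfd)"
proof
  show "chart_on (points (induced_mfd M N)) C" if "C \<in> atlas (induced_mfd M N)" for C :: "('m, 'f) chart"
    using that chart_on_induced by (auto simp: atlas_induced points_induced)
  show "(\<Union>C\<in>atlas (induced_mfd M N :: ('m, 'f) mfd). cdom C) = points (induced_mfd M N :: ('m, 'f) mfd)"
    using assms unfolding submanifold_iff atlas_induced points_induced by (fastforce simp: cdom_induced_chart)
  have half: "open (cmap (induced_chart N c J) ` (cdom (induced_chart N c J) \<inter> cdom (induced_chart N d K))) \<and>
      smooth_on (cmap (induced_chart N c J) ` (cdom (induced_chart N c J) \<inter> cdom (induced_chart N d K)))
        (cmap (induced_chart N d K) \<circ> chart_inv (induced_chart N c J))"
    if c: "slice_chart N c J" and d: "slice_chart N d K" for c d and J K :: "'f \<Rightarrow> 'e"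
  proof -
    have cd: "c \<in> max_atlas M" "d \<in> max_atlas M" "linear J" "linear K" "inj K"
      using c d by (auto simp: slice_chart_def)
    obtain R where R: "linear R" "R \<circ> K = id" using linear_injective_left_inverse[OF cd(4,5)] by blast
    let ?S = "J -` (cmap c ` (cdom c \<inter> cdom d))"
    have "cdom (induced_chart N c J) \<inter> cdom (induced_chart N d K) = N \<inter> (cdom c \<inter> cdom d)"
      by (auto simp: cdom_induced_chart)
    then have img: "cmap (induced_chart N c J) ` (cdom (induced_chart N c J) \<inter> cdom (induced_chart N d K)) = ?S"
      using image_induced_chart[OF c Int_lower1] by simp
    have S: "open ?S" by (rule open_slice_preimage[OF c open_overlap[OF cd(1,2)]])
    have "smooth_on ?S (\<lambda>z. R ((cmap d \<circ> chart_inv c) (J z)))"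
      by (rule smooth_on_compose[OF smooth_on_linear[OF R(1)]
            smooth_on_compose[OF smooth_trans[OF cd(1,2)] smooth_on_linear[OF cd(3)] S] S, of UNIV]) auto
    then have "smooth_on ?S (cmap (induced_chart N d K) \<circ> chart_inv (induced_chart N c J))"
    proof (rule smooth_on_cong[OF S, rotated])
      fix z assume z: "z \<in> ?S"
      then have z': "z \<in> J -` (cmap c ` cdom c)" by auto
      define p where "p = chart_inv c (J z)"
      have p: "p \<in> N" "chart_inv (induced_chart N c J) z = p"
        using induced_chart_inv[OF c z'] by (simp_all add: p_def)
      have "p \<in> cdom d" using z inv_cmap[OF cd(1)] by (auto simp: p_def)
      then have "K (cmap (induced_chart N d K) p) = cmap d p" by (rule induced_cmap[OF d p(1)])
      then have "R (cmap d p) = cmap (induced_chart N d K) p"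
        using R(2) by (metis comp_apply id_apply)
      then show "R ((cmap d \<circ> chart_inv c) (J z))
          = (cmap (induced_chart N d K) \<circ> chart_inv (induced_chart N c J)) z"
        using p(2) by (simp add: p_def)
    qed
    then show ?thesis using S by (simp add: img)
  qed
  show "compatible C C'" if C: "C \<in> atlas (induced_mfd M N)" "C' \<in> atlas (induced_mfd M N)"
    for C C' :: "('m, 'f) chart"
  proof -
    obtain c J d K where c: "slice_chart N c J" "C = induced_chart N c J"
      and d: "slice_chart N d K" "C' = induced_chart N d K"
      using C by (auto simp: atlas_induced)
    show ?thesis unfolding c(2) d(2) compatible_def
      using half[OF c(1) d(1)] half[OF d(1) c(1)] by (simp add: Int_commute)
  qed
qed

text \<open>In a slice chart the inclusion reads as the linear map \<open>J\<close>, which is its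
  own derivative.\<close>

lemma incl_tangent_tvec_of:
  fixes J :: "'f::euclidean_space \<Rightarrow> 'e"
  assumes sub: "submanifold TYPE('f) M N" and s: "slice_chart N c J" and p: "p \<in> N" "p \<in> cdom c"
  shows "incl_tangent M N (tvec_of (induced_mfd M N) (induced_chart N c J) p u) = tvec_of M c p (J u)"
proof -
  interpret I: atlas_mfd "induced_mfd M N :: ('m, 'f) mfd" by (rule atlas_mfd_induced[OF sub])
  let ?i = "induced_chart N c J" and ?U = "J -` (cmap c ` cdom c)"
  have c: "c \<in> max_atlas M" and J: "linear J" using s by (auto simp: slice_chart_def)
  have i: "?i \<in> max_atlas (induced_mfd M N)"
    by (rule I.atlas_max) (use s in \<open>auto simp: atlas_induced\<close>)
  have U: "open ?U" by (rule open_slice_preimage[OF s open_image[OF c]])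
  have pU: "cmap ?i p \<in> ?U" using induced_cmap[OF s p] p(2) by auto
  have "(J has_derivative J) (at (cmap ?i p))" by (rule linear_imp_has_derivative[OF J])
  then have *: "((cmap c \<circ> (\<lambda>p. p) \<circ> chart_inv ?i) has_derivative J) (at (cmap ?i p))"
    by (rule has_derivative_transform_within_open[OF _ U pU]) (simp add: induced_chart_inv[OF s])
  have "tangent_map (induced_mfd M N) M (\<lambda>p. p) (tvec_of (induced_mfd M N) ?i p u)
      = tvec_of M c p (der (cmap c \<circ> (\<lambda>p. p) \<circ> chart_inv ?i) (cmap ?i p) u)"
  proof (rule tangent_map_tvec_of[OF I.atlas_mfd_axioms atlas_mfd_axioms i _ c _ U pU])
    show "(cmap c \<circ> (\<lambda>p. p) \<circ> chart_inv ?i) differentiable at (cmap ?i p)"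
      using * by (auto simp: differentiable_def)
  qed (use p in \<open>auto simp: cdom_induced_chart induced_chart_inv[OF s]\<close>)
  then show ?thesis by (simp add: incl_tangent_def der_eqI[OF *])
qed

section \<open>The Lagrangian submanifold generated by a function on a submanifold\<close>

lemma fst_cmap_cchart: "fst (cmap (cchart c) \<mu>) = cmap c (fst \<mu>)"
  by (simp add: cmap_cchart)

text \<open>The bundle projection reads as \<open>fst\<close> in the induced coordinates, which
  yields the classical expression of the Liouville form as the sum of
  \<open>p_i dx^i\<close>.\<close>

lemma liouville_tvec_of:
  assumes c: "c \<in> max_atlas M" and \<mu>: "\<mu> \<in> cdom (cchart c)"
  shows "liouville_form M (tvec_of (cotangent_bundle M) (cchart c) \<mu> u) = snd (cmap (cchart c) \<mu>) \<bullet> fst u"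
proof -
  interpret B: atlas_mfd "cotangent_bundle M" by (rule atlas_mfd_cotangent_bundle)
  note C = cchart_max[OF c]
  let ?V = "cmap (cchart c) ` cdom (cchart c)"
  have V: "open ?V" by (rule B.open_image[OF C])
  have \<mu>V: "cmap (cchart c) \<mu> \<in> ?V" using \<mu> by blast
  have "(fst has_derivative fst) (at (cmap (cchart c) \<mu>))"
    by (rule linear_imp_has_derivative[OF linear_fst])
  then have *: "((cmap c \<circ> fst \<circ> chart_inv (cchart c)) has_derivative fst) (at (cmap (cchart c) \<mu>))"
    by (rule has_derivative_transform_within_open[OF _ V \<mu>V]) (auto simp: B.inv_cmap[OF C] fst_cmap_cchart)
  have "tangent_map (cotangent_bundle M) M fst (tvec_of (cotangent_bundle M) (cchart c) \<mu> u)
      = tvec_of M c (fst \<mu>) (der (cmap c \<circ> fst \<circ> chart_inv (cchart c)) (cmap (cchart c) \<mu>) u)"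
  proof (rule tangent_map_tvec_of[OF B.atlas_mfd_axioms atlas_mfd_axioms C \<mu> c _ V \<mu>V])
    show "(cmap c \<circ> fst \<circ> chart_inv (cchart c)) differentiable at (cmap (cchart c) \<mu>)"
      using * by (auto simp: differentiable_def)
  qed (use \<mu> in \<open>auto simp: B.inv_cmap[OF C] cdom_cchart\<close>)
  also have "\<dots> = tvec_of M c (fst \<mu>) (fst u)" by (simp add: der_eqI[OF *])
  finally show ?thesis using covec_apply[OF c \<mu>] by (simp add: liouville_form_def)
qed

text \<open>The chart is the one that \<open>ext_deriv\<close> selects, hence the existential form.
  There the Liouville form has coefficients linear in the momentum, and minus its exterior
  derivative is the sum of the \<open>dx^i \<and> dp_i\<close>.\<close>

lemma canonical_symplectic_coords:
  assumes \<mu>: "\<mu> \<in> points (cotangent_bundle M)"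
  obtains c where "c \<in> atlas M" "\<mu> \<in> cdom (cchart c)"
    "\<And>u w. canonical_symplectic M (tvec_of (cotangent_bundle M) (cchart c) \<mu> u)
        (tvec_of (cotangent_bundle M) (cchart c) \<mu> w) = fst u \<bullet> snd w - snd u \<bullet> fst w"
proof -
  interpret B: atlas_mfd "cotangent_bundle M" by (rule atlas_mfd_cotangent_bundle)
  obtain c where c: "c \<in> atlas M" "chart_at (cotangent_bundle M) \<mu> = cchart c"
    using B.chart_at(1)[OF \<mu>] by (auto simp: atlas_cotangent_bundle)
  have \<mu>c: "\<mu> \<in> cdom (cchart c)" using B.chart_at(2)[OF \<mu>] c(2) by simp
  have C: "cchart c \<in> atlas (cotangent_bundle M)" using c(1) by (simp add: atlas_cotangent_bundle)
  note Cm = B.atlas_max[OF C] and cm = atlas_max[OF c(1)]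
  have d: "der (\<lambda>x. liouville_form M (tvec_of (cotangent_bundle M) (cchart c) (chart_inv (cchart c) x) u))
      (cmap (cchart c) \<mu>) = (\<lambda>t. snd t \<bullet> fst u)" for u
  proof (rule der_eqI)
    have "bounded_linear (\<lambda>t::'e \<times> 'e. snd t \<bullet> fst u)"
      by (rule bounded_linear_compose[OF bounded_linear_inner_left bounded_linear_snd])
    then have "((\<lambda>t. snd t \<bullet> fst u) has_derivative (\<lambda>t. snd t \<bullet> fst u)) (at (cmap (cchart c) \<mu>))"
      by (rule bounded_linear_imp_has_derivative)
    then show "((\<lambda>x. liouville_form M (tvec_of (cotangent_bundle M) (cchart c) (chart_inv (cchart c) x) u))
        has_derivative (\<lambda>t. snd t \<bullet> fst u)) (at (cmap (cchart c) \<mu>))"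
      by (rule has_derivative_transform_within_open[OF _ B.open_image[OF Cm]])
         (use \<mu>c in \<open>auto simp: B.inv_cmap[OF Cm] liouville_tvec_of[OF cm]\<close>)
  qed
  have "canonical_symplectic M (tvec_of (cotangent_bundle M) (cchart c) \<mu> u)
      (tvec_of (cotangent_bundle M) (cchart c) \<mu> w) = fst u \<bullet> snd w - snd u \<bullet> fst w" for u w
    by (simp add: canonical_symplectic_def ext_deriv_def Let_def c(2) B.snd_tvec_of_self[OF C \<mu>c] d inner_commute)
  with c(1) \<mu>c that show thesis by blast
qed

text \<open>\<open>Sigma_L\<close> for an arbitrary submanifold \<open>N\<close> of \<open>M\<close>
  in place of \<open>D2\<close> in the tangent bundle of the total space.\<close>

definition generated_set :: "'f::euclidean_space itself \<Rightarrow> 'm set \<Rightarrow> ('m \<Rightarrow> real) \<Rightarrow> ('m, 'e) covec set" where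
  "generated_set F N L = {\<mu> \<in> points (cotangent_bundle M). fst \<mu> \<in> N \<and>
     (\<forall>w\<in>tangent_space (induced_mfd M N :: ('m, 'f) mfd) (fst \<mu>).
        snd \<mu> (incl_tangent M N w) = differential (induced_mfd M N :: ('m, 'f) mfd) L w)}"

context
  fixes N :: "'m set" and L :: "'m \<Rightarrow> real"
  assumes sub: "submanifold TYPE('f::euclidean_space) M N"
    and L: "smooth_fun (induced_mfd M N :: ('m, 'f) mfd) L"
begin

lemma smooth_on_slice:
  fixes J :: "'f \<Rightarrow> 'e"
  assumes s: "slice_chart N c J"
  shows "smooth_on (J -` (cmap c ` cdom c)) (L \<circ> chart_inv (induced_chart N c J))"
proof -
  have "induced_chart N c J \<in> atlas (induced_mfd M N)" using s by (auto simp: atlas_induced)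
  then have "smooth_on (cmap (induced_chart N c J) ` (N \<inter> cdom c)) (L \<circ> chart_inv (induced_chart N c J))"
    using L by (auto simp: smooth_fun_def cdom_induced_chart)
  then show ?thesis unfolding image_induced_chart[OF s order_refl] .
qed

text \<open>In a slice chart the tangent vectors of \<open>N\<close> are the \<open>J u\<close>, so
  the condition on a covector becomes a family of equations for its momentum. It prescribes the
  momentum on \<open>range J\<close> and leaves it free modulo the annihilator.\<close>

lemma mem_generated_set:
  fixes J :: "'f \<Rightarrow> 'e"
  assumes s: "slice_chart N c J" and \<mu>: "\<mu> \<in> cdom (cchart c)" "fst \<mu> \<in> N"
  shows "\<mu> \<in> generated_set TYPE('f) N L \<longleftrightarrow>
    (\<forall>u. snd (cmap (cchart c) \<mu>) \<bullet> J u
      = der (L \<circ> chart_inv (induced_chart N c J)) (cmap (induced_chart N c J) (fst \<mu>)) u)"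
proof -
  interpret I: atlas_mfd "induced_mfd M N :: ('m, 'f) mfd" by (rule atlas_mfd_induced[OF sub])
  let ?i = "induced_chart N c J" and ?v = "fst \<mu>"
  have c: "c \<in> max_atlas M" using s by (auto simp: slice_chart_def)
  have v: "?v \<in> cdom c" using \<mu> by (simp add: cdom_cchart)
  have i: "?i \<in> max_atlas (induced_mfd M N)"
    by (rule I.atlas_max) (use s in \<open>auto simp: atlas_induced\<close>)
  have vi: "?v \<in> cdom ?i" using v \<mu>(2) by (simp add: cdom_induced_chart)
  have "cmap ?i ?v \<in> J -` (cmap c ` cdom c)" using induced_cmap[OF s \<mu>(2) v] v by auto
  then have diff: "(L \<circ> chart_inv ?i) differentiable (at (cmap ?i ?v))"
    by (rule smooth_on_differentiable[OF smooth_on_slice[OF s]])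
  have "(\<forall>w\<in>tangent_space (induced_mfd M N) ?v. Q w) \<longleftrightarrow> (\<forall>u. Q (tvec_of (induced_mfd M N) ?i ?v u))"
    for Q :: "('m, 'f) tvec \<Rightarrow> bool"
    using I.tangent_repr[OF _ i vi] I.tvec_of_in_tangent[OF i vi] by metis
  moreover have "\<mu> \<in> points (cotangent_bundle M)" using \<mu> by (simp add: cdom_cchart)
  ultimately show ?thesis
    unfolding generated_set_def mem_Collect_eq
    using \<mu>(2) by (simp add: incl_tangent_tvec_of[OF sub s \<mu>(2) v] I.differential_tvec_of[OF i vi diff]
        covec_apply[OF c \<mu>(1)])
qed

end

end

text \<open>The annihilator is the orthogonal complement of \<open>range J\<close>, so the two
  dimensions add up to that of \<open>'e\<close>. The product is therefore a linear copy of
  \<open>'e\<close>, half the dimension of the cotangent bundle whatever the dimension of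
  \<open>N\<close>.\<close>

lemma ex_linear_range_times_annihilator:
  fixes J :: "'f::euclidean_space \<Rightarrow> 'e::euclidean_space"
  assumes "linear J"
  obtains K :: "'e \<Rightarrow> 'e \<times> 'e" where "linear K" "inj K" "range K = range J \<times> {p. \<forall>u. p \<bullet> J u = 0}"
proof -
  let ?A = "range J" and ?B = "{p. \<forall>u. p \<bullet> J u = 0}"
  have A: "subspace ?A" using assms subspace_UNIV by (rule linear_subspace_image)
  have B: "?B = {y \<in> UNIV. \<forall>x\<in>?A. orthogonal x y}"
    by (auto simp: orthogonal_def inner_commute)
  have sB: "subspace ?B" by (auto simp: subspace_def inner_left_distrib)
  have "dim ?B + dim ?A = DIM('e)"
    using dim_subspace_orthogonal_to_vectors[OF A subspace_UNIV subset_UNIV] unfolding B by simp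
  then have "dim (UNIV :: 'e set) = dim (?A \<times> ?B)"
    using dim_Times[OF A sB] by simp
  then obtain f g where "linear f" "f ` (UNIV :: 'e set) = ?A \<times> ?B" "\<And>x. g (f x) = x"
    using isometries_subspaces[OF subspace_UNIV subspace_Times[OF A sB]] by (metis UNIV_I)
  then show thesis using that[of f] by (metis injI)
qed

context atlas_mfd
begin

text \<open>
  In the coordinates \<open>(x, p)\<close> induced by a slice chart of \<open>N\<close>, extend \<open>L\<close> to a function \<open>f\<close> by
  means of a linear retraction onto the slice. The fibrewise translation by \<open>df\<close> maps the
  generated set into the product of the slice with its annihilator.
\<close>

lemma submanifold_generated_set:
  assumes sub: "submanifold TYPE('f::euclidean_space) M N"
    and L: "smooth_fun (induced_mfd M N :: ('m, 'f) mfd) L"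
  shows "submanifold TYPE('e) (cotangent_bundle M) (generated_set TYPE('f) N L)"
proof -
  let ?\<Sigma> = "generated_set TYPE('f) N L"
  interpret B: atlas_mfd "cotangent_bundle M" by (rule atlas_mfd_cotangent_bundle)
  have "\<exists>e (K :: 'e \<Rightarrow> 'e \<times> 'e). B.slice_chart ?\<Sigma> e K \<and> \<mu> \<in> cdom e" if \<mu>: "\<mu> \<in> ?\<Sigma>" for \<mu>
  proof -
    have \<mu>B: "\<mu> \<in> points (cotangent_bundle M)" and \<mu>N: "fst \<mu> \<in> N"
      using \<mu> by (auto simp: generated_set_def)
    obtain c and J :: "'f \<Rightarrow> 'e" where s: "slice_chart N c J" and \<mu>c: "fst \<mu> \<in> cdom c"
      using sub \<mu>N unfolding submanifold_iff by blast
    have c: "c \<in> max_atlas M" and J: "linear J" "inj J"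
      and cJ: "cmap c ` (N \<inter> cdom c) = cmap c ` cdom c \<inter> range J"
      using s by (auto simp: slice_chart_def)
    obtain R where R: "linear R" "R \<circ> J = id" using linear_injective_left_inverse[OF J] by blast
    then have RJ: "R (J z) = z" for z by (metis comp_apply id_apply)
    let ?i = "induced_chart N c J" and ?V = "cmap c ` cdom c"
    let ?l = "L \<circ> chart_inv ?i"
    have V: "open ?V" by (rule open_image[OF c])
    have U: "open (J -` ?V)" by (rule open_slice_preimage[OF s V])
    have l: "smooth_on (J -` ?V) ?l" by (rule smooth_on_slice[OF sub L s])
    \<comment> \<open>The points whose retraction \<open>J (R x)\<close> stays in the chart image;
      there the extension of \<open>L\<close> is defined.\<close>
    define V' where "V' = ?V \<inter> R -` (J -` ?V)"
    have "open (R -` (J -` ?V))"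
      by (rule open_vimage[OF U]) (use R(1) in \<open>simp add: linear_continuous_on linear_conv_bounded_linear\<close>)
    then have V': "open V'" unfolding V'_def by (rule open_Int[OF V])
    define f where "f x = ?l (R x)" for x
    have f: "smooth_on V' f" unfolding f_def
      by (rule smooth_on_compose[OF l smooth_on_linear[OF R(1)] V']) (auto simp: V'_def)
    define df where "df x = (\<Sum>b\<in>Basis. der f x b *\<^sub>R b)" for x
    have df: "smooth_on V' df" unfolding df_def
      by (intro smooth_on_sum smooth_on_scaleR smooth_on_der[OF f] smooth_on_const V')
    have df_apply: "df x \<bullet> u = der f x u" if "x \<in> V'" for x u
      using linear_sum_Basis[OF linear_der[OF smooth_on_differentiable[OF f that]], of u]
      by (simp add: df_def inner_sum_left inner_commute[of u] mult.commute)
    let ?W = "V' \<times> (UNIV :: 'e set)"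
    \<comment> \<open>A shear along the fibres, inverted by adding \<open>df\<close> back; it maps
      \<open>?W\<close> onto itself.\<close>
    let ?\<Phi> = "\<lambda>z. (fst z, snd z - df (fst z))" and ?\<Psi> = "\<lambda>z. (fst z, snd z + df (fst z))"
    have W: "open ?W" using V' by (simp add: open_Times)
    have img: "?\<Phi> ` ?W = ?W"
    proof (intro equalityI subsetI)
      fix z assume "z \<in> ?W"
      then have "z = ?\<Phi> (?\<Psi> z)" "?\<Psi> z \<in> ?W" by auto
      then show "z \<in> ?\<Phi> ` ?W" by blast
    qed auto
    have cimg: "cmap (cchart c) ` cdom (cchart c) = ?V \<times> UNIV"
    proof -
      have "cdom (cchart c) = {\<mu> \<in> cdom (cchart c). fst \<mu> \<in> cdom c}" by (auto simp: cdom_cchart)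
      then show ?thesis using image_cchart[OF c order_refl] by simp
    qed
    have dfW: "smooth_on ?W (\<lambda>z. df (fst z))"
      by (rule smooth_on_compose[OF df smooth_on_linear[OF linear_fst] W]) auto
    define e where "e = Chart {\<mu> \<in> cdom (cchart c). cmap (cchart c) \<mu> \<in> ?W} (\<lambda>\<mu>. ?\<Phi> (cmap (cchart c) \<mu>))"
    have e: "e \<in> max_atlas (cotangent_bundle M)"
      unfolding e_def
    proof (rule B.max_atlas_postcompose[OF cchart_max[OF c] W, where \<Psi> = ?\<Psi>])
      show "?W \<subseteq> cmap (cchart c) ` cdom (cchart c)" unfolding cimg by (auto simp: V'_def)
      show "smooth_on ?W ?\<Phi>"
        by (intro smooth_on_Pair smooth_on_diff dfW W smooth_on_linear[OF linear_fst] smooth_on_linear[OF linear_snd])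
      show "open (?\<Phi> ` ?W)" unfolding img by (rule W)
      show "smooth_on (?\<Phi> ` ?W) ?\<Psi>" unfolding img
        by (intro smooth_on_Pair smooth_on_add dfW W smooth_on_linear[OF linear_fst] smooth_on_linear[OF linear_snd])
    qed auto
    obtain K :: "'e \<Rightarrow> 'e \<times> 'e" where K: "linear K" "inj K"
      "range K = range J \<times> {p. \<forall>u. p \<bullet> J u = 0}"
      using ex_linear_range_times_annihilator[OF J(1)] by blast
    have iff: "\<nu> \<in> ?\<Sigma> \<longleftrightarrow> cmap e \<nu> \<in> range K" if \<nu>: "\<nu> \<in> cdom e" for \<nu>
    proof -
      let ?P = "snd (cmap (cchart c) \<nu>)" and ?x = "cmap c (fst \<nu>)"
      have \<nu>c: "\<nu> \<in> cdom (cchart c)" and x: "?x \<in> V'"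
        using \<nu> fst_cmap_cchart[of c \<nu>] by (auto simp: e_def mem_Times_iff)
      have v: "fst \<nu> \<in> cdom c" using \<nu>c by (simp add: cdom_cchart)
      have "cmap e \<nu> \<in> range K \<longleftrightarrow> ?x \<in> range J \<and> (\<forall>u. ?P \<bullet> J u = df ?x \<bullet> J u)"
        unfolding K(3) by (simp add: e_def fst_cmap_cchart inner_diff_left)
      also have "?x \<in> range J \<longleftrightarrow> fst \<nu> \<in> N"
      proof
        assume "?x \<in> range J"
        then have "?x \<in> cmap c ` (N \<inter> cdom c)" using cJ v by blast
        then show "fst \<nu> \<in> N" using cmap_eq_iff[OF c v] by auto
      next
        assume "fst \<nu> \<in> N"
        then show "?x \<in> range J" using cJ v by blast
      qed
      also have "fst \<nu> \<in> N \<and> (\<forall>u. ?P \<bullet> J u = df ?x \<bullet> J u) \<longleftrightarrow> \<nu> \<in> ?\<Sigma>"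
      proof (cases "fst \<nu> \<in> N")
        case True
        let ?z = "cmap ?i (fst \<nu>)"
        have Jz: "J ?z = ?x" by (rule induced_cmap[OF s True v])
        have "J ?z \<in> V'" using x Jz by simp
        have open_JV: "open (J -` V')" by (rule open_slice_preimage[OF s V'])
        \<comment> \<open>Since \<open>R\<close> is a left inverse of \<open>J\<close>, the
          extension \<open>f\<close> restricts along \<open>J\<close> to \<open>?l\<close>; hence
          \<open>df\<close> and the differential of \<open>L\<close> agree on directions tangent to
          the slice.\<close>
        have "der ?l ?z = der (\<lambda>z. f (J z)) ?z"
          by (rule der_cong[OF open_JV]) (use \<open>J ?z \<in> V'\<close> in \<open>auto simp: f_def RJ\<close>)
        also have "\<dots> = (\<lambda>u. der f ?x (J u))"
        proof -
          have "(J has_derivative J) (at ?z)" by (rule linear_imp_has_derivative[OF J(1)])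
          moreover have "(f has_derivative der f ?x) (at (J ?z))"
            unfolding Jz by (rule has_derivative_der[OF smooth_on_differentiable[OF f x]])
          ultimately show ?thesis by (rule der_eqI[OF has_derivative_compose])
        qed
        finally have "der ?l ?z u = df ?x \<bullet> J u" for u
          by (simp add: df_apply[OF x])
        then show ?thesis
          using True mem_generated_set[OF sub L s \<nu>c True] by simp
      next
        case False
        then show ?thesis by (auto simp: generated_set_def)
      qed
      finally show ?thesis by blast
    qed
    have "cmap e ` (?\<Sigma> \<inter> cdom e) = cmap e ` cdom e \<inter> range K"
      using iff by blast
    then have "B.slice_chart ?\<Sigma> e K" using e K(1,2) by (simp add: B.slice_chart_def)
    moreover have "\<mu> \<in> cdom e"
    proof -
      \<comment> \<open>On the slice the retraction fixes coordinates, so the given point survives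
        the restriction from \<open>?V\<close> to \<open>V'\<close>.\<close>
      have "R (cmap c (fst \<mu>)) = cmap ?i (fst \<mu>)"
        using induced_cmap[OF s \<mu>N \<mu>c] RJ by metis
      then have "cmap c (fst \<mu>) \<in> V'"
        using induced_cmap[OF s \<mu>N \<mu>c] \<mu>c by (simp add: V'_def)
      then show ?thesis using \<mu>B \<mu>c fst_cmap_cchart[of c \<mu>] by (simp add: e_def cdom_cchart mem_Times_iff)
    qed
    ultimately show ?thesis by blast
  qed
  moreover have "?\<Sigma> \<subseteq> points (cotangent_bundle M)" by (auto simp: generated_set_def)
  ultimately show ?thesis unfolding B.submanifold_iff by blast
qed

text \<open>
  A smooth family \<open>z \<mapsto> (x z, p z)\<close> of points of the generated set satisfies
  \<open>p \<bullet> dx = d(L \<circ> x)\<close>. Taking the exterior derivative shows that it is isotropic.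
\<close>

lemma generated_set_isotropic:
  assumes sub: "submanifold TYPE('f::euclidean_space) M N"
    and L: "smooth_fun (induced_mfd M N :: ('m, 'f) mfd) L"
    and \<mu>: "\<mu> \<in> generated_set TYPE('f) N L"
    and X: "X \<in> tangent_space (induced_mfd (cotangent_bundle M) (generated_set TYPE('f) N L) :: (_, 'e) mfd) \<mu>"
    and Y: "Y \<in> tangent_space (induced_mfd (cotangent_bundle M) (generated_set TYPE('f) N L) :: (_, 'e) mfd) \<mu>"
  shows "canonical_symplectic M (incl_tangent (cotangent_bundle M) (generated_set TYPE('f) N L) X)
    (incl_tangent (cotangent_bundle M) (generated_set TYPE('f) N L) Y) = 0"
proof -
  let ?\<Sigma> = "generated_set TYPE('f) N L"
  interpret B: atlas_mfd "cotangent_bundle M" by (rule atlas_mfd_cotangent_bundle)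
  have sub\<Sigma>: "submanifold TYPE('e) (cotangent_bundle M) ?\<Sigma>" by (rule submanifold_generated_set[OF sub L])
  interpret IS: atlas_mfd "induced_mfd (cotangent_bundle M) ?\<Sigma> :: (_, 'e) mfd"
    by (rule B.atlas_mfd_induced[OF sub\<Sigma>])
  obtain d and K :: "'e \<Rightarrow> 'e \<times> 'e" where sd: "B.slice_chart ?\<Sigma> d K" and \<mu>d: "\<mu> \<in> cdom d"
    using sub\<Sigma> \<mu> unfolding B.submanifold_iff by blast
  have d: "d \<in> max_atlas (cotangent_bundle M)" and K: "linear K" using sd by (auto simp: B.slice_chart_def)
  let ?i = "induced_chart ?\<Sigma> d K"
  have i: "?i \<in> max_atlas (induced_mfd (cotangent_bundle M) ?\<Sigma> :: (_, 'e) mfd)"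
    by (rule IS.atlas_max) (use sd in \<open>auto simp: B.atlas_induced\<close>)
  have \<mu>i: "\<mu> \<in> cdom ?i" using \<mu> \<mu>d by (simp add: cdom_induced_chart)
  obtain u where u: "X = tvec_of (induced_mfd (cotangent_bundle M) ?\<Sigma>) ?i \<mu> u"
    by (rule IS.tangent_repr[OF X i \<mu>i])
  obtain w where w: "Y = tvec_of (induced_mfd (cotangent_bundle M) ?\<Sigma>) ?i \<mu> w"
    by (rule IS.tangent_repr[OF Y i \<mu>i])
  have "\<mu> \<in> points (cotangent_bundle M)" using \<mu> by (simp add: generated_set_def)
  from canonical_symplectic_coords[OF this] obtain c where ca: "c \<in> atlas M" and \<mu>c: "\<mu> \<in> cdom (cchart c)"
    and omega: "\<And>u w. canonical_symplectic M (tvec_of (cotangent_bundle M) (cchart c) \<mu> u)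
        (tvec_of (cotangent_bundle M) (cchart c) \<mu> w) = fst u \<bullet> snd w - snd u \<bullet> fst w"
    by blast
  have c: "c \<in> max_atlas M" by (rule atlas_max[OF ca])
  have C: "cchart c \<in> max_atlas (cotangent_bundle M)" by (rule cchart_max[OF c])
  define S where "S = K -` (cmap d ` (cdom d \<inter> cdom (cchart c)))"
  have S: "open S" unfolding S_def by (rule B.open_slice_preimage[OF sd B.open_overlap[OF d C]])
  \<comment> \<open>The parametrisation of the generated set by the slice chart. \<open>G\<close>
    expresses it in the cotangent chart where the symplectic form is known, and \<open>x\<close>,
    \<open>p\<close> are the position and momentum parts of \<open>G\<close>.\<close>
  define m where "m z = chart_inv d (K z)" for z
  have m: "m z \<in> ?\<Sigma>" "m z \<in> cdom (cchart c)" if "z \<in> S" for z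
  proof -
    have "z \<in> K -` (cmap d ` cdom d)" using that by (auto simp: S_def)
    then show "m z \<in> ?\<Sigma>" unfolding m_def by (rule B.induced_chart_inv(2)[OF sd])
    show "m z \<in> cdom (cchart c)" using that B.inv_cmap[OF d] by (auto simp: S_def m_def)
  qed
  define G where "G z = cmap (cchart c) (m z)" for z
  have G: "smooth_on S G"
  proof -
    have "smooth_on S (\<lambda>z. (cmap (cchart c) \<circ> chart_inv d) (K z))"
      by (rule smooth_on_compose[OF B.smooth_trans[OF d C] smooth_on_linear[OF K] S]) (auto simp: S_def)
    then show ?thesis by (simp add: G_def[abs_def] m_def)
  qed
  define z0 where "z0 = cmap ?i \<mu>"
  have Kz0: "K z0 = cmap d \<mu>" unfolding z0_def by (rule B.induced_cmap[OF sd \<mu> \<mu>d])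
  have z0: "z0 \<in> S" using \<mu>d \<mu>c Kz0 by (auto simp: S_def)
  have incl: "incl_tangent (cotangent_bundle M) ?\<Sigma> (tvec_of (induced_mfd (cotangent_bundle M) ?\<Sigma>) ?i \<mu> v)
      = tvec_of (cotangent_bundle M) (cchart c) \<mu> (der G z0 v)" for v
  proof -
    have dG: "der G z0 = (\<lambda>v. B.jac d (cchart c) \<mu> (K v))"
    proof (rule der_eqI)
      have "(K has_derivative K) (at z0)" by (rule linear_imp_has_derivative[OF K])
      moreover have "((cmap (cchart c) \<circ> chart_inv d) has_derivative B.jac d (cchart c) \<mu>) (at (K z0))"
        unfolding Kz0 by (rule has_derivative_der[OF B.trans_differentiable[OF d C \<mu>d \<mu>c]])
      ultimately have "((\<lambda>z. (cmap (cchart c) \<circ> chart_inv d) (K z)) has_derivative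
          (\<lambda>v. B.jac d (cchart c) \<mu> (K v))) (at z0)" by (rule has_derivative_compose)
      then show "(G has_derivative (\<lambda>v. B.jac d (cchart c) \<mu> (K v))) (at z0)"
        by (simp add: G_def[abs_def] m_def)
    qed
    show ?thesis
      unfolding B.incl_tangent_tvec_of[OF sub\<Sigma> sd \<mu> \<mu>d] dG
      by (rule B.tvec_of_change[OF d C \<mu>d \<mu>c])
  qed
  define x where "x z = fst (G z)" for z
  define p where "p z = snd (G z)" for z
  define h where "h z = L (fst (m z))" for z
  have x: "smooth_on S x" unfolding x_def by (rule smooth_on_fst[OF G S])
  have p: "smooth_on S p" unfolding p_def by (rule smooth_on_snd[OF G S])
  have xm: "x z = cmap c (fst (m z))" for z by (simp add: x_def G_def fst_cmap_cchart)
  \<comment> \<open>The chart \<open>c\<close> need not be a slice chart of \<open>N\<close>, so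
    smoothness of \<open>h\<close> and the defining equation are obtained near each \<open>z\<close>
    from a slice chart \<open>c1\<close> around the base point. The resulting identity no longer
    involves \<open>c1\<close>.\<close>
  have local: "\<exists>T. open T \<and> z \<in> T \<and> smooth_on T h \<and> (\<forall>v. p z \<bullet> der x z v = der h z v)" if z: "z \<in> S" for z
  proof -
    let ?v = "fst (m z)"
    have vN: "?v \<in> N" using m(1)[OF z] by (simp add: generated_set_def)
    have vc: "?v \<in> cdom c" using m(2)[OF z] by (simp add: cdom_cchart)
    obtain c1 and J :: "'f \<Rightarrow> 'e" where s: "slice_chart N c1 J" and vc1: "?v \<in> cdom c1"
      using sub vN unfolding submanifold_iff by blast
    have c1: "c1 \<in> max_atlas M" and J: "linear J" "inj J" using s by (auto simp: slice_chart_def)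
    obtain R where R: "linear R" "R \<circ> J = id" using linear_injective_left_inverse[OF J] by blast
    then have RJ: "R (J z) = z" for z by (metis comp_apply id_apply)
    let ?j = "induced_chart N c1 J"
    define T where "T = S \<inter> x -` (cmap c ` (cdom c \<inter> cdom c1))"
    have T: "open T" unfolding T_def
      by (rule continuous_open_preimage[OF smooth_on_continuous[OF x] S open_overlap[OF c c1]])
    have zT: "z \<in> T" using z vc vc1 by (auto simp: T_def xm)
    have mT: "fst (m z') \<in> N" "fst (m z') \<in> cdom c" "fst (m z') \<in> cdom c1" if "z' \<in> T" for z'
    proof -
      have z': "z' \<in> S" "x z' \<in> cmap c ` (cdom c \<inter> cdom c1)" using that by (auto simp: T_def)
      show "fst (m z') \<in> N" using m(1)[OF z'(1)] by (simp add: generated_set_def)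
      show v': "fst (m z') \<in> cdom c" using m(2)[OF z'(1)] by (simp add: cdom_cchart)
      show "fst (m z') \<in> cdom c1" using z'(2) cmap_eq_iff[OF c v'] by (auto simp: xm)
    qed
    define \<zeta> where "\<zeta> z' = cmap ?j (fst (m z'))" for z'
    have J\<zeta>: "J (\<zeta> z') = cmap c1 (fst (m z'))" if "z' \<in> T" for z'
      unfolding \<zeta>_def using induced_cmap[OF s] mT[OF that] by blast
    have \<zeta>: "smooth_on T \<zeta>"
    proof -
      have "smooth_on T (\<lambda>z'. (cmap c1 \<circ> chart_inv c) (x z'))"
        by (rule smooth_on_compose[OF smooth_trans[OF c c1] smooth_on_subset[OF x] T]) (auto simp: T_def)
      then have "smooth_on T (\<lambda>z'. R ((cmap c1 \<circ> chart_inv c) (x z')))"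
        by (intro smooth_on_compose[OF smooth_on_linear[OF R(1)] _ T, of _ UNIV]) auto
      then show ?thesis
      proof (rule smooth_on_cong[OF T, rotated])
        show "R ((cmap c1 \<circ> chart_inv c) (x z')) = \<zeta> z'" if "z' \<in> T" for z'
          using J\<zeta>[OF that] mT(2)[OF that] RJ[of "\<zeta> z'"] by (simp add: xm inv_cmap[OF c])
      qed
    qed
    have d\<zeta>: "(\<zeta> has_derivative der \<zeta> z) (at z)"
      by (rule has_derivative_der[OF smooth_on_differentiable[OF \<zeta> zT]])
    let ?l = "L \<circ> chart_inv ?j"
    have l: "smooth_on (J -` (cmap c1 ` cdom c1)) ?l" by (rule smooth_on_slice[OF sub L s])
    have \<zeta>img: "\<zeta> ` T \<subseteq> J -` (cmap c1 ` cdom c1)" using J\<zeta> mT(3) by auto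
    have hl: "?l (\<zeta> z') = h z'" if "z' \<in> T" for z'
      unfolding \<zeta>_def h_def using chart_inv_cmap[OF chart_on_induced[OF s], of "fst (m z')"] mT[OF that]
      by (simp add: cdom_induced_chart)
    have h: "smooth_on T h"
      by (rule smooth_on_cong[OF T hl smooth_on_compose[OF l \<zeta> T \<zeta>img]])
    have dh: "der h z = (\<lambda>v. der ?l (\<zeta> z) (der \<zeta> z v))"
    proof (rule der_eqI)
      have "(?l has_derivative der ?l (\<zeta> z)) (at (\<zeta> z))"
        by (rule has_derivative_der[OF smooth_on_differentiable[OF l]]) (use \<zeta>img zT in blast)
      from has_derivative_compose[OF d\<zeta> this]
      show "(h has_derivative (\<lambda>v. der ?l (\<zeta> z) (der \<zeta> z v))) (at z)"
        by (rule has_derivative_transform_within_open[OF _ T zT]) (rule hl)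
    qed
    have dx: "der x z = (\<lambda>v. jac c1 c ?v (J (der \<zeta> z v)))"
    proof (rule der_eqI)
      have "((\<lambda>z'. J (\<zeta> z')) has_derivative (\<lambda>v. J (der \<zeta> z v))) (at z)"
        by (rule has_derivative_compose[OF d\<zeta> linear_imp_has_derivative[OF J(1)]])
      moreover have "((cmap c \<circ> chart_inv c1) has_derivative jac c1 c ?v) (at (J (\<zeta> z)))"
        unfolding J\<zeta>[OF zT] by (rule has_derivative_der[OF trans_differentiable[OF c1 c vc1 vc]])
      ultimately have "((\<lambda>z'. (cmap c \<circ> chart_inv c1) (J (\<zeta> z'))) has_derivative
          (\<lambda>v. jac c1 c ?v (J (der \<zeta> z v)))) (at z)" by (rule has_derivative_compose)
      then show "(x has_derivative (\<lambda>v. jac c1 c ?v (J (der \<zeta> z v)))) (at z)"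
      proof (rule has_derivative_transform_within_open[OF _ T zT])
        show "(cmap c \<circ> chart_inv c1) (J (\<zeta> z')) = x z'" if "z' \<in> T" for z'
          by (simp add: J\<zeta>[OF that] xm inv_cmap[OF c1 mT(3)[OF that]])
      qed
    qed
    have mc1: "m z \<in> cdom (cchart c1)"
      using m(2)[OF z] vc1 by (simp add: cdom_cchart)
    have "p z \<bullet> der x z v = der h z v" for v
    proof -
      have "p z \<bullet> der x z v = snd (m z) (tvec_of M c ?v (der x z v))"
        unfolding p_def G_def by (rule covec_apply[OF c m(2)[OF z], symmetric])
      also have "tvec_of M c ?v (der x z v) = tvec_of M c1 ?v (J (der \<zeta> z v))"
        unfolding dx by (rule tvec_of_change[OF c1 c vc1 vc, symmetric])
      also have "snd (m z) \<dots> = snd (cmap (cchart c1) (m z)) \<bullet> J (der \<zeta> z v)"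
        by (rule covec_apply[OF c1 mc1])
      also have "\<dots> = der h z v"
        using mem_generated_set[OF sub L s mc1 vN] m(1)[OF z] by (simp add: dh \<zeta>_def)
      finally show ?thesis .
    qed
    then show ?thesis using T zT h by blast
  qed
  have h: "smooth_on S h" by (rule smooth_on_local) (use local in blast)
  \<comment> \<open>The derivative in direction \<open>u\<close> of the identity
    \<open>p . dx(w) = dh(w)\<close>.\<close>
  have deriv: "der p z0 u \<bullet> der x z0 w + p z0 \<bullet> der (\<lambda>z. der x z w) z0 u = der (\<lambda>z. der h z w) z0 u" for u w
  proof -
    have "((\<lambda>z. p z \<bullet> der x z w) has_derivative
        (\<lambda>u. p z0 \<bullet> der (\<lambda>z. der x z w) z0 u + der p z0 u \<bullet> der x z0 w)) (at z0)"
      by (intro has_derivative_inner has_derivative_der smooth_on_differentiable[OF p z0]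
          smooth_on_differentiable[OF smooth_on_der[OF x] z0])
    then have "((\<lambda>z. der h z w) has_derivative
        (\<lambda>u. p z0 \<bullet> der (\<lambda>z. der x z w) z0 u + der p z0 u \<bullet> der x z0 w)) (at z0)"
      by (rule has_derivative_transform_within_open[OF _ S z0]) (use local in blast)
    from der_eqI[OF this] show ?thesis by simp
  qed
  \<comment> \<open>Exchanging \<open>u\<close> and \<open>w\<close> and subtracting cancels the
    second derivatives of \<open>x\<close> and \<open>h\<close>; what remains is the vanishing of
    the symplectic form.\<close>
  have "der p z0 u \<bullet> der x z0 w = der p z0 w \<bullet> der x z0 u"
    using deriv[of u w] deriv[of w u] der_der_commute[OF S z0 x, of u w] der_der_commute[OF S z0 h, of u w]
    by simp
  moreover have "fst (der G z0 v) = der x z0 v" "snd (der G z0 v) = der p z0 v" for v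
    using der_bounded_linear[OF bounded_linear_fst smooth_on_differentiable[OF G z0]]
      der_bounded_linear[OF bounded_linear_snd smooth_on_differentiable[OF G z0]]
    by (simp_all add: x_def[abs_def] p_def[abs_def])
  ultimately show ?thesis
    unfolding u w incl omega by (simp add: inner_commute)
qed

lemma lagrangian_generated_set:
  assumes sub: "submanifold TYPE('f::euclidean_space) M N"
    and L: "smooth_fun (induced_mfd M N :: ('m, 'f) mfd) L"
  shows "lagrangian_submanifold TYPE('e) (cotangent_bundle M) (canonical_symplectic M)
    (generated_set TYPE('f) N L)"
  unfolding lagrangian_submanifold_def
  using submanifold_generated_set[OF sub L] generated_set_isotropic[OF sub L] by simp

end

section \<open>The total space of a distribution\<close>

context atlas_mfd
begin

text \<open>The element with fibre coordinates \<open>y\<close> in the frame; it names the map that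
  \<open>total_space\<close> inverts in its charts.\<close>

definition frame_vec :: "('m, 'e) chart \<Rightarrow> ('e \<Rightarrow> 'k::euclidean_space \<Rightarrow> 'e) \<Rightarrow> 'm \<Rightarrow> 'k \<Rightarrow> ('m, 'e) tvec" where
  "frame_vec c \<rho> q y = tvec_of M c q (\<rho> (cmap c q) y)"

definition frame_chart :: "('m, 'e) tvec set \<Rightarrow> ('m, 'e) chart \<Rightarrow> ('e \<Rightarrow> 'k::euclidean_space \<Rightarrow> 'e) \<Rightarrow>
    (('m, 'e) tvec, 'e \<times> 'k) chart" where
  "frame_chart D c \<rho> = Chart {v \<in> D. fst v \<in> cdom c}
     (\<lambda>v. (cmap c (fst v), inv (frame_vec c \<rho> (fst v)) v))"

lemma points_total_space: "points (total_space M D) = D"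
  by (simp add: total_space_def)

lemma atlas_total_space: "atlas (total_space M D) = {frame_chart D c \<rho> | c \<rho>. local_frame M D c \<rho>}"
  by (simp add: total_space_def frame_chart_def frame_vec_def[abs_def])

lemma cdom_frame_chart: "v \<in> cdom (frame_chart D c \<rho>) \<longleftrightarrow> v \<in> D \<and> fst v \<in> cdom c"
  by (simp add: frame_chart_def)

lemma fst_cmap_frame_chart: "fst (cmap (frame_chart D c \<rho>) v) = cmap c (fst v)"
  by (simp add: frame_chart_def)

lemma fst_frame_vec [simp]: "fst (frame_vec c \<rho> q y) = q"
  by (simp add: frame_vec_def)

context
  fixes D :: "('m, 'e) tvec set" and c :: "('m, 'e) chart" and \<rho> :: "'e \<Rightarrow> 'k::euclidean_space \<Rightarrow> 'e"
  assumes frame: "local_frame M D c \<rho>"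
begin

lemma frame_max: "c \<in> max_atlas M"
  using frame by (simp add: local_frame_def)

lemma frame_linear: "x \<in> cmap c ` cdom c \<Longrightarrow> linear (\<rho> x)"
  and frame_inj: "x \<in> cmap c ` cdom c \<Longrightarrow> inj (\<rho> x)"
  and frame_smooth: "smooth_on (cmap c ` cdom c) (\<lambda>x. \<rho> x y)"
  using frame unfolding local_frame_def by blast+

lemma frame_fibre: "q \<in> cdom c \<Longrightarrow> {v \<in> D. fst v = q} = range (frame_vec c \<rho> q)"
  using frame by (simp add: local_frame_def frame_vec_def[abs_def])

lemma inj_frame_vec: "q \<in> cdom c \<Longrightarrow> inj (frame_vec c \<rho> q)"
  using frame_inj tvec_of_inject[OF frame_max] by (auto simp: frame_vec_def inj_def)

lemma frame_vec_mem: "q \<in> cdom c \<Longrightarrow> frame_vec c \<rho> q y \<in> cdom (frame_chart D c \<rho>)"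
  using frame_fibre[of q] by (auto simp: cdom_frame_chart)

lemma cmap_frame_vec: "q \<in> cdom c \<Longrightarrow> cmap (frame_chart D c \<rho>) (frame_vec c \<rho> q y) = (cmap c q, y)"
  using inj_frame_vec[of q] by (simp add: frame_chart_def inv_f_f)

lemma frame_chart_eq:
  assumes "v \<in> cdom (frame_chart D c \<rho>)"
  shows "v = frame_vec c \<rho> (fst v) (snd (cmap (frame_chart D c \<rho>) v))"
proof -
  have "v \<in> range (frame_vec c \<rho> (fst v))"
    using assms frame_fibre[of "fst v"] by (auto simp: cdom_frame_chart)
  then show ?thesis by (simp add: frame_chart_def f_inv_into_f)
qed

lemma image_frame_chart:
  assumes T: "T \<subseteq> cdom c"
  shows "cmap (frame_chart D c \<rho>) ` {v \<in> cdom (frame_chart D c \<rho>). fst v \<in> T} = cmap c ` T \<times> UNIV"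
proof (intro equalityI subsetI)
  fix z :: "'e \<times> 'k" assume "z \<in> cmap c ` T \<times> UNIV"
  then obtain q y where q: "q \<in> T" and z: "z = (cmap c q, y)" by auto
  then have "frame_vec c \<rho> q y \<in> {v \<in> cdom (frame_chart D c \<rho>). fst v \<in> T}"
    "cmap (frame_chart D c \<rho>) (frame_vec c \<rho> q y) = z"
    using T frame_vec_mem cmap_frame_vec by auto
  then show "z \<in> cmap (frame_chart D c \<rho>) ` {v \<in> cdom (frame_chart D c \<rho>). fst v \<in> T}" by blast
next
  fix z assume "z \<in> cmap (frame_chart D c \<rho>) ` {v \<in> cdom (frame_chart D c \<rho>). fst v \<in> T}"
  then show "z \<in> cmap c ` T \<times> UNIV" using fst_cmap_frame_chart[of D c \<rho>] by (auto simp: mem_Times_iff)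
qed

lemma image_frame_chart_dom:
  "cmap (frame_chart D c \<rho>) ` cdom (frame_chart D c \<rho>) = cmap c ` cdom c \<times> UNIV"
proof -
  have "cdom (frame_chart D c \<rho>) = {v \<in> cdom (frame_chart D c \<rho>). fst v \<in> cdom c}"
    by (auto simp: cdom_frame_chart)
  then show ?thesis using image_frame_chart[OF order_refl] by simp
qed

lemma chart_on_frame_chart: "chart_on D (frame_chart D c \<rho>)"
proof -
  have "inj_on (cmap (frame_chart D c \<rho>)) (cdom (frame_chart D c \<rho>))"
  proof (rule inj_onI)
    fix v w assume vw: "v \<in> cdom (frame_chart D c \<rho>)" "w \<in> cdom (frame_chart D c \<rho>)"
      and eq: "cmap (frame_chart D c \<rho>) v = cmap (frame_chart D c \<rho>) w"
    have "fst v = fst w"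
      using vw cmap_eq_iff[OF frame_max, of "fst v" "fst w"] arg_cong[OF eq, of fst]
      by (simp add: fst_cmap_frame_chart cdom_frame_chart)
    then show "v = w" using frame_chart_eq[OF vw(1)] frame_chart_eq[OF vw(2)] eq by simp
  qed
  moreover have "open (cmap (frame_chart D c \<rho>) ` cdom (frame_chart D c \<rho>))"
    unfolding image_frame_chart_dom using open_image[OF frame_max] by (simp add: open_Times)
  ultimately show ?thesis by (auto simp: chart_on_def cdom_frame_chart)
qed

lemma chart_inv_frame_chart:
  assumes "q \<in> cdom c"
  shows "chart_inv (frame_chart D c \<rho>) (cmap c q, y) = frame_vec c \<rho> q y"
  using chart_inv_cmap[OF chart_on_frame_chart frame_vec_mem[OF assms, of y]] cmap_frame_vec[OF assms]
  by simp

lemma frame_smooth_family: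
  "smooth_on (cmap c ` cdom c \<times> UNIV) (\<lambda>z. \<rho> (fst z) (snd z))"
proof (rule smooth_on_linear_family[OF _ frame_smooth])
  show "open (cmap c ` cdom c \<times> (UNIV :: 'k set))" using open_image[OF frame_max] by (simp add: open_Times)
qed (auto intro!: smooth_on_linear linear_fst linear_snd frame_linear)

end

text \<open>
  For the change of frames \<open>y \<mapsto> y'\<close> one has \<open>\<sigma>(x') y' = \<partial>x'/\<partial>x \<cdot> \<rho>(x) y\<close>, an injective linear
  system for \<open>y'\<close>.
\<close>

lemma smooth_frame_change:
  fixes \<rho> \<sigma> :: "'e \<Rightarrow> 'k::euclidean_space \<Rightarrow> 'e"
  assumes f: "local_frame M D c \<rho>" and g: "local_frame M D d \<sigma>"
  shows "open (cmap (frame_chart D c \<rho>) ` (cdom (frame_chart D c \<rho>) \<inter> cdom (frame_chart D d \<sigma>)))"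
    and "smooth_on (cmap (frame_chart D c \<rho>) ` (cdom (frame_chart D c \<rho>) \<inter> cdom (frame_chart D d \<sigma>)))
      (cmap (frame_chart D d \<sigma>) \<circ> chart_inv (frame_chart D c \<rho>))"
proof -
  note c = frame_max[OF f] and d = frame_max[OF g]
  let ?O = "cmap c ` (cdom c \<inter> cdom d)"
  let ?O' = "?O \<times> (UNIV :: 'k set)"
  let ?F = "cmap (frame_chart D d \<sigma>) \<circ> chart_inv (frame_chart D c \<rho>)"
  let ?t = "cmap d \<circ> chart_inv c"
  have dom: "cdom (frame_chart D c \<rho>) \<inter> cdom (frame_chart D d \<sigma>)
      = {v \<in> cdom (frame_chart D c \<rho>). fst v \<in> cdom c \<inter> cdom d}"
    by (auto simp: cdom_frame_chart)
  have img: "cmap (frame_chart D c \<rho>) ` (cdom (frame_chart D c \<rho>) \<inter> cdom (frame_chart D d \<sigma>)) = ?O'"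
    unfolding dom by (rule image_frame_chart[OF f Int_lower1])
  have O: "open ?O'" using open_overlap[OF c d] by (simp add: open_Times)
  then show "open (cmap (frame_chart D c \<rho>) ` (cdom (frame_chart D c \<rho>) \<inter> cdom (frame_chart D d \<sigma>)))"
    by (simp add: img)
  have t: "smooth_on ?O' (\<lambda>z. ?t (fst z))"
    by (rule smooth_on_compose[OF smooth_trans[OF c d] smooth_on_linear[OF linear_fst] O]) auto
  have t_mem: "?t (fst z) \<in> cmap d ` cdom d" if "z \<in> ?O'" for z
    using that by (auto simp: inv_cmap[OF c])
  have \<rho>: "smooth_on ?O' (\<lambda>z. \<rho> (fst z) (snd z))"
    by (rule smooth_on_subset[OF frame_smooth_family[OF f]]) auto
  have "smooth_on ?O' (\<lambda>z. snd (?F z))"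
  proof (rule smooth_on_linear_solve[where R = "\<lambda>z. \<sigma> (?t (fst z))"
        and w = "\<lambda>z. der ?t (fst z) (\<rho> (fst z) (snd z))", OF O])
    show "linear (\<sigma> (?t (fst z)))" if "z \<in> ?O'" for z by (rule frame_linear[OF g t_mem[OF that]])
    show "inj (\<sigma> (?t (fst z)))" if "z \<in> ?O'" for z by (rule frame_inj[OF g t_mem[OF that]])
    show "smooth_on ?O' (\<lambda>z. \<sigma> (?t (fst z)) y)" for y
      by (rule smooth_on_compose[OF frame_smooth[OF g] t O]) (use t_mem in blast)
    have "smooth_on ?O' (\<lambda>z. (fst z, \<rho> (fst z) (snd z)))"
      by (rule smooth_on_Pair[OF smooth_on_linear[OF linear_fst] \<rho> O])
    from smooth_on_compose[OF smooth_on_jac_family[OF c d] this O]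
    have "smooth_on ?O' (\<lambda>z. der ?t (fst (fst z, \<rho> (fst z) (snd z))) (snd (fst z, \<rho> (fst z) (snd z))))"
      by (rule meta_mp) auto
    then show "smooth_on ?O' (\<lambda>z. der ?t (fst z) (\<rho> (fst z) (snd z)))" by (simp only: fst_conv snd_conv)
    show "\<sigma> (?t (fst z)) (snd (?F z)) = der ?t (fst z) (\<rho> (fst z) (snd z))" if "z \<in> ?O'" for z
    proof -
      obtain q y where q: "q \<in> cdom c" "q \<in> cdom d" and z: "z = (cmap c q, y)" using \<open>z \<in> ?O'\<close> by auto
      let ?v = "frame_vec c \<rho> q y"
      have v: "chart_inv (frame_chart D c \<rho>) z = ?v" unfolding z by (rule chart_inv_frame_chart[OF f q(1)])
      have "?v \<in> cdom (frame_chart D d \<sigma>)"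
        using frame_vec_mem[OF f q(1), of y] q(2) by (simp add: cdom_frame_chart)
      from frame_chart_eq[OF g this]
      have "?v = tvec_of M d q (\<sigma> (cmap d q) (snd (?F z)))" by (simp add: frame_vec_def v)
      \<comment> \<open>The same vector expressed through its components in \<open>c\<close>;
        comparing both expressions in \<open>d\<close> gives the linear system.\<close>
      moreover have "?v = tvec_of M d q (jac c d q (\<rho> (cmap c q) y))"
        unfolding frame_vec_def by (rule tvec_of_change[OF c d q])
      ultimately have "\<sigma> (cmap d q) (snd (?F z)) = jac c d q (\<rho> (cmap c q) y)"
        using tvec_of_inject[OF d q(2)] by metis
      then show ?thesis by (simp add: z inv_cmap[OF c q(1)])
    qed
  qed
  then have "smooth_on ?O' (\<lambda>z. (?t (fst z), snd (?F z)))" by (rule smooth_on_Pair[OF t _ O])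
  then have "smooth_on ?O' ?F"
  proof (rule smooth_on_cong[OF O, rotated])
    fix z assume "z \<in> ?O'"
    then obtain q y where q: "q \<in> cdom c" and z: "z = (cmap c q, y)" by auto
    have "fst (?F z) = ?t (fst z)"
      by (simp add: z chart_inv_frame_chart[OF f q] fst_cmap_frame_chart inv_cmap[OF c q])
    then show "(?t (fst z), snd (?F z)) = ?F z" by (metis prod.collapse)
  qed
  then show "smooth_on (cmap (frame_chart D c \<rho>) ` (cdom (frame_chart D c \<rho>) \<inter> cdom (frame_chart D d \<sigma>))) ?F"
    by (simp only: img)
qed

lemma atlas_mfd_total_space:
  assumes D: "distribution TYPE('k::euclidean_space) M D"
  shows "atlas_mfd (total_space M D :: (_, 'e \<times> 'k) mfd)"
proof
  show "chart_on (points (total_space M D)) C" if "C \<in> atlas (total_space M D)"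
    for C :: "(('m, 'e) tvec, 'e \<times> 'k) chart"
    using that chart_on_frame_chart by (auto simp: atlas_total_space points_total_space)
  show "(\<Union>C\<in>atlas (total_space M D :: (_, 'e \<times> 'k) mfd). cdom C) = points (total_space M D :: (_, 'e \<times> 'k) mfd)"
  proof (intro equalityI subsetI)
    fix v assume v: "v \<in> points (total_space M D :: (_, 'e \<times> 'k) mfd)"
    then have "fst v \<in> points M"
      using D by (auto simp: points_total_space distribution_def mem_tangent_bundle)
    then obtain c and \<rho> :: "'e \<Rightarrow> 'k \<Rightarrow> 'e" where "local_frame M D c \<rho>" "fst v \<in> cdom c"
      using D unfolding distribution_def by blast
    then show "v \<in> (\<Union>C\<in>atlas (total_space M D :: (_, 'e \<times> 'k) mfd). cdom C)"
      using v by (fastforce simp: atlas_total_space points_total_space cdom_frame_chart)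
  qed (auto simp: atlas_total_space points_total_space cdom_frame_chart)
  show "compatible C C'" if C: "C \<in> atlas (total_space M D)" "C' \<in> atlas (total_space M D)"
    for C C' :: "(('m, 'e) tvec, 'e \<times> 'k) chart"
  proof -
    obtain c d and \<rho> \<sigma> :: "'e \<Rightarrow> 'k \<Rightarrow> 'e" where c: "local_frame M D c \<rho>" "C = frame_chart D c \<rho>"
      and d: "local_frame M D d \<sigma>" "C' = frame_chart D d \<sigma>"
      using C by (auto simp: atlas_total_space)
    show ?thesis unfolding c(2) d(2) compatible_def
      using smooth_frame_change[OF c(1) d(1)] smooth_frame_change[OF d(1) c(1)] by (simp add: Int_commute)
  qed
qed

section \<open>Velocities of admissible curves\<close>

text \<open>\<open>velocity\<close> stores derivatives in atlas charts only, whereas a local frame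
  may use any chart of the maximal atlas. The chain rule along the curve closes this gap.\<close>

lemma velocity_eq_tvec_of:
  assumes c: "c \<in> max_atlas M" and S: "open S" "t \<in> S" "\<And>s. s \<in> S \<Longrightarrow> \<gamma> s \<in> cdom c"
    and v: "((\<lambda>s. cmap c (\<gamma> s)) has_vector_derivative \<xi>) (at t)"
  shows "velocity M \<gamma> t = tvec_of M c (\<gamma> t) \<xi>"
proof -
  have "vector_derivative (cmap a \<circ> \<gamma>) (at t) = jac c a (\<gamma> t) \<xi>"
    if a: "a \<in> atlas M" "\<gamma> t \<in> cdom a" for a
  proof -
    let ?J = "jac c a (\<gamma> t)"
    note ca = trans_differentiable[OF c atlas_max[OF a(1)] S(3)[OF S(2)] a(2)]
    have "((\<lambda>s. (cmap a \<circ> chart_inv c) (cmap c (\<gamma> s))) has_derivative (\<lambda>h. ?J (h *\<^sub>R \<xi>))) (at t)"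
      by (rule has_derivative_compose[OF v[unfolded has_vector_derivative_def] has_derivative_der[OF ca]])
    then have "((cmap a \<circ> \<gamma>) has_derivative (\<lambda>h. ?J (h *\<^sub>R \<xi>))) (at t)"
      by (rule has_derivative_transform_within_open[OF _ S(1,2)]) (simp add: inv_cmap[OF c S(3)])
    then have "((cmap a \<circ> \<gamma>) has_vector_derivative ?J \<xi>) (at t)"
      by (simp add: has_vector_derivative_def linear_cmul[OF linear_der[OF ca]])
    then show ?thesis by (rule vector_derivative_at)
  qed
  then show ?thesis unfolding velocity_def by (intro tvec_of_eqI) (simp_all only: simp_thms if_True if_False)
qed

text \<open>A curve inside one chart is read in every other chart through the coordinate change, on
  the open set of times where it meets that chart.\<close>

lemma smooth_curve_in_chart:
  assumes c: "c \<in> max_atlas M" and I: "open I" and z: "smooth_on I z" "\<And>t. t \<in> I \<Longrightarrow> z t \<in> cmap c ` cdom c"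
  shows "smooth_curve M I (\<lambda>t. chart_inv c (z t))"
proof -
  have mem: "chart_inv c (z t) \<in> cdom c" "cmap c (chart_inv c (z t)) = z t" if "t \<in> I" for t
    using z(2)[OF that] inv_cmap[OF c] by auto
  have "open {t \<in> I. chart_inv c (z t) \<in> cdom d} \<and>
      smooth_on {t \<in> I. chart_inv c (z t) \<in> cdom d} (cmap d \<circ> (\<lambda>t. chart_inv c (z t)))"
    if "d \<in> atlas M" for d
  proof -
    note d = atlas_max[OF that]
    have eq: "{t \<in> I. chart_inv c (z t) \<in> cdom d} = I \<inter> z -` (cmap c ` (cdom c \<inter> cdom d))"
    proof (intro equalityI subsetI)
      fix t assume "t \<in> {t \<in> I. chart_inv c (z t) \<in> cdom d}"
      then show "t \<in> I \<inter> z -` (cmap c ` (cdom c \<inter> cdom d))" using mem[of t] by force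
    next
      fix t assume "t \<in> I \<inter> z -` (cmap c ` (cdom c \<inter> cdom d))"
      then show "t \<in> {t \<in> I. chart_inv c (z t) \<in> cdom d}" using inv_cmap[OF c] by auto
    qed
    have "open {t \<in> I. chart_inv c (z t) \<in> cdom d}"
      unfolding eq by (rule continuous_open_preimage[OF smooth_on_continuous[OF z(1)] I open_overlap[OF c d]])
    moreover from this have "smooth_on {t \<in> I. chart_inv c (z t) \<in> cdom d} (\<lambda>t. (cmap d \<circ> chart_inv c) (z t))"
      by (intro smooth_on_compose[OF smooth_trans[OF c d] smooth_on_subset[OF z(1)]]) (auto simp: eq)
    ultimately show ?thesis by (simp add: o_def)
  qed
  then show ?thesis unfolding smooth_curve_def using mem dom_points[OF c] by blast
qed

text \<open>The projection to the base reads as \<open>fst\<close> in a frame chart, so a single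
  coordinate derivative \<open>\<zeta>\<close> describes both the velocity in the total space and
  that of the projected curve.\<close>

lemma velocity_total_space:
  fixes \<rho> :: "'e \<Rightarrow> 'k::euclidean_space \<Rightarrow> 'e"
  assumes D: "distribution TYPE('k) M D" and f: "local_frame M D c \<rho>"
    and I: "open I" "0 \<in> I" and \<gamma>: "smooth_curve (total_space M D :: (_, 'e \<times> 'k) mfd) I \<gamma>"
    and mem: "\<gamma> 0 \<in> cdom (frame_chart D c \<rho>)"
  obtains \<zeta> where "velocity (total_space M D) \<gamma> 0 = tvec_of (total_space M D) (frame_chart D c \<rho>) (\<gamma> 0) \<zeta>"
    "velocity M (\<lambda>s. fst (\<gamma> s)) 0 = tvec_of M c (fst (\<gamma> 0)) (fst \<zeta>)"
proof -
  interpret E: atlas_mfd "total_space M D :: (_, 'e \<times> 'k) mfd" by (rule atlas_mfd_total_space[OF D])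
  let ?C = "frame_chart D c \<rho>"
  have C: "?C \<in> atlas (total_space M D)" using f by (auto simp: atlas_total_space)
  let ?S = "{t \<in> I. \<gamma> t \<in> cdom ?C}"
  have S: "open ?S" "smooth_on ?S (cmap ?C \<circ> \<gamma>)" using \<gamma> C by (auto simp: smooth_curve_def)
  have S0: "0 \<in> ?S" using I mem by simp
  define \<zeta> where "\<zeta> = der (cmap ?C \<circ> \<gamma>) 0 1"
  have diff: "(cmap ?C \<circ> \<gamma>) differentiable (at 0)" by (rule smooth_on_differentiable[OF S(2) S0])
  have "der (cmap ?C \<circ> \<gamma>) 0 = (\<lambda>h. h *\<^sub>R \<zeta>)"
  proof
    show "der (cmap ?C \<circ> \<gamma>) 0 h = h *\<^sub>R \<zeta>" for h
      using linear_cmul[OF linear_der[OF diff], of h 1] by (simp only: \<zeta>_def real_scaleR_def mult_1_right)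
  qed
  with has_derivative_der[OF diff] have "((cmap ?C \<circ> \<gamma>) has_derivative (\<lambda>h. h *\<^sub>R \<zeta>)) (at 0)"
    by (simp only:)
  then have v: "((\<lambda>s. cmap ?C (\<gamma> s)) has_vector_derivative \<zeta>) (at 0)"
    by (simp add: has_vector_derivative_def o_def)
  have "((\<lambda>s. fst (cmap ?C (\<gamma> s))) has_vector_derivative fst \<zeta>) (at 0)"
    by (rule bounded_linear.has_vector_derivative[OF bounded_linear_fst v])
  then have v': "((\<lambda>s. cmap c (fst (\<gamma> s))) has_vector_derivative fst \<zeta>) (at 0)"
    by (simp only: fst_cmap_frame_chart)
  show thesis
  proof (rule that)
    show "velocity (total_space M D) \<gamma> 0 = tvec_of (total_space M D) ?C (\<gamma> 0) \<zeta>"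
      by (rule E.velocity_eq_tvec_of[OF E.atlas_max[OF C] S(1) S0 _ v]) simp
    show "velocity M (\<lambda>s. fst (\<gamma> s)) 0 = tvec_of M c (fst (\<gamma> 0)) (fst \<zeta>)"
      by (rule velocity_eq_tvec_of[OF frame_max[OF f] S(1) S0 _ v']) (simp add: cdom_frame_chart)
  qed
qed

text \<open>Prescribing \<open>y' = b\<close> turns admissibility into the differential equation \<open>(x', y') = (\<rho>(x) y, b)\<close>.\<close>

lemma ex_admissible_curve:
  fixes \<rho> :: "'e \<Rightarrow> 'k::euclidean_space \<Rightarrow> 'e"
  assumes D: "distribution TYPE('k) M D" and f: "local_frame M D c \<rho>"
    and e: "e \<in> cdom (frame_chart D c \<rho>)"
  obtains I \<gamma> where "open I" "is_interval I" "0 \<in> I"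
    "admissible_curve M (total_space M D :: (_, 'e \<times> 'k) mfd) I \<gamma>"
    "velocity (total_space M D) \<gamma> 0 = tvec_of (total_space M D) (frame_chart D c \<rho>) e
      (\<rho> (cmap c (fst e)) (snd (cmap (frame_chart D c \<rho>) e)), b)"
proof -
  interpret E: atlas_mfd "total_space M D :: (_, 'e \<times> 'k) mfd" by (rule atlas_mfd_total_space[OF D])
  let ?C = "frame_chart D c \<rho>"
  have C: "?C \<in> max_atlas (total_space M D)" using f by (intro E.atlas_max) (auto simp: atlas_total_space)
  let ?W = "cmap c ` cdom c \<times> (UNIV :: 'k set)"
  have W: "open ?W" using open_image[OF frame_max[OF f]] by (simp add: open_Times)
  note Wimg = image_frame_chart_dom[OF f]
  let ?F = "\<lambda>z. (\<rho> (fst z) (snd z), b)"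
  have F: "smooth_on ?W ?F" by (rule smooth_on_Pair[OF frame_smooth_family[OF f] smooth_on_const W])
  have "cmap ?C e \<in> ?W" using e Wimg by blast
  from ode_solution_exists[OF W this F] obtain a z where a: "a > 0" and z0: "z 0 = cmap ?C e"
    and z: "\<And>t. t \<in> {-a<..<a} \<Longrightarrow> z t \<in> ?W \<and> (z has_vector_derivative ?F (z t)) (at t)"
    by blast
  let ?I = "{-a<..<a}"
  have I: "open ?I" "is_interval ?I" "0 \<in> ?I" using a by (simp_all add: is_interval_oo)
  define \<gamma> where "\<gamma> t = chart_inv ?C (z t)" for t
  have \<gamma>mem: "\<gamma> t \<in> cdom ?C" "cmap ?C (\<gamma> t) = z t" if "t \<in> ?I" for t
  proof -
    have "z t \<in> cmap ?C ` cdom ?C" using z[OF that] unfolding Wimg by simp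
    then show "\<gamma> t \<in> cdom ?C" "cmap ?C (\<gamma> t) = z t" using E.inv_cmap[OF C] by (auto simp: \<gamma>_def)
  qed
  have smooth: "smooth_curve (total_space M D :: (_, 'e \<times> 'k) mfd) ?I \<gamma>"
    unfolding \<gamma>_def
  proof (rule E.smooth_curve_in_chart[OF C I(1)])
    show "smooth_on ?I z" by (rule smooth_on_ode_solution[OF I(1) F z])
    show "z t \<in> cmap ?C ` cdom ?C" if "t \<in> ?I" for t using z[OF that] unfolding Wimg by simp
  qed
  have vel: "velocity (total_space M D) \<gamma> t = tvec_of (total_space M D) ?C (\<gamma> t) (?F (z t))"
    and velM: "velocity M (\<lambda>s. fst (\<gamma> s)) t = tvec_of M c (fst (\<gamma> t)) (\<rho> (fst (z t)) (snd (z t)))"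
    if t: "t \<in> ?I" for t
  proof -
    have v: "(z has_vector_derivative ?F (z t)) (at t)" using z[OF t] by blast
    have "((\<lambda>s. cmap ?C (\<gamma> s)) has_vector_derivative ?F (z t)) (at t)"
      by (rule has_vector_derivative_transform_within_open[OF v I(1) t]) (simp add: \<gamma>mem)
    then show "velocity (total_space M D) \<gamma> t = tvec_of (total_space M D) ?C (\<gamma> t) (?F (z t))"
      using \<gamma>mem(1) by (intro E.velocity_eq_tvec_of[OF C I(1) t])
    have "((\<lambda>s. fst (z s)) has_vector_derivative \<rho> (fst (z t)) (snd (z t))) (at t)"
      using bounded_linear.has_vector_derivative[OF bounded_linear_fst v] by simp
    then have "((\<lambda>s. cmap c (fst (\<gamma> s))) has_vector_derivative \<rho> (fst (z t)) (snd (z t))) (at t)"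
      by (rule has_vector_derivative_transform_within_open[OF _ I(1) t])
         (simp add: fst_cmap_frame_chart[of D c \<rho>, symmetric] \<gamma>mem)
    then show "velocity M (\<lambda>s. fst (\<gamma> s)) t = tvec_of M c (fst (\<gamma> t)) (\<rho> (fst (z t)) (snd (z t)))"
      using \<gamma>mem(1) by (intro velocity_eq_tvec_of[OF frame_max[OF f] I(1) t]) (simp_all add: cdom_frame_chart)
  qed
  \<comment> \<open>The frame coordinates of the curve are \<open>snd (z t)\<close>, so its value is
    the vector with components \<open>\<rho>(x) y\<close>; the first half of the equation says that
    these are the components of the base velocity.\<close>
  have "\<gamma> t = velocity M (\<lambda>s. fst (\<gamma> s)) t" if t: "t \<in> ?I" for t
  proof -
    have "cmap c (fst (\<gamma> t)) = fst (z t)" using \<gamma>mem(2)[OF t] fst_cmap_frame_chart[of D c \<rho> "\<gamma> t"] by simp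
    then show ?thesis
      using frame_chart_eq[OF f \<gamma>mem(1)[OF t]] by (simp add: velM[OF t] frame_vec_def \<gamma>mem(2)[OF t])
  qed
  then have adm: "admissible_curve M (total_space M D :: (_, 'e \<times> 'k) mfd) ?I \<gamma>"
    using smooth by (simp add: admissible_curve_def)
  have "\<gamma> 0 = e" using E.inv_cmap[OF C e] by (simp add: \<gamma>_def z0)
  then have "velocity (total_space M D) \<gamma> 0 = tvec_of (total_space M D) ?C e
      (\<rho> (cmap c (fst e)) (snd (cmap ?C e)), b)"
    using vel[OF I(3)] by (simp add: z0 fst_cmap_frame_chart)
  with I adm that show thesis by blast
qed

text \<open>Admissibility at time 0 alone forces the equation between base velocity and frame
  coordinates. Conversely the remaining component \<open>snd (snd v C)\<close>, with
  \<open>C\<close> the frame chart, is unconstrained and serves as the prescribed \<open>y'\<close>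
  of an admissible curve.\<close>

lemma mem_D2_iff:
  fixes \<rho> :: "'e \<Rightarrow> 'k::euclidean_space \<Rightarrow> 'e"
  assumes D: "distribution TYPE('k) M D" and f: "local_frame M D c \<rho>"
    and v: "v \<in> points (tangent_bundle (total_space M D))" "fst v \<in> cdom (frame_chart D c \<rho>)"
  shows "v \<in> D2 M D \<longleftrightarrow> fst (snd v (frame_chart D c \<rho>))
    = \<rho> (cmap c (fst (fst v))) (snd (cmap (frame_chart D c \<rho>) (fst v)))"
proof -
  interpret E: atlas_mfd "total_space M D :: (_, 'e \<times> 'k) mfd" by (rule atlas_mfd_total_space[OF D])
  let ?C = "frame_chart D c \<rho>"
  have C: "?C \<in> atlas (total_space M D)" using f by (auto simp: atlas_total_space)
  show ?thesis
  proof
    assume "v \<in> D2 M D"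
    then obtain \<gamma> I where I: "open I" "0 \<in> I" and adm: "admissible_curve M (total_space M D :: (_, 'e \<times> 'k) mfd) I \<gamma>"
      and v\<gamma>: "v = velocity (total_space M D) \<gamma> 0"
      unfolding D2_def by blast
    have e: "fst v = \<gamma> 0" by (simp add: v\<gamma> velocity_def)
    have mem: "\<gamma> 0 \<in> cdom ?C" using v(2) e by simp
    have \<gamma>: "smooth_curve (total_space M D :: (_, 'e \<times> 'k) mfd) I \<gamma>"
      "\<gamma> 0 = velocity M (\<lambda>s. fst (\<gamma> s)) 0"
      using adm I(2) by (auto simp: admissible_curve_def)
    obtain \<zeta> where \<zeta>: "v = tvec_of (total_space M D) ?C (\<gamma> 0) \<zeta>"
      "velocity M (\<lambda>s. fst (\<gamma> s)) 0 = tvec_of M c (fst (\<gamma> 0)) (fst \<zeta>)"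
      unfolding v\<gamma> by (rule velocity_total_space[OF D f I \<gamma>(1) mem])
    have "tvec_of M c (fst (\<gamma> 0)) (fst \<zeta>) = frame_vec c \<rho> (fst (\<gamma> 0)) (snd (cmap ?C (\<gamma> 0)))"
      using \<gamma>(2) \<zeta>(2) frame_chart_eq[OF f mem] by metis
    then have "fst \<zeta> = \<rho> (cmap c (fst (\<gamma> 0))) (snd (cmap ?C (\<gamma> 0)))"
      unfolding frame_vec_def using tvec_of_inject[OF frame_max[OF f]] mem by (metis cdom_frame_chart)
    moreover have "snd v ?C = \<zeta>" unfolding \<zeta>(1) by (rule E.snd_tvec_of_self[OF C mem])
    ultimately show "fst (snd v ?C) = \<rho> (cmap c (fst (fst v))) (snd (cmap ?C (fst v)))" by (simp add: e)
  next
    assume eq: "fst (snd v ?C) = \<rho> (cmap c (fst (fst v))) (snd (cmap ?C (fst v)))"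
    have "v \<in> cdom (E.tchart ?C)" using v by (simp add: E.cdom_tchart)
    then have "v = tvec_of (total_space M D) ?C (fst v) (snd v ?C)" by (rule E.tchart_eq[OF C])
    also have "snd v ?C = (\<rho> (cmap c (fst (fst v))) (snd (cmap ?C (fst v))), snd (snd v ?C))"
      by (simp add: eq[symmetric])
    finally have veq: "v = tvec_of (total_space M D) ?C (fst v)
        (\<rho> (cmap c (fst (fst v))) (snd (cmap ?C (fst v))), snd (snd v ?C))" .
    obtain I \<gamma> where "open I" "is_interval I" "0 \<in> I" "admissible_curve M (total_space M D :: (_, 'e \<times> 'k) mfd) I \<gamma>"
      "velocity (total_space M D) \<gamma> 0 = v"
      using ex_admissible_curve[OF D f v(2), of "snd (snd v ?C)"] veq by metis
    then show "v \<in> D2 M D" unfolding D2_def by blast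
  qed
qed

lemma D2_subset:
  assumes D: "distribution TYPE('k::euclidean_space) M D"
  shows "D2 M D \<subseteq> points (tangent_bundle (total_space M D :: (_, 'e \<times> 'k) mfd))"
proof
  interpret E: atlas_mfd "total_space M D :: (_, 'e \<times> 'k) mfd" by (rule atlas_mfd_total_space[OF D])
  fix v :: "(('m, 'e) tvec, 'e \<times> 'k) tvec" assume "v \<in> D2 M D"
  then obtain \<gamma> I where I: "open I" "0 \<in> I" and adm: "admissible_curve M (total_space M D :: (_, 'e \<times> 'k) mfd) I \<gamma>"
    and v\<gamma>: "v = velocity (total_space M D) \<gamma> 0"
    unfolding D2_def by blast
  have \<gamma>: "smooth_curve (total_space M D :: (_, 'e \<times> 'k) mfd) I \<gamma>"
    using adm by (simp add: admissible_curve_def)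
  then have "\<gamma> 0 \<in> points (total_space M D :: (_, 'e \<times> 'k) mfd)" using I(2) by (auto simp: smooth_curve_def)
  then obtain c and \<rho> :: "'e \<Rightarrow> 'k \<Rightarrow> 'e" where f: "local_frame M D c \<rho>" "\<gamma> 0 \<in> cdom (frame_chart D c \<rho>)"
    using E.ex_chart by (fastforce simp: atlas_total_space)
  obtain \<zeta> where "v = tvec_of (total_space M D) (frame_chart D c \<rho>) (\<gamma> 0) \<zeta>"
    unfolding v\<gamma> by (rule velocity_total_space[OF D f(1) I \<gamma> f(2)])
  moreover have "frame_chart D c \<rho> \<in> max_atlas (total_space M D)"
    using f(1) by (intro E.atlas_max) (auto simp: atlas_total_space)
  ultimately show "v \<in> points (tangent_bundle (total_space M D))"
    using E.tvec_of_mem f(2) by simp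
qed

lemma submanifold_D2:
  assumes D: "distribution TYPE('k::euclidean_space) M D"
  shows "submanifold TYPE('e \<times> 'k \<times> 'k) (tangent_bundle (total_space M D :: (_, 'e \<times> 'k) mfd)) (D2 M D)"
proof -
  interpret E: atlas_mfd "total_space M D :: (_, 'e \<times> 'k) mfd" by (rule atlas_mfd_total_space[OF D])
  interpret TE: atlas_mfd "tangent_bundle (total_space M D :: (_, 'e \<times> 'k) mfd)"
    by (rule E.atlas_mfd_tangent_bundle)
  have "\<exists>d (J :: 'e \<times> 'k \<times> 'k \<Rightarrow> ('e \<times> 'k) \<times> ('e \<times> 'k)). TE.slice_chart (D2 M D) d J \<and> v \<in> cdom d"
    if v: "v \<in> D2 M D" for v
  proof -
    have vT: "v \<in> points (tangent_bundle (total_space M D :: (_, 'e \<times> 'k) mfd))" using D2_subset[OF D] v by blast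
    then obtain c and \<rho> :: "'e \<Rightarrow> 'k \<Rightarrow> 'e" where f: "local_frame M D c \<rho>" and vc: "fst v \<in> cdom (frame_chart D c \<rho>)"
      using E.ex_chart[of "fst v"] unfolding E.mem_tangent_bundle atlas_total_space by blast
    let ?C = "frame_chart D c \<rho>"
    have C: "?C \<in> atlas (total_space M D)" using f by (auto simp: atlas_total_space)
    let ?T = "E.tchart ?C"
    have T: "?T \<in> max_atlas (tangent_bundle (total_space M D))"
      by (rule TE.atlas_max) (use C in \<open>simp add: E.atlas_tangent_bundle\<close>)
    let ?V = "cmap c ` cdom c \<times> (UNIV :: 'k set)" and ?r = "\<lambda>z. \<rho> (fst z) (snd z)"
    let ?W = "?V \<times> (UNIV :: ('e \<times> 'k) set)"
    have V: "open ?V" using open_image[OF frame_max[OF f]] by (simp add: open_Times)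
    have W: "open ?W" using V by (simp add: open_Times)
    have Timg: "cmap ?T ` cdom ?T = ?W"
    proof -
      have "cdom ?T = {w \<in> cdom ?T. fst w \<in> cdom ?C}" by (auto simp: E.cdom_tchart)
      then show ?thesis using E.image_tchart[OF C order_refl] image_frame_chart_dom[OF f] by simp
    qed
    \<comment> \<open>The shear depends only on the base point in the total space, so adding
      \<open>?r\<close> back inverts it and \<open>?W\<close> is preserved.\<close>
    let ?\<Phi> = "\<lambda>z. (fst z, (fst (snd z) - ?r (fst z), snd (snd z)))"
    let ?\<Psi> = "\<lambda>z. (fst z, (fst (snd z) + ?r (fst z), snd (snd z)))"
    have r: "smooth_on ?W (\<lambda>z. ?r (fst z))"
      by (rule smooth_on_compose[OF frame_smooth_family[OF f] smooth_on_linear[OF linear_fst] W]) auto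
    note sm = W r smooth_on_linear[OF linear_fst] smooth_on_fst[OF smooth_on_linear[OF linear_snd]]
      smooth_on_snd[OF smooth_on_linear[OF linear_snd]]
    have \<Phi>: "smooth_on ?W ?\<Phi>" by (intro smooth_on_Pair smooth_on_diff sm)
    have \<Psi>: "smooth_on ?W ?\<Psi>" by (intro smooth_on_Pair smooth_on_add sm)
    have img: "?\<Phi> ` ?W = ?W"
    proof (intro equalityI subsetI)
      fix z assume "z \<in> ?W"
      then have "?\<Psi> z \<in> ?W" by (simp add: mem_Times_iff)
      then show "z \<in> ?\<Phi> ` ?W" by (rule image_eqI[rotated]) simp
    next
      fix z assume "z \<in> ?\<Phi> ` ?W"
      then obtain z' where "z' \<in> ?W" "z = ?\<Phi> z'" by (rule imageE)
      then show "z \<in> ?W" by (simp add: mem_Times_iff)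
    qed
    define d where "d = Chart {w \<in> cdom ?T. cmap ?T w \<in> ?W} (\<lambda>w. ?\<Phi> (cmap ?T w))"
    have d: "d \<in> max_atlas (tangent_bundle (total_space M D))"
      unfolding d_def
    proof (rule TE.max_atlas_postcompose[OF T W _ \<Phi>, where \<Psi> = ?\<Psi>])
      show "?W \<subseteq> cmap ?T ` cdom ?T" unfolding Timg by (rule order_refl)
      show "open (?\<Phi> ` ?W)" "smooth_on (?\<Phi> ` ?W) ?\<Psi>" unfolding img by (rule W, rule \<Psi>)
    qed simp
    have cdom_d: "cdom d = cdom ?T" using Timg unfolding d_def chart.sel by blast
    \<comment> \<open>The straightened set has vanishing second \<open>'e\<close> component, which
      leaves the coordinates \<open>(q, y, y')\<close> as the model space.\<close>
    let ?J = "\<lambda>(q, y, b). ((q, y), (0, b)) :: ('e \<times> 'k) \<times> ('e \<times> 'k)"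
    have J: "linear ?J" "inj ?J" by (auto intro!: linearI injI)
    have rangeJ: "z \<in> range ?J \<longleftrightarrow> fst (snd z) = 0" for z
    proof
      assume "fst (snd z) = 0"
      then have "z = ?J (fst (fst z), snd (fst z), snd (snd z))" by (simp add: prod_eq_iff)
      then show "z \<in> range ?J" by blast
    qed auto
    have iff: "w \<in> D2 M D \<longleftrightarrow> cmap d w \<in> range ?J" if w: "w \<in> cdom d" for w
    proof -
      have w': "w \<in> points (tangent_bundle (total_space M D))" "fst w \<in> cdom ?C"
        using w by (simp_all add: cdom_d E.cdom_tchart)
      have "cmap d w \<in> range ?J \<longleftrightarrow> fst (snd w ?C) = \<rho> (cmap c (fst (fst w))) (snd (cmap ?C (fst w)))"
        unfolding rangeJ by (simp add: d_def E.cmap_tchart fst_cmap_frame_chart)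
      then show ?thesis using mem_D2_iff[OF D f w'] by simp
    qed
    have "cmap d ` (D2 M D \<inter> cdom d) = cmap d ` cdom d \<inter> range ?J" using iff by blast
    then have "TE.slice_chart (D2 M D) d ?J" using d J by (simp add: TE.slice_chart_def)
    moreover have "v \<in> cdom d" using vT vc by (simp add: cdom_d E.cdom_tchart)
    ultimately show ?thesis by blast
  qed
  then show ?thesis unfolding TE.submanifold_iff using D2_subset[OF D] by blast
qed

end

lemma smooth_manifold_atlas_mfd: "smooth_manifold M \<Longrightarrow> atlas_mfd M"
  unfolding smooth_manifold_def by unfold_locales blast+

theorem proposition4p1:
  fixes Q :: "('q, 'e::euclidean_space) mfd"
    and D :: "('q, 'e) tvec set"
    and L :: "(('q, 'e) tvec, 'e \<times> 'k::euclidean_space) tvec \<Rightarrow> real"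
  assumes "smooth_manifold Q"
    and "distribution TYPE('k) Q D"
    and "\<not> integrable_distribution TYPE('k) Q D"
    and "smooth_fun (D2_mfd Q D) L"
  shows "lagrangian_submanifold TYPE(('e \<times> 'k) \<times> ('e \<times> 'k))
           (cotangent_bundle (tangent_bundle (total_space Q D)))
           (canonical_symplectic (tangent_bundle (total_space Q D)))
           (Sigma_L Q D L)"
proof -
  interpret Q: atlas_mfd Q by (rule smooth_manifold_atlas_mfd[OF assms(1)])
  interpret E: atlas_mfd "total_space Q D :: (_, 'e \<times> 'k) mfd" by (rule Q.atlas_mfd_total_space[OF assms(2)])
  interpret TE: atlas_mfd "tangent_bundle (total_space Q D :: (_, 'e \<times> 'k) mfd)"
    by (rule E.atlas_mfd_tangent_bundle)
  \<comment> \<open>\<open>D2_mfd\<close> is by definition the induced structure, so both sets are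
    cut out by the same condition.\<close>
  have "Sigma_L Q D L = TE.generated_set TYPE('e \<times> 'k \<times> 'k) (D2 Q D) L"
    by (simp add: Sigma_L_def TE.generated_set_def D2_mfd_def)
  then show ?thesis
    using TE.lagrangian_generated_set[OF Q.submanifold_D2[OF assms(2)]] assms(4) by (simp add: D2_mfd_def)
qed

end
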